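(* Let $\sigma>0$, let $\nu,\mu\in\mathbb{T}$ with $\nu^2=\mu^2=-1$, and let $\psi_0(t)=e^{-\frac{\sigma}{2}t^2}$. The transform $$\mathcal{S}^{\sigma,\nu,\mu}_0(\varphi):=\left(\frac{\sigma}{\pi}\right)^{1/4}\mathcal{V}^{\sigma,\nu,\mu}_{\mathbb{R},\mathbb{T}}(\varphi,\psi_0)$$ defines an isometry from $L^2_{\mathbb{T}}(\mathbb{R})$ onto the Hilbert space $\mathcal{M}^{2,\sigma}(\mathbb{T}^e_{\nu,\mu})$ (equipped with the inner product of $L^2_{\mathbb{T}}(\mathbb{T})$). Moreover, the functions $$\varphi^{\sigma,\nu,\mu}_n(Z)=\left(\frac{\sigma}{\pi}\right)^{3/4}\sigma^n\,(Z^e_{\nu,\mu})^n\,e^{-\frac{\sigma}{2}|Z^e_{\nu,\mu}|^2},\qquad n=0,1,2,\dots,$$ form an orthogonal basis of $\mathcal{M}^{2,\sigma}(\mathbb{T}^e_{\nu,\mu})$, with norm given by $$\|\varphi^{\sigma,\nu,\mu}_n\|^2_{L^2_{\mathbb{T}}(\mathbb{T})}=\left(\frac{\pi}{\sigma}\right)^{1/2}2^n\sigma^n n!.$$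
   Context: Bicomplex numbers: $\mathbb{T}=\{Z=z_1+jz_2:\ z_1,z_2\in\mathbb{C}\}$ with $i^2=j^2=-1$, $ij=ji$. The idempotents $e_\pm=\frac{1\pm ij}{2}$ satisfy $e_\pm^2=e_\pm$, $e_+e_-=0$, $e_++e_-=1$; every bicomplex number is uniquely $ae_++be_-$ with $a,b\in\mathbb{C}$. Conjugation: $(ae_++be_-)^*=\bar a e_++\bar b e_-$. Modulus: $|ae_++be_-|^2=\frac12(|a|^2+|b|^2)$. Exponentials are computed componentwise. Function spaces: $L^2_{\mathbb{T}}(X)$ is the space of functions $f=f^+e_++f^-e_-$ with $f^\pm\in L^2_{\mathbb{C}}(X)$, with $\mathbb{T}$-valued inner product $\langle f,g\rangle=\int_X f g^*\,d\lambda$ and norm $\|f\|^2=|\langle f,f\rangle|$. On $X=\mathbb{R}$ the measure is Lebesgue; on $X=\mathbb{T}$, writing $Z=z_1+jz_2$, $z_\ell=x_\ell+iy_\ell$, the measure is normalized as $d\lambda(Z)=\frac14\,dx_1dy_1dx_2dy_2$. An orthogonal basis of a $\mathbb{T}$-Hilbert space is a family with pairwise vanishing $\mathbb{T}$-valued inner products such that every element has a unique convergent expansion with coefficients in $\mathbb{T}$. Imaginary units: $\nu,\mu\in\mathbb{T}$ with $\nu^2=\mu^2=-1$ (each is one of $\pm i,\pm j$). There are signs with $\nu e_+=\pm i e_+$, $\mu e_-=\pm i e_-$; inside the $e_+$ (resp. $e_-$) component, $\nu$ (resp. $\mu$) is identified with the corresponding $\pm i\in\mathbb{C}$. For $Z=z_1+jz_2\in\mathbb{T}$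 with $z_\ell=x_\ell+iy_\ell$, $x_\ell,y_\ell\in\mathbb{R}$ ($\ell=1,2$), put $z_{1_\nu}=x_1+\nu y_1$, $z_{2_\mu}=x_2+\mu y_2$ and $Z^e_{\nu,\mu}=z_{1_\nu}e_++z_{2_\mu}e_-$, so $|Z^e_{\nu,\mu}|^2=\frac12(x_1^2+y_1^2+x_2^2+y_2^2)$. Transform: with $X_e=x_1e_++x_2e_-$, $Y_e=y_1e_++y_2e_-$, $X_e^\dagger=x_2e_++x_1e_-$, $Y_e^\dagger=y_2e_++y_1e_-$, $$\mathcal{V}^{\sigma,\nu,\mu}_{\mathbb{R},\mathbb{T}}(\varphi,\psi)(Z)=\frac{\sigma}{\pi}\,e^{-\frac{\sigma}{4}\left((X_e^\dagger)^2+(Y_e^\dagger)^2\right)}\int_{\mathbb{R}}\varphi(t)\,e^{\sigma(\nu e_++\mu e_-)\left(t-\frac{X_e}{2}\right)Y_e}\left(\psi^+(t-x_1)e_++\psi^-(t-x_2)e_-\right)^*dt .$$ Target space: for $\alpha>0$ and $\tau\in\{\nu,\mu\}$, the Bargmann space $\mathcal{F}^{2,\alpha}(\mathbb{C}_\tau)$ is the space of entire functions $F$ of the variable $z_\tau=x+\tau y$ with $\int|F|^2e^{-\alpha|z_\tau|^2}dxdy<\infty$ (where $\tau=\nu$ is identified with the number $\pm i\in\mathbb{C}$ for which $\nu e_+=\pm i e_+$, and $\tau=\mu$ with the number $\pm i\in\mathbb{C}$ for which $\mu e_-=\pm i e_-$). Then $$\mathcal{M}^{2,\sigma}(\mathbb{T}^e_{\nu,\mu})=\left\{Z\mapsto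 e^{-\frac{\sigma}{2}|Z^e_{\nu,\mu}|^2}\left(F(z_{1_\nu})e_++G(z_{2_\mu})e_-\right):\ F\in\mathcal{F}^{2,\sigma/2}(\mathbb{C}_\nu),\ G\in\mathcal{F}^{2,\sigma/2}(\mathbb{C}_\mu)\right\}.$$ *)

theory Defs
  imports "HOL-Analysis.Analysis"
begin

section \<open>Bicomplex numbers\<close>

text \<open>\<open>Bicomplex z\<^sub>1 z\<^sub>2\<close> stands for $z_1 + j z_2$, where $j^2 = -1$ and $ij = ji$.\<close>

codatatype bicomplex = Bicomplex (bc1: complex) (bc2: complex)

lemma bicomplex_eqI: "bc1 Z = bc1 W \<Longrightarrow> bc2 Z = bc2 W \<Longrightarrow> Z = W"
  by (rule bicomplex.expand) simp

lemma bicomplex_eq_iff: "Z = W \<longleftrightarrow> bc1 Z = bc1 W \<and> bc2 Z = bc2 W"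
  by (auto intro: bicomplex_eqI)

instantiation bicomplex :: comm_ring_1
begin

primcorec zero_bicomplex where "bc1 0 = 0" | "bc2 0 = 0"

primcorec one_bicomplex where "bc1 1 = 1" | "bc2 1 = 0"

primcorec plus_bicomplex where
  "bc1 (Z + W) = bc1 Z + bc1 W" | "bc2 (Z + W) = bc2 Z + bc2 W"

primcorec uminus_bicomplex where
  "bc1 (- Z) = - bc1 Z" | "bc2 (- Z) = - bc2 Z"

primcorec minus_bicomplex where
  "bc1 (Z - W) = bc1 Z - bc1 W" | "bc2 (Z - W) = bc2 Z - bc2 W"

primcorec times_bicomplex where
  "bc1 (Z * W) = bc1 Z * bc1 W - bc2 Z * bc2 W"
| "bc2 (Z * W) = bc1 Z * bc2 W + bc2 Z * bc1 W"

instance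
  by standard (simp_all add: bicomplex_eq_iff algebra_simps)

end

instantiation bicomplex :: real_algebra_1
begin

primcorec scaleR_bicomplex where
  "bc1 (scaleR r Z) = scaleR r (bc1 Z)" | "bc2 (scaleR r Z) = scaleR r (bc2 Z)"

instance
  by standard (simp_all add: bicomplex_eq_iff algebra_simps)

end

definition of_cx :: "complex \<Rightarrow> bicomplex"
  where "of_cx a = Bicomplex a 0"

definition bc_j :: bicomplex
  where "bc_j = Bicomplex 0 1"

definition e_plus :: bicomplex
  where "e_plus = (1/2) *\<^sub>R (1 + of_cx \<i> * bc_j)"

definition e_minus :: bicomplex
  where "e_minus = (1/2) *\<^sub>R (1 - of_cx \<i> * bc_j)"

text \<open>The coordinates in the idempotent decomposition \<open>Z = a e\<^sub>+ + b e\<^sub>-\<close>;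
  see \<open>idem_decomp\<close> and \<open>idem_unique\<close>.\<close>

definition idem_plus :: "bicomplex \<Rightarrow> complex"
  where "idem_plus Z = bc1 Z - \<i> * bc2 Z"

definition idem_minus :: "bicomplex \<Rightarrow> complex"
  where "idem_minus Z = bc1 Z + \<i> * bc2 Z"

lemma idem_decomp: "Z = of_cx (idem_plus Z) * e_plus + of_cx (idem_minus Z) * e_minus"
  by (simp add: bicomplex_eq_iff of_cx_def bc_j_def e_plus_def e_minus_def idem_plus_def
      idem_minus_def complex_eq_iff field_simps)

lemma idem_combine [simp]:
  "idem_plus (of_cx a * e_plus + of_cx b * e_minus) = a"
  "idem_minus (of_cx a * e_plus + of_cx b * e_minus) = b"
  by (simp_all add: of_cx_def bc_j_def e_plus_def e_minus_def idem_plus_def idem_minus_def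
      complex_eq_iff field_simps)

lemma idem_unique:
  "Z = of_cx a * e_plus + of_cx b * e_minus \<longleftrightarrow> a = idem_plus Z \<and> b = idem_minus Z"
  using idem_decomp by auto

lemma idem_plus_times [simp]: "idem_plus (Z * W) = idem_plus Z * idem_plus W"
  and idem_minus_times [simp]: "idem_minus (Z * W) = idem_minus Z * idem_minus W"
  by (simp_all add: idem_plus_def idem_minus_def algebra_simps)

text \<open>The conjugation \<open>Z\<^sup>*\<close> and the exponential, both acting on idempotent coordinates.\<close>

definition bc_cnj :: "bicomplex \<Rightarrow> bicomplex"
  where "bc_cnj Z = of_cx (cnj (idem_plus Z)) * e_plus + of_cx (cnj (idem_minus Z)) * e_minus"

definition bc_exp :: "bicomplex \<Rightarrow> bicomplex"
  where "bc_exp Z = of_cx (exp (idem_plus Z)) * e_plus + of_cx (exp (idem_minus Z)) * e_minus"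

text \<open>With the modulus as norm, $1, i, j, ij$ is an orthonormal basis over the reals, so
  \<open>lborel\<close> and \<open>lebesgue\<close> on this type are the measure $dx_1 dy_1 dx_2 dy_2$.\<close>

lemma bicomplex_modulus_aux:
  "((cmod (idem_plus Z))\<^sup>2 + (cmod (idem_minus Z))\<^sup>2) / 2 = bc1 Z \<bullet> bc1 Z + bc2 Z \<bullet> bc2 Z"
  unfolding idem_plus_def idem_minus_def cmod_power2 inner_complex_def
  by (simp add: power2_eq_square algebra_simps)

instantiation bicomplex :: real_inner
begin

definition norm_bicomplex :: "bicomplex \<Rightarrow> real"
  where "norm_bicomplex Z = sqrt (((cmod (idem_plus Z))\<^sup>2 + (cmod (idem_minus Z))\<^sup>2) / 2)"

definition inner_bicomplex :: "bicomplex \<Rightarrow> bicomplex \<Rightarrow> real"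
  where "inner_bicomplex Z W = bc1 Z \<bullet> bc1 W + bc2 Z \<bullet> bc2 W"

definition sgn_bicomplex :: "bicomplex \<Rightarrow> bicomplex"
  where "sgn_bicomplex Z = Z /\<^sub>R norm Z"

definition dist_bicomplex :: "bicomplex \<Rightarrow> bicomplex \<Rightarrow> real"
  where "dist_bicomplex Z W = norm (Z - W)"

definition uniformity_bicomplex :: "(bicomplex \<times> bicomplex) filter"
  where "uniformity_bicomplex = (INF e\<in>{0 <..}. principal {(Z, W). dist Z W < e})"

definition open_bicomplex :: "bicomplex set \<Rightarrow> bool"
  where "open_bicomplex U \<longleftrightarrow> (\<forall>Z\<in>U. eventually (\<lambda>(Z', W). Z' = Z \<longrightarrow> W \<in> U) uniformity)"

instance
proof
  fix X Y Z :: bicomplex and r :: real and U :: "bicomplex set"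
  show "inner X Y = inner Y X"
    by (simp add: inner_bicomplex_def inner_commute)
  show "inner (X + Y) Z = inner X Z + inner Y Z"
    by (simp add: inner_bicomplex_def inner_add_left)
  show "inner (r *\<^sub>R X) Y = r * inner X Y"
    by (simp add: inner_bicomplex_def distrib_left)
  show "0 \<le> inner X X"
    by (simp add: inner_bicomplex_def)
  show "inner X X = 0 \<longleftrightarrow> X = 0"
    by (simp add: inner_bicomplex_def add_nonneg_eq_0_iff bicomplex_eq_iff)
  show "norm X = sqrt (inner X X)"
    by (simp only: norm_bicomplex_def inner_bicomplex_def bicomplex_modulus_aux)
qed (rule sgn_bicomplex_def dist_bicomplex_def uniformity_bicomplex_def open_bicomplex_def)+

end

instantiation bicomplex :: euclidean_space
begin

definition Basis_bicomplex :: "bicomplex set"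
  where "Basis_bicomplex = {1, of_cx \<i>, bc_j, of_cx \<i> * bc_j}"

lemma inner_Bicomplex:
  "inner (Bicomplex a b) (Bicomplex c d) = Re a * Re c + Im a * Im c + (Re b * Re d + Im b * Im d)"
  by (simp add: inner_bicomplex_def inner_complex_def)

lemma Basis_bicomplex_eq:
  "Basis = {Bicomplex 1 0, Bicomplex \<i> 0, Bicomplex 0 1, Bicomplex 0 \<i>}"
proof -
  have "(1 :: bicomplex) = Bicomplex 1 0" "of_cx \<i> = Bicomplex \<i> 0" "bc_j = Bicomplex 0 1"
    "of_cx \<i> * bc_j = Bicomplex 0 \<i>"
    by (simp_all add: bicomplex_eq_iff of_cx_def bc_j_def)
  then show ?thesis by (simp only: Basis_bicomplex_def)
qed

instance
proof
  fix u v Z :: bicomplex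
  show "(Basis :: bicomplex set) \<noteq> {}" and "finite (Basis :: bicomplex set)"
    by (simp_all add: Basis_bicomplex_eq)
  show "inner u v = (if u = v then 1 else 0)" if "u \<in> Basis" "v \<in> Basis"
    using that unfolding Basis_bicomplex_eq
    by (elim insertE emptyE; simp add: inner_Bicomplex)
  show "(\<forall>u\<in>Basis. inner Z u = 0) \<longleftrightarrow> Z = 0"
    unfolding Basis_bicomplex_eq
    by (simp add: inner_bicomplex_def inner_complex_def)
      (auto simp: bicomplex_eq_iff complex_eq_iff)
qed

end

section \<open>Spaces of bicomplex-valued functions\<close>

text \<open>Elements are functions rather than classes; the inner product and the norm do not
  distinguish functions that agree almost everywhere. The norm is
  $\|f\| = |\langle f, f\rangle|^{1/2}$, with the bicomplex modulus.\<close>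

definition L2_complex :: "'a measure \<Rightarrow> ('a \<Rightarrow> complex) set"
  where "L2_complex M = {f \<in> borel_measurable M. integrable M (\<lambda>x. (cmod (f x))\<^sup>2)}"

definition L2_bc :: "'a measure \<Rightarrow> ('a \<Rightarrow> bicomplex) set"
  where "L2_bc M =
    {f. (\<lambda>x. idem_plus (f x)) \<in> L2_complex M \<and> (\<lambda>x. idem_minus (f x)) \<in> L2_complex M}"

definition inner_bc :: "'a measure \<Rightarrow> ('a \<Rightarrow> bicomplex) \<Rightarrow> ('a \<Rightarrow> bicomplex) \<Rightarrow> bicomplex"
  where "inner_bc M f g = (\<integral>x. f x * bc_cnj (g x) \<partial>M)"

definition norm_bc :: "'a measure \<Rightarrow> ('a \<Rightarrow> bicomplex) \<Rightarrow> real"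
  where "norm_bc M f = sqrt (norm (inner_bc M f f))"

definition lebesgue_bc :: "bicomplex measure"
  where "lebesgue_bc = density lebesgue (\<lambda>_. 1/4)"

text \<open>A space of genuine functions inside \<open>L2_bc M\<close> that is a Hilbert space over the bicomplex
  numbers: a complete submodule on which the norm is definite.\<close>

definition bc_hilbert :: "'a measure \<Rightarrow> ('a \<Rightarrow> bicomplex) set \<Rightarrow> bool"
  where "bc_hilbert M H \<longleftrightarrow>
    H \<subseteq> L2_bc M \<and>
    (\<lambda>_. 0) \<in> H \<and>
    (\<forall>f\<in>H. \<forall>g\<in>H. (\<lambda>x. f x + g x) \<in> H) \<and>
    (\<forall>c. \<forall>f\<in>H. (\<lambda>x. c * f x) \<in> H) \<and>
    (\<forall>f\<in>H. norm_bc M f = 0 \<longrightarrow> f = (\<lambda>_. 0)) \<and>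
    (\<forall>u. (\<forall>n::nat. u n \<in> H) \<and>
         (\<forall>e>0. \<exists>N. \<forall>m\<ge>N. \<forall>n\<ge>N. norm_bc M (\<lambda>x. u m x - u n x) < e) \<longrightarrow>
         (\<exists>f\<in>H. (\<lambda>n. norm_bc M (\<lambda>x. u n x - f x)) \<longlonglongrightarrow> 0))"

definition bc_orthogonal_basis ::
    "'a measure \<Rightarrow> ('a \<Rightarrow> bicomplex) set \<Rightarrow> (nat \<Rightarrow> 'a \<Rightarrow> bicomplex) \<Rightarrow> bool"
  where "bc_orthogonal_basis M H b \<longleftrightarrow>
    (\<forall>n. b n \<in> H) \<and>
    (\<forall>m n. m \<noteq> n \<longrightarrow> inner_bc M (b m) (b n) = 0) \<and>
    (\<forall>f\<in>H. \<exists>!c. (\<lambda>N. norm_bc M (\<lambda>x. f x - (\<Sum>n<N. c n * b n x))) \<longlonglongrightarrow> 0)"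

text \<open>The second conjunct makes \<open>S\<close> a map on classes of functions modulo equality almost
  everywhere; on such classes injectivity follows from norm preservation.\<close>

definition bc_isometry_onto ::
    "'a measure \<Rightarrow> 'b measure \<Rightarrow> ('b \<Rightarrow> bicomplex) set \<Rightarrow>
     (('a \<Rightarrow> bicomplex) \<Rightarrow> 'b \<Rightarrow> bicomplex) \<Rightarrow> bool"
  where "bc_isometry_onto M N H S \<longleftrightarrow>
    S ` L2_bc M = H \<and>
    (\<forall>f\<in>L2_bc M. \<forall>g\<in>L2_bc M. (AE x in M. f x = g x) \<longrightarrow> S f = S g) \<and>
    (\<forall>f\<in>L2_bc M. \<forall>g\<in>L2_bc M. S (\<lambda>x. f x + g x) = (\<lambda>y. S f y + S g y)) \<and>
    (\<forall>c. \<forall>f\<in>L2_bc M. S (\<lambda>x. c * f x) = (\<lambda>y. c * S f y)) \<and>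
    (\<forall>f\<in>L2_bc M. norm_bc N (S f) = norm_bc M f)"

section \<open>The transform and its target space\<close>

text \<open>For \<open>Z = (x\<^sub>1 + i y\<^sub>1) + j (x\<^sub>2 + i y\<^sub>2)\<close>.\<close>

definition x1 :: "bicomplex \<Rightarrow> real" where "x1 Z = Re (bc1 Z)"
definition y1 :: "bicomplex \<Rightarrow> real" where "y1 Z = Im (bc1 Z)"
definition x2 :: "bicomplex \<Rightarrow> real" where "x2 Z = Re (bc2 Z)"
definition y2 :: "bicomplex \<Rightarrow> real" where "y2 Z = Im (bc2 Z)"

definition X_e :: "bicomplex \<Rightarrow> bicomplex"
  where "X_e Z = of_real (x1 Z) * e_plus + of_real (x2 Z) * e_minus"

definition Y_e :: "bicomplex \<Rightarrow> bicomplex"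
  where "Y_e Z = of_real (y1 Z) * e_plus + of_real (y2 Z) * e_minus"

definition X_e_dagger :: "bicomplex \<Rightarrow> bicomplex"
  where "X_e_dagger Z = of_real (x2 Z) * e_plus + of_real (x1 Z) * e_minus"

definition Y_e_dagger :: "bicomplex \<Rightarrow> bicomplex"
  where "Y_e_dagger Z = of_real (y2 Z) * e_plus + of_real (y1 Z) * e_minus"

definition V_integrand ::
    "real \<Rightarrow> bicomplex \<Rightarrow> bicomplex \<Rightarrow> (real \<Rightarrow> bicomplex) \<Rightarrow> (real \<Rightarrow> bicomplex) \<Rightarrow>
     bicomplex \<Rightarrow> real \<Rightarrow> bicomplex"
  where "V_integrand \<sigma> \<nu> \<mu> \<phi> \<psi> Z t =
    \<phi> t *
    bc_exp (\<sigma> *\<^sub>R ((\<nu> * e_plus + \<mu> * e_minus) * (of_real t - (1/2) *\<^sub>R X_e Z) * Y_e Z)) *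
    bc_cnj (of_cx (idem_plus (\<psi> (t - x1 Z))) * e_plus +
            of_cx (idem_minus (\<psi> (t - x2 Z))) * e_minus)"

definition V_transform ::
    "real \<Rightarrow> bicomplex \<Rightarrow> bicomplex \<Rightarrow> (real \<Rightarrow> bicomplex) \<Rightarrow> (real \<Rightarrow> bicomplex) \<Rightarrow>
     bicomplex \<Rightarrow> bicomplex"
  where "V_transform \<sigma> \<nu> \<mu> \<phi> \<psi> Z =
    (\<sigma> / pi) *\<^sub>R
    (bc_exp (- (\<sigma> / 4) *\<^sub>R ((X_e_dagger Z)\<^sup>2 + (Y_e_dagger Z)\<^sup>2)) *
     (\<integral>t. V_integrand \<sigma> \<nu> \<mu> \<phi> \<psi> Z t \<partial>lebesgue))"

definition psi0 :: "real \<Rightarrow> real \<Rightarrow> bicomplex"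
  where "psi0 \<sigma> t = of_real (exp (- (\<sigma> / 2) * t\<^sup>2))"

definition S0_transform ::
    "real \<Rightarrow> bicomplex \<Rightarrow> bicomplex \<Rightarrow> (real \<Rightarrow> bicomplex) \<Rightarrow> bicomplex \<Rightarrow> bicomplex"
  where "S0_transform \<sigma> \<nu> \<mu> \<phi> =
    (\<lambda>Z. ((\<sigma> / pi) powr (1/4)) *\<^sub>R V_transform \<sigma> \<nu> \<mu> \<phi> (psi0 \<sigma>) Z)"

definition z1_nu :: "bicomplex \<Rightarrow> bicomplex \<Rightarrow> bicomplex"
  where "z1_nu \<nu> Z = of_real (x1 Z) + \<nu> * of_real (y1 Z)"

definition z2_mu :: "bicomplex \<Rightarrow> bicomplex \<Rightarrow> bicomplex"
  where "z2_mu \<mu> Z = of_real (x2 Z) + \<mu> * of_real (y2 Z)"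

definition Z_e :: "bicomplex \<Rightarrow> bicomplex \<Rightarrow> bicomplex \<Rightarrow> bicomplex"
  where "Z_e \<nu> \<mu> Z = z1_nu \<nu> Z * e_plus + z2_mu \<mu> Z * e_minus"

text \<open>The Bargmann space for a complex unit \<open>\<tau>\<close> (either \<open>\<i>\<close> or \<open>- \<i>\<close>).\<close>

definition bargmann :: "real \<Rightarrow> complex \<Rightarrow> (complex \<Rightarrow> complex) set"
  where "bargmann \<alpha> \<tau> = {F. F holomorphic_on UNIV \<and>
    integrable lebesgue (\<lambda>(x::real, y::real).
      (cmod (F (of_real x + \<tau> * of_real y)))\<^sup>2 *
      exp (- \<alpha> * (cmod (of_real x + \<tau> * of_real y))\<^sup>2))}"

text \<open>If \<open>\<nu>\<^sup>2 = \<mu>\<^sup>2 = -1\<close> then \<open>idem_plus \<nu>\<close> and \<open>idem_minus \<mu>\<close> are the complex units with which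
  \<open>\<nu>\<close> and \<open>\<mu>\<close> are identified in the \<open>e\<^sub>+\<close> and \<open>e\<^sub>-\<close> components; the arguments of \<open>F\<close> and \<open>G\<close>
  below are identified with complex numbers in the same way.\<close>

lemma unit_plus: "\<nu> * e_plus = of_cx (idem_plus \<nu>) * e_plus"
  and unit_minus: "\<mu> * e_minus = of_cx (idem_minus \<mu>) * e_minus"
  by (simp_all add: bicomplex_eq_iff of_cx_def bc_j_def e_plus_def e_minus_def idem_plus_def
      idem_minus_def complex_eq_iff field_simps)

definition M_space :: "real \<Rightarrow> bicomplex \<Rightarrow> bicomplex \<Rightarrow> (bicomplex \<Rightarrow> bicomplex) set"
  where "M_space \<sigma> \<nu> \<mu> =
    {(\<lambda>Z. exp (- (\<sigma> / 2) * (norm (Z_e \<nu> \<mu> Z))\<^sup>2) *\<^sub>R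
           (of_cx (F (idem_plus (z1_nu \<nu> Z))) * e_plus +
            of_cx (G (idem_minus (z2_mu \<mu> Z))) * e_minus)) | F G.
      F \<in> bargmann (\<sigma> / 2) (idem_plus \<nu>) \<and> G \<in> bargmann (\<sigma> / 2) (idem_minus \<mu>)}"

definition phi_n ::
    "real \<Rightarrow> bicomplex \<Rightarrow> bicomplex \<Rightarrow> nat \<Rightarrow> bicomplex \<Rightarrow> bicomplex"
  where "phi_n \<sigma> \<nu> \<mu> n Z =
    ((\<sigma> / pi) powr (3/4) * \<sigma> ^ n * exp (- (\<sigma> / 2) * (norm (Z_e \<nu> \<mu> Z))\<^sup>2)) *\<^sub>R (Z_e \<nu> \<mu> Z) ^ n"

end

theory Submission
  imports Defs "HOL-Probability.Probability" "HOL-Complex_Analysis.Complex_Analysis"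
begin

text \<open>In idempotent components the transform is, up to a constant and the Gaussian factor
  $e^{-\frac{\sigma}{2}|Z^e_{\nu,\mu}|^2}$, the Segal--Bargmann transform
  $B\varphi(z) = \int \varphi(t)\, e^{-\frac{\sigma}{2}t^2 + \sigma t z - \frac{\sigma}{4}z^2}\,dt$
  of $\varphi^+$ at $z_{1_\nu}$ and of $\varphi^-$ at $z_{2_\mu}$. Its kernel is the generating
  function $\sum_n z^n h_n(t)$ of the Hermite functions, so the $n$-th Taylor coefficient of
  $B\varphi$ is $\langle\varphi, h_n\rangle$. The $h_n$ form a complete orthogonal system of
  $L^2(\mathbb{R})$ (completeness is uniqueness of the Fourier transform), while the monomials
  satisfy Parseval's identity with respect to $e^{-\frac{\sigma}{2}|z|^2}$ on the plane for every
  entire function. As $\|h_n\|^2 \|z^n\|^2$ does not depend on $n$, $B$ is a multiple of an isometry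
  onto the Bargmann space. The Hilbert space property and the orthogonal basis are then
  transported from $L^2_{\mathbb{T}}(\mathbb{R})$ along the transform.\<close>

section \<open>Square integrable functions\<close>

text \<open>The prefactor of the transform carries the daggered coordinates, so it multiplies the
  e_+ component by a Gaussian in x_2, y_2 and the e_- component by one in x_1, y_1. Together with
  the Gaussian produced by the integral, each component acquires the full factor in all four
  variables. Its squared modulus then splits over the two planes, and the plane on which the
  component does not otherwise depend integrates to a constant. The constants cancel:
  (\<sigma>/\<pi>)^(5/2) from the prefactors, \<pi>/(2\<sigma>) from the idle plane and the factor
  1/4 of the measure, and 2(\<pi>/\<sigma>)^(3/2) from ||h_n||^2 ||z^n||^2. Parseval's identity is
  kept in the extended nonnegative reals. It then holds for every entire function, finite or not, so
  that summability of the weighted squared Taylor coefficients decides membership in the Bargmann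
  space; surjectivity rests on this. The Taylor series need not converge uniformly on the whole
  plane, hence the passage through disks. The norms of h_n and of z^n come from comparing
  coefficients of generating functions, and the orthogonality of the monomials from rotation
  invariance, so polar coordinates never enter.\<close>

definition l2_sq :: "'a measure \<Rightarrow> ('a \<Rightarrow> complex) \<Rightarrow> real"
  where "l2_sq M f = (\<integral>x. (cmod (f x))\<^sup>2 \<partial>M)"

lemma L2_complexD [dest]:
  assumes "f \<in> L2_complex M"
  shows "f \<in> borel_measurable M" "integrable M (\<lambda>x. (cmod (f x))\<^sup>2)"
  using assms by (auto simp: L2_complex_def)

lemma L2_complexI_nn:
  assumes "f \<in> borel_measurable M" "(\<integral>\<^sup>+x. ennreal ((cmod (f x))\<^sup>2) \<partial>M) < \<infinity>"
  shows "f \<in> L2_complex M"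
  using assms by (auto simp: L2_complex_def intro!: integrableI_nonneg)

lemma nn_integral_l2_sq:
  "f \<in> L2_complex M \<Longrightarrow> (\<integral>\<^sup>+x. ennreal ((cmod (f x))\<^sup>2) \<partial>M) = ennreal (l2_sq M f)"
  unfolding l2_sq_def by (rule nn_integral_eq_integral) auto

lemma l2_sq_nonneg [simp]: "0 \<le> l2_sq M f"
  by (simp add: l2_sq_def)

text \<open>Domination by two functions covers both uses: sums, with constants 2 and 2, and a single
  majorant, with \<open>h = 0\<close>.\<close>

lemma L2_bound:
  assumes "f \<in> L2_complex M" "h \<in> L2_complex M" "g \<in> borel_measurable M"
    and "\<And>x. (cmod (g x))\<^sup>2 \<le> a * (cmod (f x))\<^sup>2 + b * (cmod (h x))\<^sup>2"
  shows "g \<in> L2_complex M"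
  unfolding L2_complex_def
proof (intro CollectI conjI)
  show "integrable M (\<lambda>x. (cmod (g x))\<^sup>2)"
    by (rule Bochner_Integration.integrable_bound[of _ "\<lambda>x. a * (cmod (f x))\<^sup>2 + b * (cmod (h x))\<^sup>2"])
      (use assms in \<open>auto simp: L2_complex_def intro!: AE_I2 order_trans[OF _ abs_ge_self]\<close>)
qed (rule assms)

lemma L2_zero [simp]: "(\<lambda>x. 0) \<in> L2_complex M"
  by (simp add: L2_complex_def)

lemma L2_cnj: "f \<in> L2_complex M \<Longrightarrow> (\<lambda>x. cnj (f x)) \<in> L2_complex M"
  by (auto simp: L2_complex_def intro: borel_measurable_continuous_on[where f=cnj] continuous_intros)

lemma L2_cmult: "f \<in> L2_complex M \<Longrightarrow> (\<lambda>x. c * f x) \<in> L2_complex M"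
  by (auto simp: L2_complex_def norm_mult power_mult_distrib)

lemma norm_add_sq_le:
  fixes a b :: "'a::real_normed_vector"
  shows "(norm (a + b))\<^sup>2 \<le> 2 * (norm a)\<^sup>2 + 2 * (norm b)\<^sup>2"
proof -
  have "(norm (a + b))\<^sup>2 \<le> (norm a + norm b)\<^sup>2"
    by (intro power_mono norm_triangle_ineq) auto
  also have "\<dots> \<le> 2 * (norm a)\<^sup>2 + 2 * (norm b)\<^sup>2"
    using sum_squares_bound[of "norm a" "norm b"] by (simp add: power2_eq_square algebra_simps)
  finally show ?thesis .
qed

lemma L2_add: "f \<in> L2_complex M \<Longrightarrow> g \<in> L2_complex M \<Longrightarrow> (\<lambda>x. f x + g x) \<in> L2_complex M"
  by (rule L2_bound[of f M g _ 2 2]) (auto intro: norm_add_sq_le borel_measurable_add)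

lemma L2_diff: "f \<in> L2_complex M \<Longrightarrow> g \<in> L2_complex M \<Longrightarrow> (\<lambda>x. f x - g x) \<in> L2_complex M"
  using L2_add[OF _ L2_cmult[of g M "-1"], of f] by simp

lemma L2_sum:
  "(\<And>i. i \<in> I \<Longrightarrow> f i \<in> L2_complex M) \<Longrightarrow> (\<lambda>x. \<Sum>i\<in>I. f i x) \<in> L2_complex M"
  by (induction I rule: infinite_finite_induct) (auto intro: L2_add)

lemma L2_mult_integrable:
  assumes "f \<in> L2_complex M" "g \<in> L2_complex M"
  shows "integrable M (\<lambda>x. f x * g x)"
proof (rule Bochner_Integration.integrable_bound[of _ "\<lambda>x. (cmod (f x))\<^sup>2 + (cmod (g x))\<^sup>2"])
  show "AE x in M. norm (f x * g x) \<le> norm ((cmod (f x))\<^sup>2 + (cmod (g x))\<^sup>2)"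
  proof (rule AE_I2)
    fix x
    show "norm (f x * g x) \<le> norm ((cmod (f x))\<^sup>2 + (cmod (g x))\<^sup>2)"
      using sum_squares_bound[of "cmod (f x)" "cmod (g x)"] mult_nonneg_nonneg[of "cmod (f x)" "cmod (g x)"]
      by (auto simp: norm_mult simp del: mult_nonneg_nonneg)
  qed
qed (use assms in \<open>auto simp: L2_complex_def\<close>)

text \<open>The pairing is bilinear, without a conjugate, because it is applied to coefficient
  functionals whose second factor is real-valued.\<close>

lemma L2_Cauchy_Schwarz:
  assumes f: "f \<in> L2_complex M" and g: "g \<in> L2_complex M"
  shows "(cmod (\<integral>x. f x * g x \<partial>M))\<^sup>2 \<le> l2_sq M f * l2_sq M g"
proof -
  have [measurable]: "f \<in> borel_measurable M" "g \<in> borel_measurable M"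
    using f g by auto
  have "ennreal ((cmod (\<integral>x. f x * g x \<partial>M))\<^sup>2) = (ennreal (cmod (\<integral>x. f x * g x \<partial>M)))\<^sup>2"
    by (simp add: ennreal_power)
  also have "\<dots> \<le> (\<integral>\<^sup>+x. ennreal (cmod (f x)) * ennreal (cmod (g x)) \<partial>M)\<^sup>2"
  proof (rule power_mono)
    show "ennreal (cmod (\<integral>x. f x * g x \<partial>M)) \<le> (\<integral>\<^sup>+x. ennreal (cmod (f x)) * ennreal (cmod (g x)) \<partial>M)"
      using integral_norm_bound_ennreal[OF L2_mult_integrable[OF f g]]
      by (simp add: norm_mult ennreal_mult)
  qed simp
  also have "\<dots> \<le> (\<integral>\<^sup>+x. (ennreal (cmod (f x)))\<^sup>2 \<partial>M) * (\<integral>\<^sup>+x. (ennreal (cmod (g x)))\<^sup>2 \<partial>M)"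
    by (rule Cauchy_Schwarz_nn_integral) auto
  also have "\<dots> = ennreal (l2_sq M f * l2_sq M g)"
    by (simp add: ennreal_power nn_integral_l2_sq f g ennreal_mult)
  finally show ?thesis
    by (simp add: ennreal_le_iff)
qed

lemma l2_sq_cong_AE:
  assumes "f \<in> borel_measurable M" "g \<in> borel_measurable M" "AE x in M. f x = g x"
  shows "l2_sq M f = l2_sq M g"
  unfolding l2_sq_def by (rule integral_cong_AE) (use assms in auto)

lemma l2_sq_cmult: "l2_sq M (\<lambda>x. c * f x) = (cmod c)\<^sup>2 * l2_sq M f"
  by (simp add: l2_sq_def norm_mult power_mult_distrib)

lemma l2_sq_commute: "l2_sq M (\<lambda>x. f x - g x) = l2_sq M (\<lambda>x. g x - f x)"
  by (simp add: l2_sq_def norm_minus_commute)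

text \<open>Write |a_k| as the product of 2^(-k/2) and 2^(k/2) |a_k| and apply 2xy \<le> x^2 +
  y^2.\<close>

lemma summable_of_weighted_sq:
  fixes a :: "nat \<Rightarrow> real"
  assumes "summable (\<lambda>k. 2 ^ k * (a k)\<^sup>2)"
  shows "summable (\<lambda>k. \<bar>a k\<bar>)"
proof (rule summable_comparison_test')
  show "summable (\<lambda>k. (1/2) ^ k + 2 ^ k * (a k)\<^sup>2)"
    by (intro summable_add assms summable_geometric) simp
  fix k
  have "2 * (sqrt ((1/2) ^ k) * (sqrt (2 ^ k) * \<bar>a k\<bar>)) \<le> (sqrt ((1/2) ^ k))\<^sup>2 + (sqrt (2 ^ k) * \<bar>a k\<bar>)\<^sup>2"
    using sum_squares_bound[of "sqrt ((1/2) ^ k)" "sqrt (2 ^ k) * \<bar>a k\<bar>"] by (simp add: mult.assoc)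
  then have "2 * \<bar>a k\<bar> \<le> (1/2) ^ k + 2 ^ k * (a k)\<^sup>2"
    by (simp add: power_mult_distrib real_sqrt_divide power_one_over)
  then show "norm \<bar>a k\<bar> \<le> (1/2) ^ k + 2 ^ k * (a k)\<^sup>2"
    by simp
qed

text \<open>Riesz--Fischer. Along a rapidly convergent subsequence the weighted sum
  $\sum_k 2^k |u_{r(k+1)} - u_{r(k)}|^2$ has finite integral, which gives convergence almost
  everywhere; Fatou's lemma then yields convergence in norm.\<close>

lemma L2_complete:
  fixes u :: "nat \<Rightarrow> 'a \<Rightarrow> complex"
  assumes u: "\<And>n. u n \<in> L2_complex M"
    and C: "\<And>e. e > 0 \<Longrightarrow> \<exists>N. \<forall>m\<ge>N. \<forall>n\<ge>N. l2_sq M (\<lambda>x. u m x - u n x) < e"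
  shows "\<exists>f\<in>L2_complex M. (\<lambda>n. l2_sq M (\<lambda>x. u n x - f x)) \<longlonglongrightarrow> 0"
proof -
  have um [measurable]: "u n \<in> borel_measurable M" for n
    using u by auto
  \<comment> \<open>The rate (1/4)^k beats the weight 2^k used below and leaves the summable
    (1/2)^k.\<close>
  have "\<forall>k. \<exists>N. \<forall>m\<ge>N. \<forall>n\<ge>N. l2_sq M (\<lambda>x. u m x - u n x) < (1/4) ^ k"
    by (intro allI C) simp
  then obtain r0 where "\<forall>k. \<forall>m\<ge>r0 k. \<forall>n\<ge>r0 k. l2_sq M (\<lambda>x. u m x - u n x) < (1/4) ^ k"
    by (rule choice[THEN exE])
  then have r0: "l2_sq M (\<lambda>x. u m x - u n x) < (1/4) ^ k" if "m \<ge> r0 k" "n \<ge> r0 k" for k m n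
    using that by blast
  \<comment> \<open>Summing the indices \<open>r0 i\<close> makes \<open>r\<close> monotone while
    keeping it above \<open>r0\<close>; the added \<open>k\<close> forces \<open>r\<close> to tend
    to infinity.\<close>
  define r where "r k = (\<Sum>i\<le>k. r0 i) + k" for k
  have r_ge: "r0 k \<le> r k" for k
    unfolding r_def by (rule trans_le_add1, rule member_le_sum[of k]) auto
  have r_mono: "r k \<le> r (Suc k)" and r_id: "k \<le> r k" for k
    by (auto simp: r_def)
  define a where "a k x = cmod (u (r (Suc k)) x - u (r k) x)" for k x
  have am [measurable]: "a k \<in> borel_measurable M" for k
    unfolding a_def by measurable
  have "(\<integral>\<^sup>+x. (\<Sum>k. ennreal (2 ^ k * (a k x)\<^sup>2)) \<partial>M) = (\<Sum>k. \<integral>\<^sup>+x. ennreal (2 ^ k * (a k x)\<^sup>2) \<partial>M)"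
    by (rule nn_integral_suminf) auto
  also have "\<dots> \<le> (\<Sum>k. ennreal ((1/2) ^ k))"
  proof (rule suminf_le)
    fix k
    have "(\<integral>\<^sup>+x. ennreal (2 ^ k * (a k x)\<^sup>2) \<partial>M) = ennreal (2 ^ k) * (\<integral>\<^sup>+x. ennreal ((a k x)\<^sup>2) \<partial>M)"
      by (simp add: ennreal_mult nn_integral_cmult)
    also have "\<dots> = ennreal (2 ^ k * l2_sq M (\<lambda>x. u (r (Suc k)) x - u (r k) x))"
      unfolding a_def by (simp add: nn_integral_l2_sq L2_diff u ennreal_mult del: ennreal_power)
    also have "\<dots> \<le> ennreal (2 ^ k * (1/4) ^ k)"
      using r0[of k "r (Suc k)" "r k"] r_ge[of k] r_mono[of k]
      by (intro ennreal_leI mult_left_mono) auto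
    also have "(2::real) ^ k * (1/4) ^ k = (1/2) ^ k"
      by (simp add: power_mult_distrib[symmetric])
    finally show "(\<integral>\<^sup>+x. ennreal (2 ^ k * (a k x)\<^sup>2) \<partial>M) \<le> ennreal ((1/2) ^ k)" .
  qed simp_all
  also have "\<dots> = ennreal (\<Sum>k. (1/2) ^ k)"
    by (rule suminf_ennreal2[OF _ summable_geometric]) simp_all
  also have "\<dots> < \<infinity>" by simp
  finally have "AE x in M. (\<Sum>k. ennreal (2 ^ k * (a k x)\<^sup>2)) \<noteq> \<infinity>"
    by (intro nn_integral_PInf_AE) simp_all
  then have conv: "AE x in M. convergent (\<lambda>k. u (r k) x)"
  proof eventually_elim
    case (elim x)
    have "summable (\<lambda>k. 2 ^ k * (a k x)\<^sup>2)"
      by (rule summable_suminf_not_top) (use elim in auto)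
    then have "summable (\<lambda>k. \<bar>a k x\<bar>)"
      by (rule summable_of_weighted_sq)
    then have "summable (\<lambda>k. u (r (Suc k)) x - u (r k) x)"
      unfolding a_def abs_norm_cancel by (rule summable_norm_cancel)
    then have "convergent (\<lambda>n. \<Sum>k<n. u (r (Suc k)) x - u (r k) x)"
      by (simp only: summable_iff_convergent)
    then have "convergent (\<lambda>n. u (r n) x - u (r 0) x)"
      using sum_lessThan_telescope[of "\<lambda>n. u (r n) x"] by simp
    from convergent_add[OF this convergent_const[of "u (r 0) x"]] show ?case
      by simp
  qed
  \<comment> \<open>Where the subsequence diverges, \<open>lim\<close> has some unspecified value;
    by \<open>conv\<close> this happens only on a null set.\<close>
  define f where "f x = lim (\<lambda>k. u (r k) x)" for x
  have fm [measurable]: "f \<in> borel_measurable M"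
    unfolding f_def by measurable
  have lim: "AE x in M. (\<lambda>k. u (r k) x) \<longlonglongrightarrow> f x"
    using conv by eventually_elim (simp add: f_def convergent_LIMSEQ_iff)
  \<comment> \<open>Fatou's lemma with \<open>n\<close> fixed and the second index running along
    \<open>r\<close>. It serves twice: with bound 1 to place \<open>f\<close> in the space, and with
    bound e/2 for the convergence.\<close>
  have bound: "(\<integral>\<^sup>+x. ennreal ((cmod (u n x - f x))\<^sup>2) \<partial>M) \<le> ennreal e"
    if "\<And>m. m \<ge> n \<Longrightarrow> l2_sq M (\<lambda>x. u n x - u m x) \<le> e" for n e
  proof -
    have "(\<integral>\<^sup>+x. ennreal ((cmod (u n x - f x))\<^sup>2) \<partial>M) =
        (\<integral>\<^sup>+x. liminf (\<lambda>k. ennreal ((cmod (u n x - u (r k) x))\<^sup>2)) \<partial>M)"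
    proof (rule nn_integral_cong_AE, use lim in eventually_elim)
      fix x assume "(\<lambda>k. u (r k) x) \<longlonglongrightarrow> f x"
      then have "(\<lambda>k. ennreal ((cmod (u n x - u (r k) x))\<^sup>2)) \<longlonglongrightarrow> ennreal ((cmod (u n x - f x))\<^sup>2)"
        by (intro tendsto_intros) auto
      then show "ennreal ((cmod (u n x - f x))\<^sup>2) = liminf (\<lambda>k. ennreal ((cmod (u n x - u (r k) x))\<^sup>2))"
        by (intro lim_imp_Liminf[symmetric] sequentially_bot)
    qed
    also have "\<dots> \<le> liminf (\<lambda>k. \<integral>\<^sup>+x. ennreal ((cmod (u n x - u (r k) x))\<^sup>2) \<partial>M)"
      by (rule nn_integral_liminf) auto
    also have "\<dots> \<le> liminf (\<lambda>k. ennreal e)"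
    proof (rule Liminf_mono, rule eventually_sequentiallyI[of n])
      fix k assume "n \<le> k"
      then show "(\<integral>\<^sup>+x. ennreal ((cmod (u n x - u (r k) x))\<^sup>2) \<partial>M) \<le> ennreal e"
        using that[of "r k"] r_id[of k] by (simp add: nn_integral_l2_sq L2_diff u ennreal_leI)
    qed
    also have "\<dots> = ennreal e"
      by (simp add: Liminf_const)
    finally show ?thesis .
  qed
  obtain N0 where N0: "\<And>m n. m \<ge> N0 \<Longrightarrow> n \<ge> N0 \<Longrightarrow> l2_sq M (\<lambda>x. u m x - u n x) < 1"
    using C[of 1] by auto
  have "(\<integral>\<^sup>+x. ennreal ((cmod (u N0 x - f x))\<^sup>2) \<partial>M) < \<infinity>"
    by (rule order_le_less_trans[OF bound[of N0 1]]) (use N0 in \<open>auto intro: less_imp_le\<close>)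
  then have "(\<lambda>x. u N0 x - f x) \<in> L2_complex M"
    by (intro L2_complexI_nn) auto
  from L2_diff[OF u[of N0] this] have f: "f \<in> L2_complex M"
    by simp
  have "(\<lambda>n. l2_sq M (\<lambda>x. u n x - f x)) \<longlonglongrightarrow> 0"
  proof (rule LIMSEQ_I)
    fix e :: real assume "e > 0"
    then obtain N where N: "\<And>m n. m \<ge> N \<Longrightarrow> n \<ge> N \<Longrightarrow> l2_sq M (\<lambda>x. u m x - u n x) < e/2"
      using C[of "e/2"] by auto
    have "l2_sq M (\<lambda>x. u n x - f x) \<le> e/2" if "n \<ge> N" for n
    proof -
      have "ennreal (l2_sq M (\<lambda>x. u n x - f x)) \<le> ennreal (e/2)"
        unfolding nn_integral_l2_sq[OF L2_diff[OF u f], symmetric]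
        by (rule bound) (rule less_imp_le[OF N[OF that order_trans[OF that]]])
      with \<open>e > 0\<close> show ?thesis by (simp add: ennreal_le_iff)
    qed
    with \<open>e > 0\<close> show "\<exists>N. \<forall>n\<ge>N. norm (l2_sq M (\<lambda>x. u n x - f x) - 0) < e"
      by (intro exI[of _ N]) (fastforce simp: abs_of_nonneg)
  qed
  with f show ?thesis by blast
qed

section \<open>Complete orthogonal systems\<close>

text \<open>Since the system is real-valued, pairing without conjugation agrees with the inner
  product. The vectors are left unnormalised because the Hermite functions arise as Taylor
  coefficients of the kernel.\<close>

locale complete_orthogonal_system =
  fixes M :: "'a measure" and k :: "nat \<Rightarrow> 'a \<Rightarrow> real" and d :: "nat \<Rightarrow> real"
  assumes k_L2: "(\<lambda>x. complex_of_real (k n x)) \<in> L2_complex M"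
    and d_pos: "d n > 0"
    and orthogonal: "(\<integral>x. k m x * k n x \<partial>M) = (if m = n then d n else 0)"
    and total: "f \<in> L2_complex M \<Longrightarrow> (\<And>n. (\<integral>x. f x * complex_of_real (k n x) \<partial>M) = 0) \<Longrightarrow>
      AE x in M. f x = 0"
begin

definition coef :: "('a \<Rightarrow> complex) \<Rightarrow> nat \<Rightarrow> complex"
  where "coef f n = (\<integral>x. f x * complex_of_real (k n x) \<partial>M) / complex_of_real (d n)"

definition psum :: "(nat \<Rightarrow> complex) \<Rightarrow> nat \<Rightarrow> 'a \<Rightarrow> complex"
  where "psum c N x = (\<Sum>n<N. c n * complex_of_real (k n x))"

lemma psum_L2: "psum c N \<in> L2_complex M"
  unfolding psum_def by (intro L2_sum L2_cmult k_L2)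

lemma integral_k: "(\<integral>x. f x * complex_of_real (k n x) \<partial>M) = coef f n * complex_of_real (d n)"
  using d_pos[of n] by (simp add: coef_def)

lemma coef_psum: "coef (psum c N) m = (if m < N then c m else 0)"
proof -
  have "(\<integral>x. psum c N x * complex_of_real (k m x) \<partial>M) =
      (\<integral>x. (\<Sum>n<N. c n * (complex_of_real (k n x) * complex_of_real (k m x))) \<partial>M)"
    by (simp add: psum_def sum_distrib_right mult.assoc)
  also have "\<dots> = (\<Sum>n<N. c n * (\<integral>x. complex_of_real (k n x) * complex_of_real (k m x) \<partial>M))"
    using L2_mult_integrable[OF k_L2 k_L2] by (subst Bochner_Integration.integral_sum) auto
  also have "\<dots> = (\<Sum>n<N. if n = m then c m * complex_of_real (d m) else 0)"
    by (intro sum.cong refl) (simp add: orthogonal flip: of_real_mult)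
  finally show ?thesis
    using d_pos[of m] by (simp add: coef_def sum.delta)
qed

lemma coef_diff:
  assumes "f \<in> L2_complex M" "g \<in> L2_complex M"
  shows "coef (\<lambda>x. f x - g x) n = coef f n - coef g n"
  using L2_mult_integrable[OF _ k_L2[of n]] assms
  by (simp add: coef_def left_diff_distrib diff_divide_distrib)

text \<open>One expansion of the square serves twice: where the coefficient vanishes it is
  Pythagoras for partial sums, and with \<open>a = coef f n\<close> it is the decrease in Bessel's
  identity.\<close>

lemma l2_sq_diff_k:
  assumes f: "f \<in> L2_complex M"
  shows "l2_sq M (\<lambda>x. f x - a * complex_of_real (k n x)) =
    l2_sq M f - 2 * d n * Re (cnj a * coef f n) + (cmod a)\<^sup>2 * d n"
proof -
  have i2: "integrable M (\<lambda>x. f x * complex_of_real (k n x))"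
    by (rule L2_mult_integrable[OF f k_L2])
  have i3: "integrable M (\<lambda>x. k n x * k n x)"
    using L2_complexD(2)[OF k_L2[of n]] by (simp add: power2_eq_square)
  have eq: "(cmod (f x - a * complex_of_real (k n x)))\<^sup>2 =
      (cmod (f x))\<^sup>2 - 2 * Re (cnj a * (f x * complex_of_real (k n x))) + (cmod a)\<^sup>2 * (k n x * k n x)" for x
    unfolding cmod_power2 by (simp add: power2_eq_square algebra_simps)
  have "(\<integral>x. Re (cnj a * (f x * complex_of_real (k n x))) \<partial>M) =
      Re (\<integral>x. cnj a * (f x * complex_of_real (k n x)) \<partial>M)"
    by (rule integral_Re) (intro integrable_mult_right i2)
  also have "\<dots> = d n * Re (cnj a * coef f n)"
    using i2 by (simp add: integral_k algebra_simps)
  finally have Re: "(\<integral>x. Re (cnj a * (f x * complex_of_real (k n x))) \<partial>M) = d n * Re (cnj a * coef f n)" .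
  have "integrable M (\<lambda>x. Re (cnj a * (f x * complex_of_real (k n x))))"
    by (intro integrable_Re integrable_mult_right i2)
  then show ?thesis
    unfolding l2_sq_def eq using i3 L2_complexD(2)[OF f] Re
    by (simp add: orthogonal del: times_complex.sel complex_cnj_mult)
qed

lemma psum_Suc: "psum c (Suc N) x = psum c N x + c N * complex_of_real (k N x)"
  by (simp add: psum_def)

lemma l2_sq_psum: "l2_sq M (psum c N) = (\<Sum>n<N. (cmod (c n))\<^sup>2 * d n)"
proof (induction N)
  case 0
  show ?case by (simp add: psum_def l2_sq_def)
next
  case (Suc N)
  have "l2_sq M (psum c (Suc N)) = l2_sq M (\<lambda>x. psum c N x - (- c N) * complex_of_real (k N x))"
    by (simp add: psum_Suc[abs_def])
  also have "\<dots> = l2_sq M (psum c N) + (cmod (c N))\<^sup>2 * d N"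
    by (subst l2_sq_diff_k[OF psum_L2]) (simp add: coef_psum)
  finally show ?case using Suc by simp
qed

lemma l2_sq_diff_psum_coef:
  assumes "f \<in> L2_complex M"
  shows "l2_sq M (\<lambda>x. f x - psum (coef f) N x) = l2_sq M f - (\<Sum>n<N. (cmod (coef f n))\<^sup>2 * d n)"
proof (induction N)
  case 0
  show ?case by (simp add: psum_def)
next
  case (Suc N)
  have "l2_sq M (\<lambda>x. f x - psum (coef f) (Suc N) x) =
      l2_sq M (\<lambda>x. (f x - psum (coef f) N x) - coef f N * complex_of_real (k N x))"
    by (simp add: psum_Suc diff_diff_eq)
  also have "\<dots> = l2_sq M (\<lambda>x. f x - psum (coef f) N x) - (cmod (coef f N))\<^sup>2 * d N"
    using cmod_power2[of "coef f N"]
    by (subst l2_sq_diff_k) (auto simp: coef_diff coef_psum psum_L2 L2_diff assms power2_eq_square algebra_simps)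
  finally show ?case using Suc by simp
qed

text \<open>Each coefficient functional is continuous in the norm by Cauchy--Schwarz.\<close>

lemma coef_tendsto:
  assumes "f \<in> L2_complex M" "(\<lambda>N. l2_sq M (\<lambda>x. f x - g N x)) \<longlonglongrightarrow> 0"
    and "\<And>N. g N \<in> L2_complex M"
  shows "(\<lambda>N. coef (g N) n) \<longlonglongrightarrow> coef f n"
proof -
  have "(\<lambda>N. coef f n - coef (g N) n) \<longlonglongrightarrow> 0"
  proof (rule Lim_null_comparison)
    have "(\<lambda>N. sqrt (l2_sq M (\<lambda>x. f x - g N x) * l2_sq M (\<lambda>x. complex_of_real (k n x))) / d n)
        \<longlonglongrightarrow> sqrt (0 * l2_sq M (\<lambda>x. complex_of_real (k n x))) / d n"
      by (intro tendsto_intros assms) (use d_pos[of n] in auto)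
    then show "(\<lambda>N. sqrt (l2_sq M (\<lambda>x. f x - g N x) * l2_sq M (\<lambda>x. complex_of_real (k n x))) / d n) \<longlonglongrightarrow> 0"
      by simp
    show "\<forall>\<^sub>F N in sequentially. norm (coef f n - coef (g N) n) \<le>
        sqrt (l2_sq M (\<lambda>x. f x - g N x) * l2_sq M (\<lambda>x. complex_of_real (k n x))) / d n"
    proof (rule always_eventually, rule allI)
      fix N
      have "cmod (\<integral>x. (f x - g N x) * complex_of_real (k n x) \<partial>M) \<le>
          sqrt (l2_sq M (\<lambda>x. f x - g N x) * l2_sq M (\<lambda>x. complex_of_real (k n x)))"
        by (rule real_le_rsqrt, rule L2_Cauchy_Schwarz) (intro L2_diff assms k_L2)+
      then show "norm (coef f n - coef (g N) n) \<le>
          sqrt (l2_sq M (\<lambda>x. f x - g N x) * l2_sq M (\<lambda>x. complex_of_real (k n x))) / d n"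
        using d_pos[of n] by (subst coef_diff[symmetric]) (auto simp: assms coef_def norm_divide divide_right_mono)
    qed
  qed
  from tendsto_diff[OF tendsto_const[of "coef f n"] this] show ?thesis
    by simp
qed

text \<open>Orthogonality turns differences of partial sums into differences of a convergent
  numerical series, so they form a Cauchy sequence. \<open>L2_complete\<close> supplies the limit,
  and continuity of the coefficient functionals identifies its coefficients.\<close>

lemma synthesis:
  assumes c: "summable (\<lambda>n. (cmod (c n))\<^sup>2 * d n)"
  obtains f where "f \<in> L2_complex M" "coef f = c"
    "(\<lambda>N. l2_sq M (\<lambda>x. f x - psum c N x)) \<longlonglongrightarrow> 0"
proof -
  define s where "s N = (\<Sum>n<N. (cmod (c n))\<^sup>2 * d n)" for N
  have diff: "l2_sq M (\<lambda>x. psum c m x - psum c n x) = s m - s n" if "n \<le> m" for m n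
  proof -
    have set: "{..<m} = {..<n} \<union> {n..<m}" "{..<n} \<inter> {n..<m} = {}"
      using that by auto
    \<comment> \<open>A difference of two partial sums is again a partial sum, with its first
      \<open>n\<close> coefficients set to 0, so \<open>l2_sq_psum\<close> computes its
      norm.\<close>
    have "psum c m x - psum c n x = psum (\<lambda>i. if i < n then 0 else c i) m x" for x
      by (simp add: psum_def set sum.union_disjoint)
    then have "l2_sq M (\<lambda>x. psum c m x - psum c n x) = l2_sq M (psum (\<lambda>i. if i < n then 0 else c i) m)"
      by simp
    also have "\<dots> = s m - s n"
      by (simp add: l2_sq_psum s_def set sum.union_disjoint)
    finally show ?thesis .
  qed
  have "Cauchy s"
    using c unfolding s_def by (simp add: Cauchy_convergent_iff summable_iff_convergent)
  have "\<exists>N. \<forall>m\<ge>N. \<forall>n\<ge>N. l2_sq M (\<lambda>x. psum c m x - psum c n x) < e" if "e > 0" for e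
  proof -
    from CauchyD[OF \<open>Cauchy s\<close> \<open>e > 0\<close>] obtain N where N: "\<And>m n. m \<ge> N \<Longrightarrow> n \<ge> N \<Longrightarrow> norm (s m - s n) < e"
      by blast
    have "l2_sq M (\<lambda>x. psum c m x - psum c n x) < e" if "m \<ge> N" "n \<ge> N" for m n
      using N[OF that] diff[of m n] diff[of n m] l2_sq_commute[of M "psum c m" "psum c n"]
      by (cases "n \<le> m") auto
    then show ?thesis by blast
  qed
  from L2_complete[OF psum_L2 this] obtain f where f: "f \<in> L2_complex M"
      "(\<lambda>n. l2_sq M (\<lambda>x. psum c n x - f x)) \<longlonglongrightarrow> 0"
    by blast
  have lim: "(\<lambda>n. l2_sq M (\<lambda>x. f x - psum c n x)) \<longlonglongrightarrow> 0"
    using f(2) by (subst l2_sq_commute)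
  have "coef f n = c n" for n
  proof (rule LIMSEQ_unique)
    show "(\<lambda>N. coef (psum c N) n) \<longlonglongrightarrow> coef f n"
      by (rule coef_tendsto[OF f(1) lim psum_L2])
    \<comment> \<open>The sequence is constant as soon as N > n, hence from \<open>Suc n\<close>
      on.\<close>
    show "(\<lambda>N. coef (psum c N) n) \<longlonglongrightarrow> c n"
      by (rule tendsto_eventually) (auto simp: coef_psum eventually_sequentially intro!: exI[of _ "Suc n"])
  qed
  with f(1) lim that show thesis by blast
qed

text \<open>Bessel's inequality makes the coefficients of \<open>f\<close> admissible for
  \<open>synthesis\<close>. The resulting \<open>g\<close> has the same coefficients, so
  \<open>total\<close> applied to \<open>f - g\<close> gives f = g almost everywhere.\<close>

lemma expansion:
  assumes f: "f \<in> L2_complex M"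
  shows "(\<lambda>N. l2_sq M (\<lambda>x. f x - psum (coef f) N x)) \<longlonglongrightarrow> 0"
    and "(\<lambda>n. (cmod (coef f n))\<^sup>2 * d n) sums l2_sq M f"
proof -
  have "summable (\<lambda>n. (cmod (coef f n))\<^sup>2 * d n)"
  proof (rule summableI_nonneg_bounded)
    show "(\<Sum>n<N. (cmod (coef f n))\<^sup>2 * d n) \<le> l2_sq M f" for N
      using l2_sq_diff_psum_coef[OF f, of N] l2_sq_nonneg[of M "\<lambda>x. f x - psum (coef f) N x"] by simp
  qed (simp add: d_pos less_imp_le)
  from synthesis[OF this] obtain g where g: "g \<in> L2_complex M" "coef g = coef f"
    "(\<lambda>N. l2_sq M (\<lambda>x. g x - psum (coef f) N x)) \<longlonglongrightarrow> 0" .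
  have "AE x in M. f x - g x = 0"
  proof (rule total)
    fix n show "(\<integral>x. (f x - g x) * complex_of_real (k n x) \<partial>M) = 0"
      by (simp add: integral_k coef_diff f g)
  qed (intro L2_diff f g)
  then have "l2_sq M (\<lambda>x. f x - psum (coef f) N x) = l2_sq M (\<lambda>x. g x - psum (coef f) N x)" for N
    by (intro l2_sq_cong_AE L2_complexD L2_diff f g psum_L2) auto
  with g show lim: "(\<lambda>N. l2_sq M (\<lambda>x. f x - psum (coef f) N x)) \<longlonglongrightarrow> 0"
    by simp
  from tendsto_diff[OF tendsto_const[of "l2_sq M f"] this]
  show "(\<lambda>n. (cmod (coef f n))\<^sup>2 * d n) sums l2_sq M f"
    by (simp add: l2_sq_diff_psum_coef[OF f] sums_def)
qed

lemma expansion_unique: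
  assumes f: "f \<in> L2_complex M" and lim: "(\<lambda>N. l2_sq M (\<lambda>x. f x - psum c N x)) \<longlonglongrightarrow> 0"
  shows "c = coef f"
proof
  fix n show "c n = coef f n"
  proof (rule LIMSEQ_unique)
    show "(\<lambda>N. coef (psum c N) n) \<longlonglongrightarrow> coef f n"
      by (rule coef_tendsto[OF f(1) lim psum_L2])
    show "(\<lambda>N. coef (psum c N) n) \<longlonglongrightarrow> c n"
      by (rule tendsto_eventually) (auto simp: coef_psum eventually_sequentially intro!: exI[of _ "Suc n"])
  qed
qed

lemma expansion_iff:
  assumes "f \<in> L2_complex M"
  shows "(\<lambda>N. l2_sq M (\<lambda>x. f x - psum c N x)) \<longlonglongrightarrow> 0 \<longleftrightarrow> c = coef f"
proof
  assume "c = coef f"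
  then show "(\<lambda>N. l2_sq M (\<lambda>x. f x - psum c N x)) \<longlonglongrightarrow> 0"
    by (simp only: expansion(1)[OF assms])
qed (rule expansion_unique[OF assms])

end

section \<open>Power series and Gaussian integrals\<close>

text \<open>An identity theorem from positive arguments alone, since the generating function of the
  moments is only available there. After division by the first power with nonzero coefficient, the
  sum is 0 to the right of the origin but tends to that coefficient.\<close>

lemma powser_zero_on_pos:
  fixes c :: "nat \<Rightarrow> real"
  assumes z: "\<And>r. r > 0 \<Longrightarrow> (\<lambda>n. c n * r ^ n) sums 0"
  shows "c n = 0"
proof (rule ccontr)
  assume "c n \<noteq> 0"
  define m where "m = (LEAST m. c m \<noteq> 0)"
  have m: "c m \<noteq> 0" and lt: "\<And>i. i < m \<Longrightarrow> c i = 0"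
    unfolding m_def by (rule LeastI[of _ n], fact) (blast dest: not_less_Least)
  define a where "a i = c (i + m)" for i
  have pos: "(\<lambda>i. a i * r ^ i) sums 0" if r: "r > 0" for r
  proof -
    have "(\<lambda>i. c (i + m) * r ^ (i + m)) sums (0 - (\<Sum>i<m. c i * r ^ i))"
      by (subst sums_iff_shift) (use z[OF r] in simp)
    then have "(\<lambda>i. r ^ m * (a i * r ^ i)) sums (r ^ m * 0)"
      by (simp add: lt a_def power_add mult_ac)
    then show ?thesis
      using r by (subst (asm) sums_mult_iff) auto
  qed
  define f where "f x = (\<Sum>i. a i * x ^ i)" for x
  have "(\<lambda>i. a i * x ^ i) sums f x" if "norm x < 1" for x
    unfolding f_def
    by (rule summable_sums, rule powser_inside[of a 1]) (use pos[of 1] that in \<open>auto simp: sums_iff\<close>)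
  then have "(f \<longlongrightarrow> a 0) (at 0)"
    by (rule powser_limit_0[of 1, rotated]) simp_all
  then have "(f \<longlongrightarrow> a 0) (at_right 0)"
    by (rule filterlim_mono[OF _ order_refl at_le]) simp
  moreover have "(f \<longlongrightarrow> 0) (at_right 0)"
    by (rule tendsto_eventually, rule eventually_mono[OF eventually_at_right_less])
      (use pos in \<open>auto simp: f_def sums_iff\<close>)
  ultimately have "a 0 = 0"
    by (rule tendsto_unique[rotated]) simp
  with m show False
    by (simp add: a_def)
qed

lemma powser_unique_on_pos:
  fixes a b :: "nat \<Rightarrow> real"
  assumes "\<And>r. r > 0 \<Longrightarrow> (\<lambda>n. a n * r ^ n) sums f r" "\<And>r. r > 0 \<Longrightarrow> (\<lambda>n. b n * r ^ n) sums f r"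
  shows "a n = b n"
  using powser_zero_on_pos[of "\<lambda>n. a n - b n" n] sums_diff[OF assms(1) assms(2)]
  by (simp add: left_diff_distrib) (metis diff_self)

text \<open>Completing the square exhibits the integrand as a multiple of the normal density with
  mean b/(2a) and variance 1/(2a).\<close>

lemma has_bochner_integral_gaussian:
  fixes a b :: real
  assumes a: "a > 0"
  shows "has_bochner_integral lborel (\<lambda>t. exp (- a * t\<^sup>2 + b * t)) (sqrt (pi / a) * exp (b\<^sup>2 / (4 * a)))"
proof -
  define s where "s = sqrt (1 / (2 * a))"
  define m where "m = b / (2 * a)"
  have s: "s > 0" "s\<^sup>2 = 1 / (2 * a)"
    using a by (auto simp: s_def)
  have "exp (- a * t\<^sup>2 + b * t) = sqrt (pi / a) * exp (b\<^sup>2 / (4 * a)) * normal_density m s t" for t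
  proof -
    have "- a * t\<^sup>2 + b * t = b\<^sup>2 / (4 * a) + (- (t - m)\<^sup>2 / (2 * s\<^sup>2))"
      unfolding s(2) m_def using a by (simp add: field_simps power2_eq_square)
    then have "exp (- a * t\<^sup>2 + b * t) = exp (b\<^sup>2 / (4 * a)) * exp (- (t - m)\<^sup>2 / (2 * s\<^sup>2))"
      by (simp only: exp_add)
    then show ?thesis
      unfolding normal_density_def s(2) using a by simp
  qed
  moreover have "has_bochner_integral lborel (normal_density m s) 1"
    using s by (simp add: has_bochner_integral_iff)
  then have "has_bochner_integral lborel (\<lambda>t. sqrt (pi / a) * exp (b\<^sup>2 / (4 * a)) * normal_density m s t)
      (sqrt (pi / a) * exp (b\<^sup>2 / (4 * a)) * 1)"
    by (rule has_bochner_integral_mult_right)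
  ultimately show ?thesis
    by simp
qed

section \<open>Uniqueness of the Fourier transform\<close>

text \<open>The positive and negative parts of \<open>g\<close> have equal Fourier transforms, and
  equal mass by the value at 0. Divided by that mass they become densities of probability measures
  with the same characteristic function, and Levy's uniqueness theorem applies.\<close>

lemma fourier_unique_borel:
  fixes g :: "real \<Rightarrow> real"
  assumes g: "integrable lborel g"
    and zero: "\<And>y. (\<integral>t. g t *\<^sub>R iexp (y * t) \<partial>lborel) = 0"
  shows "AE t in lborel. g t = 0"
proof -
  have [measurable]: "g \<in> borel_measurable borel"
    using g by (simp add: borel_measurable_integrable)
  define p where "p t = max 0 (g t)" for t
  define q where "q t = max 0 (- g t)" for t
  have [measurable]: "p \<in> borel_measurable borel" "q \<in> borel_measurable borel"
    unfolding p_def q_def by measurable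
  have pq: "integrable lborel p" "integrable lborel q"
    unfolding p_def q_def using g by auto
  have nn: "0 \<le> p t" "0 \<le> q t" and diff: "g t = p t - q t" for t
    by (auto simp: p_def q_def max_def)
  have ii: "integrable lborel (\<lambda>t. f t *\<^sub>R iexp (y * t))" if "integrable lborel f"
    for f :: "real \<Rightarrow> real" and y
    by (rule Bochner_Integration.integrable_bound[OF that])
      (use that in \<open>auto simp: borel_measurable_integrable\<close>)
  have eq: "(\<integral>t. p t *\<^sub>R iexp (y * t) \<partial>lborel) = (\<integral>t. q t *\<^sub>R iexp (y * t) \<partial>lborel)" for y
    using zero[of y] ii[OF pq(1)] ii[OF pq(2)] by (simp add: diff scaleR_diff_left)
  have ipq: "integral\<^sup>L lborel p = integral\<^sup>L lborel q"
  proof -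
    have "complex_of_real (integral\<^sup>L lborel p) = complex_of_real (integral\<^sup>L lborel q)"
      using eq[of 0] by (simp add: scaleR_conv_of_real)
    then show ?thesis by simp
  qed
  \<comment> \<open>Without mass there is nothing to normalise, but then both parts vanish almost
    everywhere.\<close>
  have "AE t in lborel. p t = q t"
  proof (cases "integral\<^sup>L lborel p = 0")
    case True
    then have "AE t in lborel. p t = 0" "AE t in lborel. q t = 0"
      using integral_nonneg_eq_0_iff_AE[OF pq(1)] integral_nonneg_eq_0_iff_AE[OF pq(2)] ipq nn by auto
    then show ?thesis by eventually_elim simp
  next
    case False
    define c where "c = integral\<^sup>L lborel p"
    have "0 \<le> integral\<^sup>L lborel p"
      by (rule Bochner_Integration.integral_nonneg) (rule nn)
    with False have c: "c > 0"
      by (simp add: c_def)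
    have rd: "real_distribution (density lborel (\<lambda>t. ennreal (f t / c)))"
      if f: "integrable lborel f" "\<And>t. 0 \<le> f t" "integral\<^sup>L lborel f = c" for f
    proof -
      have "prob_space (density lborel (\<lambda>t. ennreal (f t / c)))"
      proof
        have "(\<integral>\<^sup>+t. ennreal (f t / c) \<partial>lborel) = ennreal (\<integral>t. f t / c \<partial>lborel)"
          by (rule nn_integral_eq_integral) (use f c in auto)
        then show "emeasure (density lborel (\<lambda>t. ennreal (f t / c)))
            (space (density lborel (\<lambda>t. ennreal (f t / c)))) = 1"
          using f c by (simp add: emeasure_density borel_measurable_integrable)
      qed
      then show ?thesis
        unfolding real_distribution_def real_distribution_axioms_def by simp
    qed
    have ch: "char (density lborel (\<lambda>t. ennreal (f t / c))) y = (\<integral>t. f t *\<^sub>R iexp (y * t) \<partial>lborel) /\<^sub>R c"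
      if f: "integrable lborel f" "\<And>t. 0 \<le> f t" for f y
    proof -
      have "char (density lborel (\<lambda>t. ennreal (f t / c))) y = (\<integral>t. (f t / c) *\<^sub>R iexp (y * t) \<partial>lborel)"
        unfolding char_def by (rule integral_density) (use f c in auto)
      also have "\<dots> = (\<integral>t. inverse c *\<^sub>R (f t *\<^sub>R iexp (y * t)) \<partial>lborel)"
        by (simp add: divide_inverse_commute)
      also have "\<dots> = (\<integral>t. f t *\<^sub>R iexp (y * t) \<partial>lborel) /\<^sub>R c"
        by (rule integral_scaleR_right)
      finally show ?thesis .
    qed
    have "density lborel (\<lambda>t. ennreal (p t / c)) = density lborel (\<lambda>t. ennreal (q t / c))"
      by (rule Levy_uniqueness)
        (use rd[OF pq(1)] rd[OF pq(2)] ch[OF pq(1)] ch[OF pq(2)] nn eq ipq in \<open>auto simp: c_def\<close>)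
    then have "AE t in lborel. ennreal (p t / c) = ennreal (q t / c)"
      by (intro sigma_finite_measure.density_unique[OF sigma_finite_lborel]) auto
    then show ?thesis
      by eventually_elim (use nn c in simp)
  qed
  then show ?thesis
    by eventually_elim (simp add: diff)
qed

text \<open>A Lebesgue measurable function agrees almost everywhere with a Borel one, and none of
  the integrals involved changes.\<close>

lemma fourier_unique_real:
  fixes g :: "real \<Rightarrow> real"
  assumes g: "integrable lebesgue g"
    and zero: "\<And>y. (\<integral>t. g t *\<^sub>R iexp (y * t) \<partial>lebesgue) = 0"
  shows "AE t in lebesgue. g t = 0"
proof -
  from completion_ex_borel_measurable_real[OF borel_measurable_integrable[OF g]]
  obtain h where h: "h \<in> borel_measurable lborel" and gh: "AE t in lborel. g t = h t"
    by auto
  have [measurable]: "h \<in> borel_measurable borel" using h by simp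
  have gm: "g \<in> borel_measurable lebesgue" and hm: "h \<in> borel_measurable lebesgue"
    using g h by (auto simp: borel_measurable_integrable intro: measurable_completion)
  have gh': "AE t in lebesgue. g t = h t"
    using gh by (rule AE_completion)
  have im: "(\<lambda>t. iexp (y * t)) \<in> borel_measurable lebesgue" for y
    by (rule measurable_completion) simp
  have "integrable lebesgue h"
    using g gh' gm hm by (subst integrable_cong_AE[symmetric]) auto
  then have "integrable lborel h"
    by (simp add: integrable_completion h)
  moreover have "(\<integral>t. h t *\<^sub>R iexp (y * t) \<partial>lborel) = 0" for y
  proof -
    have "(\<integral>t. h t *\<^sub>R iexp (y * t) \<partial>lborel) = (\<integral>t. h t *\<^sub>R iexp (y * t) \<partial>lebesgue)"
      by (rule integral_completion[symmetric]) simp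
    also have "\<dots> = (\<integral>t. g t *\<^sub>R iexp (y * t) \<partial>lebesgue)"
      by (rule integral_cong_AE) (use gh' gm hm im in \<open>auto intro: borel_measurable_scaleR\<close>)
    finally show ?thesis using zero by simp
  qed
  ultimately have "AE t in lborel. h t = 0"
    by (rule fourier_unique_borel)
  then have "AE t in lebesgue. h t = 0"
    by (rule AE_completion)
  with gh' show ?thesis
    by eventually_elim simp
qed

text \<open>The transform of the conjugate of \<open>f\<close> at y is the conjugate of the
  transform of \<open>f\<close> at -y, so it vanishes too, and with it the transform of the real
  part.\<close>

lemma fourier_unique_Re:
  fixes f :: "real \<Rightarrow> complex"
  assumes f: "integrable lebesgue f"
    and zero: "\<And>y. (\<integral>t. f t * iexp (y * t) \<partial>lebesgue) = 0"
  shows "AE t in lebesgue. Re (f t) = 0"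
proof -
  have im: "(\<lambda>t. iexp (y * t)) \<in> borel_measurable lebesgue" for y
    by (rule measurable_completion) simp
  have i1: "integrable lebesgue (\<lambda>t. f t * iexp (y * t))" for y
    by (rule Bochner_Integration.integrable_bound[OF f])
      (use f im in \<open>auto simp: borel_measurable_integrable norm_mult\<close>)
  have c: "cnj (f t) * iexp (y * t) = cnj (f t * iexp (- y * t))" for t y
    by (simp add: exp_cnj)
  have i2: "integrable lebesgue (\<lambda>t. cnj (f t) * iexp (y * t))" for y
    unfolding c by (rule integrable_cnj) (rule i1)
  have z2: "(\<integral>t. cnj (f t) * iexp (y * t) \<partial>lebesgue) = 0" for y
    unfolding c by (simp only: Bochner_Integration.integral_cnj zero complex_cnj_zero)
  show ?thesis
  proof (rule fourier_unique_real)
    fix y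
    have "Re (f t) *\<^sub>R iexp (y * t) = (1/2) * (f t * iexp (y * t) + cnj (f t) * iexp (y * t))" for t
      by (simp only: distrib_right[symmetric] complex_add_cnj) (simp add: scaleR_conv_of_real)
    then show "(\<integral>t. Re (f t) *\<^sub>R iexp (y * t) \<partial>lebesgue) = 0"
      using i1[of y] i2[of y] zero[of y] z2[of y]
      by (simp only: Bochner_Integration.integral_add integral_mult_right_zero add_0 mult_zero_right)
  qed (use f in simp)
qed

lemma fourier_unique:
  fixes f :: "real \<Rightarrow> complex"
  assumes f: "integrable lebesgue f"
    and zero: "\<And>y. (\<integral>t. f t * iexp (y * t) \<partial>lebesgue) = 0"
  shows "AE t in lebesgue. f t = 0"
proof -
  \<comment> \<open>This is the imaginary part of \<open>f\<close>.\<close>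
  have "AE t in lebesgue. Re (- \<i> * f t) = 0"
  proof (rule fourier_unique_Re)
    show "integrable lebesgue (\<lambda>t. - \<i> * f t)"
      by (rule integrable_mult_right) (rule f)
    show "(\<integral>t. - \<i> * f t * iexp (y * t) \<partial>lebesgue) = 0" for y
      by (simp only: mult.assoc integral_mult_right_zero zero mult_zero_right)
  qed
  moreover have "AE t in lebesgue. Re (f t) = 0"
    by (rule fourier_unique_Re[OF f zero])
  ultimately show ?thesis
    by eventually_elim (simp add: complex_eq_iff)
qed

section \<open>The Segal--Bargmann kernel and Hermite functions\<close>

text \<open>The coefficient of z^n in exp(p z + q z^2); for p = 2x and q = -1 it is H_n(x)/n!, with
  H_n the Hermite polynomial. The type is generic because the complex instance gives the kernel and
  the real one its majorant.\<close>

definition hcoef :: "'a::{real_normed_field,banach} \<Rightarrow> 'a \<Rightarrow> nat \<Rightarrow> 'a"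
  where "hcoef p q n =
    (\<Sum>i\<le>n. p ^ i / fact i * (if even (n - i) then q ^ ((n - i) div 2) / fact ((n - i) div 2) else 0))"

lemma even_exp_sums:
  fixes q :: "'a::{real_normed_field,banach}"
  shows "(\<lambda>j. if even j then q ^ (j div 2) / fact (j div 2) else 0) sums exp q"
proof -
  have "(\<lambda>n. if even (2 * n) then q ^ (2 * n div 2) / fact (2 * n div 2) else 0) sums exp q"
    using exp_converges[of q] by (simp add: scaleR_conv_of_real field_simps)
  then show ?thesis
    by (subst (asm) sums_mono_reindex[of "\<lambda>n. 2 * n"]) (auto simp: strict_mono_def elim!: evenE)
qed

text \<open>The Cauchy product of the series of exp p with that of exp q, the latter spread over the
  even indices so that q counts with degree 2.\<close>

lemma hcoef_sums: "hcoef p q sums exp (p + q)"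
proof -
  let ?a = "\<lambda>i. p ^ i / fact i"
  let ?b = "\<lambda>j. if even j then q ^ (j div 2) / fact (j div 2) else 0"
  have a: "?a sums exp p"
    using exp_converges[of p] by (simp add: scaleR_conv_of_real field_simps)
  have "summable (\<lambda>k. norm (?a k))"
    using summable_norm_exp[of p] by (simp add: scaleR_conv_of_real field_simps)
  moreover have "summable (\<lambda>k. norm (?b k))"
  proof -
    have "(\<lambda>k. norm (?b k)) = (\<lambda>j. if even j then (norm q) ^ (j div 2) / fact (j div 2) else 0)"
      by (auto simp: norm_divide norm_power)
    then show ?thesis
      using even_exp_sums[of "norm q"] by (simp add: sums_iff)
  qed
  ultimately have "(\<lambda>k. \<Sum>i\<le>k. ?a i * ?b (k - i)) sums ((\<Sum>k. ?a k) * (\<Sum>k. ?b k))"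
    by (rule Cauchy_product_sums)
  also have "(\<Sum>k. ?a k) * (\<Sum>k. ?b k) = exp (p + q)"
    using a even_exp_sums[of q] by (simp add: sums_iff exp_add)
  finally show ?thesis
    unfolding hcoef_def .
qed

lemma norm_hcoef_le: "norm (hcoef p q n) \<le> hcoef (norm p) (norm q) n"
  unfolding hcoef_def
  by (rule order_trans[OF norm_sum], rule sum_mono) (simp add: norm_mult norm_divide norm_power)

text \<open>Weighted homogeneity: p has weight 1 and q weight 2, and each nonzero summand has total
  weight i + 2j = n.\<close>

lemma hcoef_scale: "hcoef (p * z) (q * z\<^sup>2) n = z ^ n * hcoef p q n"
proof -
  have "(p * z) ^ i / fact i * (if even (n - i) then (q * z\<^sup>2) ^ ((n - i) div 2) / fact ((n - i) div 2) else 0) =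
     z ^ n * (p ^ i / fact i * (if even (n - i) then q ^ ((n - i) div 2) / fact ((n - i) div 2) else 0))"
    if "i \<le> n" for i
  proof (cases "even (n - i)")
    case True
    then obtain j where j: "n - i = 2 * j" by (elim evenE)
    with that have "n = i + 2 * j" by simp
    then show ?thesis
      by (simp add: power_mult_distrib power_add flip: power_mult)
  qed simp
  then show ?thesis
    unfolding hcoef_def sum_distrib_left by (intro sum.cong) auto
qed

lemma hcoef_of_real: "hcoef (of_real p) (of_real q) n = of_real (hcoef p q n)"
  unfolding hcoef_def of_real_sum by (intro sum.cong) auto

definition bkernel :: "real \<Rightarrow> complex \<Rightarrow> real \<Rightarrow> complex"
  where "bkernel s z t =
    exp (of_real (- (s / 2) * t\<^sup>2) + of_real (s * t) * z - of_real (s / 4) * z\<^sup>2)"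

text \<open>In terms of the Hermite polynomials H_n the polynomial factor is (sqrt s / 2)^n H_n(sqrt
  s * t) / n!.\<close>

definition herm :: "real \<Rightarrow> nat \<Rightarrow> real \<Rightarrow> real"
  where "herm s n t = exp (- (s / 2) * t\<^sup>2) * hcoef (s * t) (- (s / 4)) n"

lemma herm_generating: "(\<lambda>n. z ^ n * of_real (herm s n t)) sums bkernel s z t"
proof -
  have "z ^ n * of_real (herm s n t) =
      exp (of_real (- (s / 2) * t\<^sup>2)) * hcoef (of_real (s * t) * z) (of_real (- (s / 4)) * z\<^sup>2) n" for n
  proof -
    have "hcoef (of_real (s * t) * z) (of_real (- (s / 4)) * z\<^sup>2) n = z ^ n * of_real (hcoef (s * t) (- (s / 4)) n)"
      by (simp only: hcoef_scale hcoef_of_real)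
    then show ?thesis
      by (simp only: herm_def exp_of_real mult.left_commute
          of_real_mult[of "exp (- (s / 2) * t\<^sup>2)" "hcoef (s * t) (- (s / 4)) n"])
  qed
  then show ?thesis
    using sums_mult[OF hcoef_sums[of "of_real (s * t) * z" "of_real (- (s / 4)) * z\<^sup>2"], of "exp (of_real (- (s / 2) * t\<^sup>2))"]
    by (simp add: bkernel_def mult_exp_exp algebra_simps)
qed

text \<open>The kernel with t and z replaced by |t| and r and with the sign of the quadratic term in
  z reversed, so that all coefficients of the series in r become nonnegative.\<close>

definition hbound :: "real \<Rightarrow> real \<Rightarrow> real \<Rightarrow> real"
  where "hbound s r t = exp (- (s / 2) * t\<^sup>2 + s * \<bar>t\<bar> * r + s / 4 * r\<^sup>2)"

text \<open>Taking absolute values inside \<open>hcoef\<close> only increases it, and the enlarged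
  coefficients sum to an exponential. The bound is uniform in N, so it controls single Hermite
  functions, all partial sums and, in the limit, the kernel.\<close>

lemma herm_sum_bound:
  assumes s: "s > 0" and r: "r \<ge> 0"
  shows "(\<Sum>n<N. r ^ n * \<bar>herm s n t\<bar>) \<le> hbound s r t"
proof -
  have nn: "0 \<le> hcoef (s * \<bar>t\<bar> * r) (s / 4 * r\<^sup>2) n" for n
    unfolding hcoef_def by (rule sum_nonneg) (use s r in auto)
  have "(\<Sum>n<N. r ^ n * \<bar>herm s n t\<bar>) \<le> (\<Sum>n<N. exp (- (s / 2) * t\<^sup>2) * hcoef (s * \<bar>t\<bar> * r) (s / 4 * r\<^sup>2) n)"
  proof (rule sum_mono)
    fix n
    have "\<bar>hcoef (s * t) (- (s / 4)) n\<bar> \<le> hcoef (s * \<bar>t\<bar>) (s / 4) n"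
      using norm_hcoef_le[of "s * t" "- (s / 4)" n] s by (simp add: abs_mult)
    then show "r ^ n * \<bar>herm s n t\<bar> \<le> exp (- (s / 2) * t\<^sup>2) * hcoef (s * \<bar>t\<bar> * r) (s / 4 * r\<^sup>2) n"
      unfolding hcoef_scale herm_def abs_mult using r by (simp add: mult.left_commute[of "r ^ n"] mult_left_mono)
  qed
  also have "\<dots> \<le> exp (- (s / 2) * t\<^sup>2) * exp (s * \<bar>t\<bar> * r + s / 4 * r\<^sup>2)"
    unfolding sum_distrib_left[symmetric]
    using sum_le_suminf[OF sums_summable[OF hcoef_sums], of "{..<N}" "s * \<bar>t\<bar> * r" "s / 4 * r\<^sup>2"] nn
      hcoef_sums[of "s * \<bar>t\<bar> * r" "s / 4 * r\<^sup>2"]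
    by (intro mult_left_mono) (auto simp: sums_iff)
  also have "\<dots> = hbound s r t"
    by (simp only: hbound_def exp_add[symmetric] add.assoc)
  finally show ?thesis .
qed

lemma hbound_L2:
  assumes s: "s > 0"
  shows "(\<lambda>t. of_real (hbound s r t)) \<in> L2_complex lebesgue"
proof -
  define c where "c = exp (s / 2 * r\<^sup>2)"
  have i: "integrable lborel (\<lambda>t. exp (- s * t\<^sup>2 + b * t))" for b
    using has_bochner_integral_gaussian[OF s, of b] by (rule integrable.intros)
  have "integrable lborel (\<lambda>t. c * (exp (- s * t\<^sup>2 + 2 * s * r * t) + exp (- s * t\<^sup>2 + (- 2 * s * r) * t)))"
    by (intro integrable_mult_right Bochner_Integration.integrable_add i)
  then have "integrable lborel (\<lambda>t. (hbound s r t)\<^sup>2)"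
  proof (rule Bochner_Integration.integrable_bound)
    show "AE t in lborel. norm ((hbound s r t)\<^sup>2) \<le>
        norm (c * (exp (- s * t\<^sup>2 + 2 * s * r * t) + exp (- s * t\<^sup>2 + (- 2 * s * r) * t)))"
    proof (rule AE_I2)
      fix t :: real
      have "(hbound s r t)\<^sup>2 = c * exp (- s * t\<^sup>2 + 2 * s * r * \<bar>t\<bar>)"
        by (simp add: hbound_def c_def mult_exp_exp algebra_simps flip: exp_of_nat_mult)
      \<comment> \<open>The absolute value is removed by bounding exp(2sr|t|), which equals one of
        exp(2srt) and exp(-2srt), by their sum; what remains are Gaussian integrals.\<close>
      also have "\<dots> \<le> c * (exp (- s * t\<^sup>2 + 2 * s * r * t) + exp (- s * t\<^sup>2 + (- 2 * s * r) * t))"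
      proof (intro mult_left_mono)
        have "2 * s * r * \<bar>t\<bar> = 2 * s * r * t \<or> 2 * s * r * \<bar>t\<bar> = (- 2 * s * r) * t"
          by (simp add: abs_if)
        then show "exp (- s * t\<^sup>2 + 2 * s * r * \<bar>t\<bar>) \<le>
            exp (- s * t\<^sup>2 + 2 * s * r * t) + exp (- s * t\<^sup>2 + (- 2 * s * r) * t)"
          by (elim disjE) (simp_all only: less_imp_le[OF exp_gt_zero] le_add_same_cancel1 le_add_same_cancel2)
      qed (simp add: c_def)
      finally show "norm ((hbound s r t)\<^sup>2) \<le>
          norm (c * (exp (- s * t\<^sup>2 + 2 * s * r * t) + exp (- s * t\<^sup>2 + (- 2 * s * r) * t)))"
        by simp
    qed
  qed (simp add: hbound_def)
  then have "integrable lebesgue (\<lambda>t. (hbound s r t)\<^sup>2)"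
    by (subst integrable_completion) (auto simp: hbound_def)
  moreover have "(\<lambda>t. complex_of_real (hbound s r t)) \<in> borel_measurable lebesgue"
    by (rule measurable_completion) (simp add: hbound_def)
  ultimately show ?thesis
    by (simp add: L2_complex_def)
qed

lemma herm_measurable [measurable]: "herm s n \<in> borel_measurable borel"
  unfolding herm_def hcoef_def by measurable

lemma bkernel_measurable [measurable]: "bkernel s z \<in> borel_measurable borel"
  unfolding bkernel_def by (intro borel_measurable_continuous_onI continuous_intros)

lemma L2_real_bound:
  assumes "s > 0" "g \<in> borel_measurable borel" "\<And>t. cmod (g t) \<le> hbound s r t"
  shows "g \<in> L2_complex lebesgue"
proof (rule L2_bound[OF hbound_L2[OF assms(1)] L2_zero])
  show "g \<in> borel_measurable lebesgue"
    by (rule measurable_completion) (use assms in simp)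
  show "(cmod (g t))\<^sup>2 \<le> 1 * (cmod (complex_of_real (hbound s r t)))\<^sup>2 + 0 * (cmod 0)\<^sup>2" for t
    using assms(3)[of t] by (simp add: power_mono)
qed

lemma herm_L2: "s > 0 \<Longrightarrow> (\<lambda>t. of_real (herm s n t)) \<in> L2_complex lebesgue"
proof (rule L2_real_bound)
  fix t assume s: "s > 0"
  have "\<bar>herm s n t\<bar> \<le> (\<Sum>i<Suc n. 1 ^ i * \<bar>herm s i t\<bar>)"
    by (simp add: sum_nonneg)
  also have "\<dots> \<le> hbound s 1 t"
    by (rule herm_sum_bound) (use s in auto)
  finally show "cmod (of_real (herm s n t)) \<le> hbound s 1 t"
    by simp
qed auto

lemma bkernel_L2: "s > 0 \<Longrightarrow> bkernel s z \<in> L2_complex lebesgue"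
proof (rule L2_real_bound)
  fix t assume s: "s > 0"
  show "cmod (bkernel s z t) \<le> hbound s (cmod z) t"
  proof (rule LIMSEQ_le_const2)
    show "(\<lambda>N. cmod (\<Sum>n<N. z ^ n * of_real (herm s n t))) \<longlonglongrightarrow> cmod (bkernel s z t)"
      using herm_generating[of z s t] unfolding sums_def by (rule tendsto_norm)
    have "cmod (\<Sum>n<N. z ^ n * of_real (herm s n t)) \<le> hbound s (cmod z) t" for N
      by (rule order_trans[OF norm_sum])
        (use herm_sum_bound[OF s, of "cmod z" t N] in \<open>simp add: norm_mult norm_power\<close>)
    then show "\<exists>N. \<forall>n\<ge>N. cmod (\<Sum>n<n. z ^ n * of_real (herm s n t)) \<le> hbound s (cmod z) t"
      by blast
  qed
qed auto

section \<open>The Taylor expansion of the Segal--Bargmann transform\<close>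

definition btransform :: "real \<Rightarrow> (real \<Rightarrow> complex) \<Rightarrow> complex \<Rightarrow> complex"
  where "btransform s \<phi> z = (\<integral>t. \<phi> t * bkernel s z t \<partial>lebesgue)"

text \<open>Dominated convergence in the generating series of the kernel: \<open>hbound\<close>
  majorises all partial sums, and its product with \<open>\<phi>\<close> is integrable because both
  are square integrable.\<close>

lemma btransform_sums:
  assumes s: "s > 0" and \<phi>: "\<phi> \<in> L2_complex lebesgue"
  shows "(\<lambda>n. (\<integral>t. \<phi> t * of_real (herm s n t) \<partial>lebesgue) * z ^ n) sums btransform s \<phi> z"
proof -
  have ih: "integrable lebesgue (\<lambda>t. \<phi> t * of_real (herm s n t))" for n
    by (rule L2_mult_integrable[OF \<phi> herm_L2[OF s]])
  have "(\<lambda>N. \<integral>t. (\<Sum>n<N. \<phi> t * of_real (herm s n t) * z ^ n) \<partial>lebesgue) \<longlonglongrightarrow> btransform s \<phi> z"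
    unfolding btransform_def
  proof (rule integral_dominated_convergence[where w = "\<lambda>t. cmod (\<phi> t * of_real (hbound s (cmod z) t))"])
    show "AE t in lebesgue. (\<lambda>N. \<Sum>n<N. \<phi> t * of_real (herm s n t) * z ^ n) \<longlonglongrightarrow> \<phi> t * bkernel s z t"
      using tendsto_mult_left[OF herm_generating[of z s, unfolded sums_def], of "\<phi> _"]
      by (intro AE_I2) (simp add: sum_distrib_left mult_ac)
    show "AE t in lebesgue. norm (\<Sum>n<N. \<phi> t * of_real (herm s n t) * z ^ n) \<le>
        cmod (\<phi> t * of_real (hbound s (cmod z) t))" for N
    proof (rule AE_I2)
      fix t
      have "(\<Sum>n<N. \<phi> t * of_real (herm s n t) * z ^ n) = \<phi> t * (\<Sum>n<N. z ^ n * of_real (herm s n t))"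
        by (simp add: sum_distrib_left mult_ac)
      moreover have "cmod (\<Sum>n<N. z ^ n * of_real (herm s n t)) \<le> hbound s (cmod z) t"
        by (rule order_trans[OF norm_sum])
          (use herm_sum_bound[OF s, of "cmod z" t N] in \<open>simp add: norm_mult norm_power\<close>)
      ultimately show "norm (\<Sum>n<N. \<phi> t * of_real (herm s n t) * z ^ n) \<le>
          cmod (\<phi> t * of_real (hbound s (cmod z) t))"
        using abs_ge_self order_trans by (fastforce simp: norm_mult intro: mult_left_mono)
    qed
    show "integrable lebesgue (\<lambda>t. cmod (\<phi> t * of_real (hbound s (cmod z) t)))"
      by (intro integrable_norm L2_mult_integrable[OF \<phi> hbound_L2[OF s]])
    show "(\<lambda>t. \<phi> t * bkernel s z t) \<in> borel_measurable lebesgue"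
      using L2_mult_integrable[OF \<phi> bkernel_L2[OF s]] by (rule borel_measurable_integrable)
    show "(\<lambda>t. \<Sum>n<N. \<phi> t * of_real (herm s n t) * z ^ n) \<in> borel_measurable lebesgue" for N
      by (intro borel_measurable_sum borel_measurable_times borel_measurable_integrable[OF ih]) simp
  qed
  also have "(\<lambda>N. \<integral>t. (\<Sum>n<N. \<phi> t * of_real (herm s n t) * z ^ n) \<partial>lebesgue) =
      (\<lambda>N. \<Sum>n<N. (\<integral>t. \<phi> t * of_real (herm s n t) \<partial>lebesgue) * z ^ n)"
    using ih by (simp add: Bochner_Integration.integral_sum)
  finally show ?thesis
    by (simp add: sums_def)
qed

section \<open>Orthogonality and completeness of the Hermite functions\<close>

definition hnorm :: "real \<Rightarrow> nat \<Rightarrow> real"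
  where "hnorm s n = sqrt (pi / s) * (s / 2) ^ n / fact n"

lemma hnorm_pos: "s > 0 \<Longrightarrow> hnorm s n > 0"
  by (simp add: hnorm_def)

text \<open>The pairing of two kernels at real points is a Gaussian integral, equal to
  $\sqrt{\pi/s}\, e^{sxy/2}$; comparing coefficients in $x$ and in $y$ gives the orthogonality
  relations of the Hermite functions.\<close>

lemma btransform_bkernel:
  assumes s: "s > 0"
  shows "btransform s (bkernel s (of_real y)) (of_real x) = of_real (sqrt (pi / s) * exp (s * x * y / 2))"
proof -
  have "has_bochner_integral lborel
      (\<lambda>t. exp (- (s / 4) * (x\<^sup>2 + y\<^sup>2)) * exp (- s * t\<^sup>2 + s * (x + y) * t))
      (exp (- (s / 4) * (x\<^sup>2 + y\<^sup>2)) * (sqrt (pi / s) * exp ((s * (x + y))\<^sup>2 / (4 * s))))"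
    by (intro has_bochner_integral_mult_right has_bochner_integral_gaussian s)
  also have "exp (- (s / 4) * (x\<^sup>2 + y\<^sup>2)) * (sqrt (pi / s) * exp ((s * (x + y))\<^sup>2 / (4 * s))) =
      sqrt (pi / s) * exp (s * x * y / 2)"
  proof -
    have "- (s / 4) * (x\<^sup>2 + y\<^sup>2) + (s * (x + y))\<^sup>2 / (4 * s) = s * x * y / 2"
      using s by (simp add: field_simps power2_eq_square)
    then show ?thesis
      by (simp add: mult_exp_exp mult.left_commute)
  qed
  finally have *: "has_bochner_integral lborel
      (\<lambda>t. complex_of_real (exp (- (s / 4) * (x\<^sup>2 + y\<^sup>2)) * exp (- s * t\<^sup>2 + s * (x + y) * t)))
      (of_real (sqrt (pi / s) * exp (s * x * y / 2)))"
    by (rule has_bochner_integral_of_real)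
  have "complex_of_real (exp (- (s / 4) * (x\<^sup>2 + y\<^sup>2)) * exp (- s * t\<^sup>2 + s * (x + y) * t)) =
      bkernel s (of_real y) t * bkernel s (of_real x) t" for t
    by (simp add: bkernel_def mult_exp_exp algebra_simps flip: exp_of_real)
  with * have "has_bochner_integral lborel (\<lambda>t. bkernel s (of_real y) t * bkernel s (of_real x) t)
      (of_real (sqrt (pi / s) * exp (s * x * y / 2)))"
    by (simp only:)
  then show ?thesis
    unfolding btransform_def by (subst integral_completion) (auto simp: has_bochner_integral_iff)
qed

lemma integral_bkernel_herm:
  assumes s: "s > 0"
  shows "(\<integral>t. bkernel s (of_real y) t * of_real (herm s n t) \<partial>lebesgue) = of_real (hnorm s n * y ^ n)"
proof -
  \<comment> \<open>At real points the kernel is real. Passing to real parts brings the integrals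
    within reach of \<open>powser_unique_on_pos\<close>, which compares real coefficients.\<close>
  define I where "I n = (\<integral>t. Re (bkernel s (of_real y) t) * herm s n t \<partial>lebesgue)" for n
  have "bkernel s (of_real y) t = of_real (Re (bkernel s (of_real y) t))" for t
  proof -
    have "bkernel s (of_real y) t = of_real (exp (- (s / 2) * t\<^sup>2 + s * t * y - s / 4 * y\<^sup>2))"
      by (simp add: bkernel_def exp_of_real[symmetric])
    then show ?thesis
      by (simp only: Re_complex_of_real)
  qed
  then have I: "(\<integral>t. bkernel s (of_real y) t * of_real (herm s n t) \<partial>lebesgue) = of_real (I n)" for n
    unfolding I_def integral_complex_of_real[symmetric] of_real_mult by simp
  have "I n = hnorm s n * y ^ n"
  proof (rule powser_unique_on_pos)
    fix x :: real
    have "(\<lambda>n. complex_of_real (I n * x ^ n)) sums of_real (sqrt (pi / s) * exp (s * x * y / 2))"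
      using btransform_sums[OF s bkernel_L2[OF s], of "of_real y" "of_real x"]
      by (simp only: I btransform_bkernel[OF s] of_real_mult of_real_power)
    then show "(\<lambda>n. I n * x ^ n) sums (sqrt (pi / s) * exp (s * x * y / 2))"
      by (simp only: sums_of_real_iff)
    have "(\<lambda>n. sqrt (pi / s) * ((s * x * y / 2) ^ n / fact n)) sums (sqrt (pi / s) * exp (s * x * y / 2))"
      using sums_mult[OF exp_converges[of "s * x * y / 2"], of "sqrt (pi / s)"] by (simp add: field_simps)
    then show "(\<lambda>n. hnorm s n * y ^ n * x ^ n) sums (sqrt (pi / s) * exp (s * x * y / 2))"
      by (simp add: hnorm_def power_mult_distrib power_divide field_simps)
  qed
  then show ?thesis
    by (simp add: I)
qed

lemma herm_orthogonal:
  assumes s: "s > 0"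
  shows "(\<integral>t. herm s m t * herm s n t \<partial>lebesgue) = (if m = n then hnorm s n else 0)"
proof -
  define J where "J n = (\<integral>t. herm s m t * herm s n t \<partial>lebesgue)" for n
  have J: "(\<integral>t. complex_of_real (herm s m t) * of_real (herm s n t) \<partial>lebesgue) = of_real (J n)" for n
    unfolding J_def integral_complex_of_real[symmetric] of_real_mult by simp
  have "J n = (if m = n then hnorm s n else 0)"
  proof (rule powser_unique_on_pos)
    fix y :: real
    \<comment> \<open>With the two factors exchanged this is \<open>integral_bkernel_herm\<close>:
      the transform of the m-th Hermite function is a single monomial on the real axis, so comparing
      coefficients once more isolates the index m.\<close>
    have eq: "btransform s (\<lambda>t. of_real (herm s m t)) (of_real y) = of_real (hnorm s m * y ^ m)"
      unfolding btransform_def integral_bkernel_herm[OF s, symmetric] by (simp add: mult.commute)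
    have "(\<lambda>n. complex_of_real (J n * y ^ n)) sums of_real (hnorm s m * y ^ m)"
      using btransform_sums[OF s herm_L2[OF s], of m "of_real y"]
      by (simp only: J eq of_real_mult of_real_power)
    then show "(\<lambda>n. J n * y ^ n) sums (hnorm s m * y ^ m)"
      by (simp only: sums_of_real_iff)
    show "(\<lambda>n. (if m = n then hnorm s n else 0) * y ^ n) sums (hnorm s m * y ^ m)"
      using sums_single[of m "\<lambda>n. hnorm s n * y ^ n"] by (simp add: if_distrib[of "\<lambda>x. x * _"] eq_commute[of m] cong: if_cong)
  qed
  then show ?thesis
    by (simp add: J_def)
qed

text \<open>If all pairings vanish, the whole transform vanishes by its Taylor series. Restricted to
  the imaginary axis the transform is, up to a nonzero factor, the Fourier transform of
  \<open>\<phi>\<close> times a Gaussian, so \<open>fourier_unique\<close> applies.\<close>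

lemma herm_total:
  assumes s: "s > 0" and \<phi>: "\<phi> \<in> L2_complex lebesgue"
    and zero: "\<And>n. (\<integral>t. \<phi> t * of_real (herm s n t) \<partial>lebesgue) = 0"
  shows "AE t in lebesgue. \<phi> t = 0"
proof -
  define f where "f t = \<phi> t * exp (of_real (- (s / 2) * t\<^sup>2))" for t
  have B: "btransform s \<phi> z = 0" for z
    using btransform_sums[OF s \<phi>, of z] by (simp add: zero sums_iff)
  have "AE t in lebesgue. f t = 0"
  proof (rule fourier_unique)
    have "f = (\<lambda>t. \<phi> t * bkernel s 0 t)"
      by (simp add: f_def bkernel_def fun_eq_iff)
    then show "integrable lebesgue f"
      using L2_mult_integrable[OF \<phi> bkernel_L2[OF s]] by simp
    fix y :: real
    \<comment> \<open>Chosen so that the linear term s t w of the kernel is i y t; the term in w^2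
      does not depend on t and moves outside the integral.\<close>
    define w where "w = \<i> * of_real (y / s)"
    have w: "of_real (s * t) * w = \<i> * of_real (y * t)" for t
      using s by (simp add: w_def)
    have "f t * iexp (y * t) = exp (of_real (s / 4) * w\<^sup>2) * (\<phi> t * bkernel s w t)" for t
      unfolding f_def bkernel_def w exp_add exp_diff by simp
    then show "(\<integral>t. f t * iexp (y * t) \<partial>lebesgue) = 0"
      using B[of w] unfolding btransform_def by (simp only: integral_mult_right_zero mult_zero_right)
  qed
  then show ?thesis
    by eventually_elim (simp add: f_def)
qed

lemma complete_orthogonal_herm:
  "s > 0 \<Longrightarrow> complete_orthogonal_system lebesgue (herm s) (hnorm s)"
  by unfold_locales (auto simp: herm_L2 hnorm_pos herm_orthogonal intro: herm_total)

section \<open>Rotation invariance of the plane\<close>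

lemma borel_measurable_cnj' [measurable (raw)]:
  "f \<in> borel_measurable M \<Longrightarrow> (\<lambda>x. cnj (f x)) \<in> borel_measurable M"
  by (rule borel_measurable_continuous_on[where f = cnj]) (auto intro: continuous_intros)

text \<open>By Tonelli a shear is a translation on every horizontal line.\<close>

lemma nn_integral_shear_fst:
  fixes f :: "real \<times> real \<Rightarrow> ennreal"
  assumes f: "f \<in> borel_measurable borel"
  shows "(\<integral>\<^sup>+p. f (fst p + a * snd p, snd p) \<partial>lborel) = (\<integral>\<^sup>+p. f p \<partial>lborel)"
proof -
  have [measurable]: "f \<in> borel_measurable (borel \<Otimes>\<^sub>M borel)"
    using f by (simp add: borel_prod)
  have "(\<integral>\<^sup>+p. f (fst p + a * snd p, snd p) \<partial>lborel) = (\<integral>\<^sup>+y. \<integral>\<^sup>+x. f (x + a * y, y) \<partial>lborel \<partial>lborel)"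
    unfolding lborel_prod[symmetric] by (subst lborel_pair.nn_integral_snd[symmetric]) auto
  also have "\<dots> = (\<integral>\<^sup>+y. \<integral>\<^sup>+x. f (x, y) \<partial>lborel \<partial>lborel)"
  proof (rule nn_integral_cong)
    fix y :: real
    show "(\<integral>\<^sup>+x. f (x + a * y, y) \<partial>lborel) = (\<integral>\<^sup>+x. f (x, y) \<partial>lborel)"
      using nn_integral_real_affine[of "\<lambda>x. f (x, y)" 1 "a * y"] by (simp add: add.commute)
  qed
  also have "\<dots> = (\<integral>\<^sup>+p. f p \<partial>lborel)"
    unfolding lborel_prod[symmetric] by (subst lborel_pair.nn_integral_snd[symmetric]) auto
  finally show ?thesis .
qed

lemma nn_integral_shear_snd:
  fixes f :: "real \<times> real \<Rightarrow> ennreal"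
  assumes f: "f \<in> borel_measurable borel"
  shows "(\<integral>\<^sup>+p. f (fst p, snd p + a * fst p) \<partial>lborel) = (\<integral>\<^sup>+p. f p \<partial>lborel)"
proof -
  have [measurable]: "f \<in> borel_measurable (borel \<Otimes>\<^sub>M borel)"
    using f by (simp add: borel_prod)
  have "(\<integral>\<^sup>+p. f (fst p, snd p + a * fst p) \<partial>lborel) = (\<integral>\<^sup>+x. \<integral>\<^sup>+y. f (x, y + a * x) \<partial>lborel \<partial>lborel)"
    unfolding lborel_prod[symmetric] by (subst lborel.nn_integral_fst[symmetric]) auto
  also have "\<dots> = (\<integral>\<^sup>+x. \<integral>\<^sup>+y. f (x, y) \<partial>lborel \<partial>lborel)"
  proof (rule nn_integral_cong)
    fix x :: real
    show "(\<integral>\<^sup>+y. f (x, y + a * x) \<partial>lborel) = (\<integral>\<^sup>+y. f (x, y) \<partial>lborel)"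
      using nn_integral_real_affine[of "\<lambda>y. f (x, y)" 1 "a * x"] by (simp add: add.commute)
  qed
  also have "\<dots> = (\<integral>\<^sup>+p. f p \<partial>lborel)"
    unfolding lborel_prod[symmetric] by (subst lborel.nn_integral_fst[symmetric]) auto
  finally show ?thesis .
qed

text \<open>A rotation other than by $\pi$ is a product of three shears, with parameters
  $-t$, $s$, $-t$ for $t = s / (1 + c)$.\<close>

lemma nn_integral_rotation:
  fixes f :: "real \<times> real \<Rightarrow> ennreal"
  assumes f: "f \<in> borel_measurable borel" and cs: "c\<^sup>2 + s\<^sup>2 = 1" "c \<noteq> - 1"
  shows "(\<integral>\<^sup>+p. f (c * fst p - s * snd p, s * fst p + c * snd p) \<partial>lborel) = (\<integral>\<^sup>+p. f p \<partial>lborel)"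
proof -
  define t where "t = s / (1 + c)"
  have c: "1 + c \<noteq> 0" using cs by auto
  have "s * s = (1 - c) * (1 + c)"
    using cs by (simp add: power2_eq_square algebra_simps)
  then have ts: "t * s = 1 - c"
    using c by (simp add: t_def)
  have tc: "t * (1 + c) = s"
    using c by (simp add: t_def)
  have eq: "(fst q + (- t) * snd q, snd q) = (c * fst p - s * snd p, s * fst p + c * snd p)"
    if r: "r = (fst p + (- t) * snd p, snd p)" and q: "q = (fst r, snd r + s * fst r)" for p q r :: "real \<times> real"
  proof -
    have "snd q = s * fst p + (1 - t * s) * snd p"
      by (simp add: q r algebra_simps)
    then have 1: "snd q = s * fst p + c * snd p"
      by (simp add: ts)
    have "fst q - t * snd q = fst p - t * snd p - (t * s) * fst p - (t * c) * snd p"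
      by (simp add: 1) (simp add: q r algebra_simps)
    also have "\<dots> = c * fst p - (t * (1 + c)) * snd p"
      unfolding ts by (simp add: algebra_simps)
    finally show ?thesis using 1 tc by simp
  qed
  have [measurable]: "f \<in> borel_measurable (borel \<Otimes>\<^sub>M borel)"
    using f by (simp add: borel_prod)
  \<comment> \<open>\<open>?g\<close> is \<open>f\<close> after the last shear and \<open>?h\<close>
    is \<open>f\<close> after the last two; each of the steps below removes one shear.\<close>
  let ?g = "\<lambda>q. f (fst q + (- t) * snd q, snd q)"
  let ?h = "\<lambda>r. ?g (fst r, snd r + s * fst r)"
  have "(\<integral>\<^sup>+p. f (c * fst p - s * snd p, s * fst p + c * snd p) \<partial>lborel) =
      (\<integral>\<^sup>+p. ?h (fst p + (- t) * snd p, snd p) \<partial>lborel)"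
    by (intro nn_integral_cong) (simp only: eq[OF refl refl])
  also have "\<dots> = (\<integral>\<^sup>+r. ?h r \<partial>lborel)"
    by (rule nn_integral_shear_fst) (unfold borel_prod[symmetric], measurable)
  also have "\<dots> = (\<integral>\<^sup>+q. ?g q \<partial>lborel)"
    by (rule nn_integral_shear_snd) (unfold borel_prod[symmetric], measurable)
  also have "\<dots> = (\<integral>\<^sup>+p. f p \<partial>lborel)"
    by (rule nn_integral_shear_fst) (unfold borel_prod[symmetric], measurable)
  finally show ?thesis .
qed

text \<open>The nonnegative case applied to indicators shows that Lebesgue measure is its own image
  under the rotation, which carries over to complex integrands at once.\<close>

lemma integral_rotation:
  fixes f :: "real \<times> real \<Rightarrow> complex"
  assumes [measurable]: "f \<in> borel_measurable borel" and cs: "c\<^sup>2 + s\<^sup>2 = 1" "c \<noteq> - 1"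
  shows "(\<integral>p. f (c * fst p - s * snd p, s * fst p + c * snd p) \<partial>lborel) = (\<integral>p. f p \<partial>lborel)"
proof -
  define R where "R p = (c * fst p - s * snd p, s * fst p + c * snd p)" for p :: "real \<times> real"
  have [measurable]: "R \<in> borel \<rightarrow>\<^sub>M borel"
    unfolding R_def by (intro borel_measurable_continuous_onI continuous_intros)
  have "distr lborel borel R = lborel"
  proof (rule measure_eqI)
    fix A assume "A \<in> sets (distr lborel borel R)"
    then have A [measurable]: "A \<in> sets borel" by simp
    have "emeasure (distr lborel borel R) A = (\<integral>\<^sup>+p. indicator A p \<partial>distr lborel borel R)"
      by simp
    also have "\<dots> = (\<integral>\<^sup>+p. indicator A (R p) \<partial>lborel)"
      by (rule nn_integral_distr) auto
    also have "\<dots> = (\<integral>\<^sup>+p. indicator A p \<partial>lborel)"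
      unfolding R_def by (rule nn_integral_rotation[OF _ cs]) measurable
    finally show "emeasure (distr lborel borel R) A = emeasure lborel A"
      by simp
  qed simp
  then have "(\<integral>p. f p \<partial>lborel) = (\<integral>p. f p \<partial>distr lborel borel R)"
    by simp
  also have "\<dots> = (\<integral>p. f (R p) \<partial>lborel)"
    by (rule integral_distr) auto
  finally show ?thesis
    by (simp add: R_def)
qed

section \<open>Monomials on the plane\<close>

text \<open>For \<tau> = -i this identification of the plane with the complex numbers reverses
  orientation, so rotation angles below carry the sign \<open>Im \<tau>\<close>.\<close>

definition plane :: "complex \<Rightarrow> real \<times> real \<Rightarrow> complex"
  where "plane \<tau> p = of_real (fst p) + \<tau> * of_real (snd p)"

lemma plane_measurable [measurable]: "plane \<tau> \<in> borel_measurable borel"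
  unfolding plane_def by (intro borel_measurable_continuous_onI continuous_intros)

lemma complex_unit_cases:
  fixes \<tau> :: complex
  assumes "\<tau>\<^sup>2 = - 1"
  shows "\<tau> = \<i> * of_real (Im \<tau>)" "(Im \<tau>)\<^sup>2 = 1"
proof -
  have "(\<tau> - \<i>) * (\<tau> + \<i>) = 0"
    using assms by (simp add: algebra_simps power2_eq_square)
  then have "\<tau> = \<i> \<or> \<tau> = - \<i>"
    by (simp add: eq_neg_iff_add_eq_0)
  then show "\<tau> = \<i> * of_real (Im \<tau>)" "(Im \<tau>)\<^sup>2 = 1" by auto
qed

lemma norm_plane:
  assumes "\<tau>\<^sup>2 = - 1"
  shows "cmod (plane \<tau> p) = norm p"
proof -
  have "plane \<tau> p = of_real (fst p) + \<i> * of_real (Im \<tau> * snd p)"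
    unfolding plane_def by (subst complex_unit_cases(1)[OF assms]) simp
  then have "(cmod (plane \<tau> p))\<^sup>2 = (fst p)\<^sup>2 + (snd p)\<^sup>2"
    using complex_unit_cases(2)[OF assms] by (simp add: cmod_power2 power_mult_distrib)
  then have "(cmod (plane \<tau> p))\<^sup>2 = (norm p)\<^sup>2"
    by (simp add: norm_prod_def)
  then show ?thesis
    by simp
qed

lemma power_mult_cnj: "z ^ n * cnj (z ^ n) = of_real (cmod z ^ (2 * n))"
  by (simp only: complex_norm_square[symmetric] norm_power power_even_eq)

text \<open>With k = |m - n| and angle pi/(2k), the power e^k is i, so the product in question is i
  or -i. The nonnegative real part keeps e away from -1, the rotation that three shears do not
  reach.\<close>

lemma ex_unit_power_ne:
  fixes m n :: nat
  assumes "m \<noteq> n"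
  obtains e :: complex where "cmod e = 1" "Re e \<ge> 0" "e ^ m * cnj e ^ n \<noteq> 1"
proof -
  define k where "k = (if m < n then n - m else m - n)"
  have k: "k > 0" using assms by (auto simp: k_def)
  define e where "e = cis (pi / (2 * k))"
  have e: "cmod e = 1" by (simp add: e_def)
  then have ee: "e * cnj e = 1"
    by (simp add: complex_norm_square[symmetric])
  have ek: "e ^ k = \<i>"
    unfolding e_def by (subst Complex.DeMoivre) (use k in \<open>simp add: complex_eq_iff\<close>)
  have "pi / (2 * k) \<le> pi / 2"
    using k by (intro divide_left_mono) auto
  then have "Re e \<ge> 0"
    by (simp add: e_def) (rule cos_ge_zero, auto intro: order_trans[of _ 0])
  moreover have "e ^ m * cnj e ^ n \<noteq> 1"
  proof (cases "m < n")
    case True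
    then have "e ^ m * cnj e ^ n = (e * cnj e) ^ m * cnj (e ^ k)"
      by (simp add: k_def power_mult_distrib mult.assoc flip: power_add)
    then show ?thesis
      using ee ek by (simp add: complex_eq_iff)
  next
    case False
    then have "e ^ m * cnj e ^ n = (e * cnj e) ^ n * e ^ k"
      by (simp add: k_def power_mult_distrib mult_ac flip: power_add)
    then show ?thesis
      using ee ek by (simp add: complex_eq_iff)
  qed
  ultimately show thesis
    using that e by blast
qed

text \<open>A suitable rotation multiplies the integrand by a constant different from 1 without
  changing the integral. The radial weight is left arbitrary so that it can include the cut-off to a
  disk.\<close>

lemma monomials_orthogonal:
  assumes \<tau>: "\<tau>\<^sup>2 = - 1" and [measurable]: "w \<in> borel_measurable borel" and mn: "m \<noteq> n"
  shows "(\<integral>p. complex_of_real (w (norm p)) * (plane \<tau> p ^ m * cnj (plane \<tau> p ^ n)) \<partial>lborel) = 0"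
    (is "(\<integral>p. ?f p \<partial>lborel) = 0")
proof -
  obtain e :: complex where e: "cmod e = 1" "Re e \<ge> 0" "e ^ m * cnj e ^ n \<noteq> 1"
    using ex_unit_power_ne[OF mn] .
  define c where "c = Re e"
  \<comment> \<open>The sign makes e = c + \<tau> s, so that multiplication by e becomes the
    rotation with entries c and s in the coordinates of \<open>plane \<tau>\<close>.\<close>
  define s where "s = Im \<tau> * Im e"
  have "c\<^sup>2 + s\<^sup>2 = (cmod e)\<^sup>2"
    using complex_unit_cases(2)[OF \<tau>] by (simp add: c_def s_def power_mult_distrib cmod_power2)
  with e have cs: "c\<^sup>2 + s\<^sup>2 = 1" "c \<noteq> - 1"
    by (auto simp: c_def)
  have es: "e = of_real c + \<tau> * of_real s"
  proof -
    have "\<tau> * of_real s = \<i> * of_real ((Im \<tau>)\<^sup>2 * Im e)"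
      by (subst complex_unit_cases(1)[OF \<tau>]) (simp add: s_def power2_eq_square)
    then show ?thesis
      using complex_unit_cases(2)[OF \<tau>] by (simp add: c_def complex_eq[symmetric])
  qed
  define R where "R p = (c * fst p - s * snd p, s * fst p + c * snd p)" for p
  have rot: "plane \<tau> (R p) = e * plane \<tau> p" for p
  proof -
    have "e * plane \<tau> p - plane \<tau> (R p) = (\<tau>\<^sup>2 + 1) * (of_real s * of_real (snd p))"
      by (simp add: plane_def R_def es power2_eq_square algebra_simps)
    then show ?thesis using \<tau> by simp
  qed
  have nR: "norm (R p) = norm p" for p
    using arg_cong[OF rot, of cmod p] e by (simp add: norm_mult norm_plane[OF \<tau>])
  have "(\<integral>p. ?f p \<partial>lborel) = (\<integral>p. ?f (R p) \<partial>lborel)"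
    unfolding R_def by (rule integral_rotation[OF _ cs, symmetric]) measurable
  also have "\<dots> = (\<integral>p. (e ^ m * cnj e ^ n) * ?f p \<partial>lborel)"
    by (simp add: rot nR power_mult_distrib mult_ac)
  also have "\<dots> = (e ^ m * cnj e ^ n) * (\<integral>p. ?f p \<partial>lborel)"
    by (rule integral_mult_right_zero)
  finally have "(1 - e ^ m * cnj e ^ n) * (\<integral>p. ?f p \<partial>lborel) = 0"
    by (simp add: algebra_simps)
  with e(3) show ?thesis
    by simp
qed

section \<open>Parseval's identity on disks and on the whole plane\<close>

lemma nn_integral_exhaust_cball:
  fixes f :: "'a::euclidean_space \<Rightarrow> ennreal"
  assumes [measurable]: "f \<in> borel_measurable borel"
  shows "(\<integral>\<^sup>+p. f p \<partial>lborel) = (SUP k::nat. \<integral>\<^sup>+p. f p * indicator (cball 0 (real k)) p \<partial>lborel)"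
proof -
  have [measurable]: "cball (0::'a) (real k) \<in> sets borel" for k
    by simp
  have inc: "incseq (\<lambda>k p. f p * indicator (cball 0 (real k)) p)"
    by (auto simp: incseq_def le_fun_def indicator_def)
  have "f p = (SUP k::nat. f p * indicator (cball 0 (real k)) p)" for p
  proof (rule LIMSEQ_unique)
    show "(\<lambda>k. f p * indicator (cball 0 (real k)) p) \<longlonglongrightarrow> (SUP k::nat. f p * indicator (cball 0 (real k)) p)"
      using inc by (intro LIMSEQ_SUP) (auto simp: incseq_def le_fun_def)
    obtain k0 :: nat where "norm p \<le> real k0"
      using real_arch_simple by blast
    then show "(\<lambda>k. f p * indicator (cball 0 (real k)) p) \<longlonglongrightarrow> f p"
      by (intro tendsto_eventually eventually_sequentiallyI[of k0]) (auto simp: indicator_def)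
  qed
  then have "(\<integral>\<^sup>+p. f p \<partial>lborel) = (\<integral>\<^sup>+p. (SUP k::nat. f p * indicator (cball 0 (real k)) p) \<partial>lborel)"
    by (intro nn_integral_cong) blast
  also have "\<dots> = (SUP k::nat. \<integral>\<^sup>+p. f p * indicator (cball 0 (real k)) p \<partial>lborel)"
    by (rule nn_integral_monotone_convergence_SUP[OF inc]) measurable
  finally show ?thesis .
qed

text \<open>Parseval's identity on a disk: there the Taylor series converges uniformly.\<close>

lemma parseval_disk:
  fixes a :: "nat \<Rightarrow> complex"
  assumes \<tau>: "\<tau>\<^sup>2 = - 1" and \<alpha>: "\<alpha> > 0" and F: "\<And>z. (\<lambda>n. a n * z ^ n) sums F z"
    and Fm [measurable]: "F \<in> borel_measurable borel"
  shows "(\<integral>\<^sup>+p. ennreal ((cmod (F (plane \<tau> p)))\<^sup>2 * exp (- \<alpha> * (norm p)\<^sup>2)) * indicator (cball 0 R) p \<partial>lborel) =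
    (\<Sum>n. ennreal ((cmod (a n))\<^sup>2) *
      (\<integral>\<^sup>+p. ennreal ((norm p) ^ (2 * n) * exp (- \<alpha> * (norm p)\<^sup>2)) * indicator (cball 0 R) p
        \<partial>(lborel :: (real \<times> real) measure)))"
proof (cases "R \<ge> 0")
  case False
  then show ?thesis by simp
next
  case R: True
  \<comment> \<open>The disk is absorbed into the radial weight, so that
    \<open>monomials_orthogonal\<close> applies to the truncated integrals.\<close>
  define w where "w r = indicator {..R} r * exp (- \<alpha> * r\<^sup>2)" for r :: real
  have [measurable]: "w \<in> borel_measurable borel"
    unfolding w_def by measurable
  have w: "0 \<le> w r" "w r \<le> indicator {..R} r" for r
    using \<alpha> by (auto simp: w_def indicator_def)
  have ib: "integrable lborel (\<lambda>p::real \<times> real. C * indicator (cball 0 R) p :: real)" for C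
    by (intro integrable_mult_right integrable_real_indicator)
      (auto intro!: emeasure_bounded_finite[simplified])
  have bnd: "integrable lborel g"
    if [measurable]: "g \<in> borel_measurable borel" and "\<And>p. norm p \<le> R \<Longrightarrow> norm (g p) \<le> C" "\<And>p. norm p > R \<Longrightarrow> g p = 0"
    for g :: "real \<times> real \<Rightarrow> complex" and C
    by (rule Bochner_Integration.integrable_bound[OF ib[of C]])
      (use that in \<open>auto simp: indicator_def intro!: AE_I2 order_trans[OF _ abs_ge_self]\<close>)
  define I where "I n = (\<integral>p. w (norm p) * norm p ^ (2 * n) \<partial>(lborel :: (real \<times> real) measure))" for n
  have mono_int: "integrable lborel (\<lambda>p. of_real (w (norm p)) * (plane \<tau> p ^ m * cnj (plane \<tau> p ^ n)))" for m n
  proof (rule bnd[where C = "1 * (R ^ m * R ^ n)"])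
    fix p :: "real \<times> real" assume p: "norm p \<le> R"
    have "norm (of_real (w (norm p)) * (plane \<tau> p ^ m * cnj (plane \<tau> p ^ n))) = w (norm p) * (norm p ^ m * norm p ^ n)"
      using w by (simp add: norm_mult norm_power norm_plane[OF \<tau>])
    also have "\<dots> \<le> 1 * (R ^ m * R ^ n)"
      using w[of "norm p"] p R by (intro mult_mono power_mono) (auto simp: indicator_def)
    finally show "norm (of_real (w (norm p)) * (plane \<tau> p ^ m * cnj (plane \<tau> p ^ n))) \<le> 1 * (R ^ m * R ^ n)" .
  next
    fix p :: "real \<times> real" assume "R < norm p"
    then show "complex_of_real (w (norm p)) * (plane \<tau> p ^ m * cnj (plane \<tau> p ^ n)) = 0"
      by (simp add: w_def)
  qed measurable
  have inner: "(\<integral>p. of_real (w (norm p)) * (plane \<tau> p ^ m * cnj (plane \<tau> p ^ n)) \<partial>lborel) =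
      (if m = n then complex_of_real (I n) else 0)" for m n
  proof (cases "m = n")
    case True
    have "plane \<tau> p ^ n * cnj (plane \<tau> p ^ n) = of_real (norm p ^ (2 * n))" for p
      by (simp only: power_mult_cnj norm_plane[OF \<tau>])
    then show ?thesis
      using True by (simp only: I_def simp_thms if_True integral_complex_of_real flip: of_real_mult)
  next
    case False
    then show ?thesis
      using monomials_orthogonal[OF \<tau> _ False, of w] by simp
  qed
  define S where "S N z = (\<Sum>n<N. a n * z ^ n)" for N z
  have [measurable]: "S N \<in> borel_measurable borel" for N
    unfolding S_def by measurable
  have S: "(\<integral>p. of_real (w (norm p)) * (S N (plane \<tau> p) * cnj (S N (plane \<tau> p))) \<partial>lborel) =
      of_real (\<Sum>n<N. (cmod (a n))\<^sup>2 * I n)" for N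
  proof -
    have "of_real (w (norm p)) * (S N (plane \<tau> p) * cnj (S N (plane \<tau> p))) =
        (\<Sum>m<N. \<Sum>n<N. a m * cnj (a n) * (of_real (w (norm p)) * (plane \<tau> p ^ m * cnj (plane \<tau> p ^ n))))" for p
      by (simp add: S_def sum_product sum_distrib_left mult_ac) (rule sum.swap)
    then have "(\<integral>p. of_real (w (norm p)) * (S N (plane \<tau> p) * cnj (S N (plane \<tau> p))) \<partial>lborel) =
        (\<Sum>m<N. \<Sum>n<N. a m * cnj (a n) * (if m = n then of_real (I n) else 0))"
      using mono_int by (simp add: Bochner_Integration.integral_sum inner del: complex_cnj_power)
    also have "\<dots> = (\<Sum>m<N. of_real ((cmod (a m))\<^sup>2 * I m))"
      by (intro sum.cong refl) (simp add: if_distrib complex_norm_square[symmetric] sum.delta cong: if_cong)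
    finally show ?thesis by simp
  qed
  define C where "C = (\<Sum>n. cmod (a n) * R ^ n)"
  have sumC: "summable (\<lambda>n. cmod (a n) * R ^ n)"
  proof -
    \<comment> \<open>Convergence at the larger radius R + 1 gives absolute convergence at
      R.\<close>
    have "summable (\<lambda>n. norm (a n * of_real R ^ n))"
      by (rule powser_insidea[where x = "of_real (R + 1)"]) (use F R in \<open>auto simp: sums_iff\<close>)
    then show ?thesis using R by (simp add: norm_mult norm_power)
  qed
  have SC: "cmod (S N z) \<le> C" if "cmod z \<le> R" for N z
  proof -
    have "cmod (S N z) \<le> (\<Sum>n<N. cmod (a n) * R ^ n)"
      unfolding S_def by (rule order_trans[OF norm_sum], rule sum_mono)
        (use that in \<open>auto simp: norm_mult norm_power intro!: mult_left_mono power_mono\<close>)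
    also have "\<dots> \<le> C"
      unfolding C_def by (rule sum_le_suminf[OF sumC]) (use R in auto)
    finally show ?thesis .
  qed
  have C0: "0 \<le> C" using SC[of 0 0] R by (simp add: S_def)
  have lim: "(\<lambda>N. S N z) \<longlonglongrightarrow> F z" for z
    using F[of z] by (simp add: S_def sums_def)
  have FC: "cmod (F z) \<le> C" if "cmod z \<le> R" for z
    by (rule LIMSEQ_le_const2[OF tendsto_norm[OF lim]]) (use SC[OF that] in auto)
  \<comment> \<open>Stated for any function bounded by C on the disk: for the partial sums it is the
    majorant, for \<open>F\<close> it gives integrability.\<close>
  have cb: "norm (complex_of_real (w (norm p)) * (g (plane \<tau> p) * cnj (g (plane \<tau> p)))) \<le> C * C * indicator (cball 0 R) p"
    if "\<And>z. cmod z \<le> R \<Longrightarrow> cmod (g z) \<le> C" for g p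
  proof (cases "norm p \<le> R")
    case True
    have "w (norm p) * (cmod (g (plane \<tau> p)) * cmod (g (plane \<tau> p))) \<le> 1 * (C * C)"
      using w[of "norm p"] True C0 that[of "plane \<tau> p"] by (intro mult_mono) (auto simp: indicator_def norm_plane[OF \<tau>])
    with True show ?thesis using w by (simp add: norm_mult)
  qed (simp add: w_def)
  have "(\<lambda>N. \<integral>p. of_real (w (norm p)) * (S N (plane \<tau> p) * cnj (S N (plane \<tau> p))) \<partial>lborel)
      \<longlonglongrightarrow> (\<integral>p. of_real (w (norm p)) * (F (plane \<tau> p) * cnj (F (plane \<tau> p))) \<partial>lborel)"
  proof (rule integral_dominated_convergence[OF _ _ ib[of "C * C"]])
    show "AE p in lborel. (\<lambda>N. of_real (w (norm p)) * (S N (plane \<tau> p) * cnj (S N (plane \<tau> p))))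
      \<longlonglongrightarrow> of_real (w (norm p)) * (F (plane \<tau> p) * cnj (F (plane \<tau> p)))"
      by (intro AE_I2 tendsto_intros lim)
    show "AE p in lborel. norm (complex_of_real (w (norm p)) * (S N (plane \<tau> p) * cnj (S N (plane \<tau> p)))) \<le>
        C * C * indicator (cball 0 R) p" for N
      by (intro AE_I2 cb SC)
  qed measurable
  then have "(\<lambda>N. complex_of_real (\<Sum>n<N. (cmod (a n))\<^sup>2 * I n))
      \<longlonglongrightarrow> of_real (\<integral>p. w (norm p) * (cmod (F (plane \<tau> p)))\<^sup>2 \<partial>lborel)"
    unfolding S by (simp only: complex_norm_square[symmetric] of_real_mult[symmetric] integral_complex_of_real)
  then have sums: "(\<lambda>n. (cmod (a n))\<^sup>2 * I n) sums (\<integral>p. w (norm p) * (cmod (F (plane \<tau> p)))\<^sup>2 \<partial>lborel)"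
    unfolding sums_def tendsto_of_real_iff .
  have I0: "0 \<le> I n" for n
    unfolding I_def by (intro Bochner_Integration.integral_nonneg mult_nonneg_nonneg) (auto simp: w)
  have wi: "ennreal (g * exp (- \<alpha> * (norm p)\<^sup>2)) * indicator (cball 0 R) p = ennreal (w (norm p) * g)"
    for g and p :: "real \<times> real"
    by (simp add: w_def indicator_def mult.commute)
  have "(\<integral>\<^sup>+p. ennreal (w (norm p) * (cmod (F (plane \<tau> p)))\<^sup>2) \<partial>lborel) =
      ennreal (\<integral>p. w (norm p) * (cmod (F (plane \<tau> p)))\<^sup>2 \<partial>lborel)"
  proof (rule nn_integral_eq_integral)
    have "integrable lborel (\<lambda>p. complex_of_real (w (norm p)) * (F (plane \<tau> p) * cnj (F (plane \<tau> p))))"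
      by (rule Bochner_Integration.integrable_bound[OF ib[of "C * C"]])
        (auto intro!: AE_I2 order_trans[OF _ abs_ge_self] cb[OF FC, simplified])
    then show "integrable lborel (\<lambda>p. w (norm p) * (cmod (F (plane \<tau> p)))\<^sup>2)"
      unfolding complex_norm_square[symmetric] of_real_mult[symmetric] by (simp only: complex_of_real_integrable_eq)
  qed (auto simp: w)
  also have "\<dots> = ennreal (\<Sum>n. (cmod (a n))\<^sup>2 * I n)"
    using sums by (simp add: sums_iff)
  also have "\<dots> = (\<Sum>n. ennreal ((cmod (a n))\<^sup>2 * I n))"
    by (rule suminf_ennreal2[symmetric]) (use sums I0 in \<open>auto simp: sums_iff\<close>)
  also have "\<dots> = (\<Sum>n. ennreal ((cmod (a n))\<^sup>2) * (\<integral>\<^sup>+p. ennreal (w (norm p) * norm p ^ (2 * n)) \<partial>(lborel :: (real \<times> real) measure)))"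
  proof (intro suminf_cong)
    fix n
    have "(\<integral>\<^sup>+p. ennreal (w (norm p) * norm p ^ (2 * n)) \<partial>(lborel :: (real \<times> real) measure)) = ennreal (I n)"
      unfolding I_def
    proof (rule nn_integral_eq_integral)
      show "integrable lborel (\<lambda>p::real \<times> real. w (norm p) * norm p ^ (2 * n))"
        using mono_int[of n n]
        by (simp only: power_mult_cnj norm_plane[OF \<tau>] of_real_mult[symmetric] complex_of_real_integrable_eq)
    qed (auto simp: w)
    then show "ennreal ((cmod (a n))\<^sup>2 * I n) =
        ennreal ((cmod (a n))\<^sup>2) * (\<integral>\<^sup>+p. ennreal (w (norm p) * norm p ^ (2 * n)) \<partial>(lborel :: (real \<times> real) measure))"
      by (simp add: ennreal_mult I0)
  qed
  finally show ?thesis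
    unfolding wi .
qed

text \<open>Monotone convergence in the radius, on both sides; the supremum passes through the
  series because each term increases with the disk. All quantities may be infinite, and the moments
  are still unevaluated.\<close>

lemma parseval_plane_moments:
  fixes a :: "nat \<Rightarrow> complex"
  assumes \<tau>: "\<tau>\<^sup>2 = - 1" and \<alpha>: "\<alpha> > 0" and F: "\<And>z. (\<lambda>n. a n * z ^ n) sums F z"
    and Fm [measurable]: "F \<in> borel_measurable borel"
  shows "(\<integral>\<^sup>+p. ennreal ((cmod (F (plane \<tau> p)))\<^sup>2 * exp (- \<alpha> * (norm p)\<^sup>2)) \<partial>lborel) =
    (\<Sum>n. ennreal ((cmod (a n))\<^sup>2) *
      (\<integral>\<^sup>+p. ennreal ((norm p) ^ (2 * n) * exp (- \<alpha> * (norm p)\<^sup>2)) \<partial>(lborel :: (real \<times> real) measure)))"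
proof -
  define m where "m n k = (\<integral>\<^sup>+p. ennreal ((norm p) ^ (2 * n) * exp (- \<alpha> * (norm p)\<^sup>2)) *
    indicator (cball 0 (real k)) p \<partial>(lborel :: (real \<times> real) measure))" for n k
  have M: "(SUP k. m n k) = (\<integral>\<^sup>+p. ennreal ((norm p) ^ (2 * n) * exp (- \<alpha> * (norm p)\<^sup>2)) \<partial>(lborel :: (real \<times> real) measure))" for n
    unfolding m_def by (rule nn_integral_exhaust_cball[symmetric]) measurable
  have inc: "incseq (m n)" for n
    unfolding m_def by (auto simp: incseq_def indicator_def intro!: nn_integral_mono)
  have "(\<integral>\<^sup>+p. ennreal ((cmod (F (plane \<tau> p)))\<^sup>2 * exp (- \<alpha> * (norm p)\<^sup>2)) \<partial>lborel) =
      (SUP k. \<Sum>n. ennreal ((cmod (a n))\<^sup>2) * m n k)"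
    unfolding m_def parseval_disk[OF assms, symmetric] by (rule nn_integral_exhaust_cball) measurable
  also have "\<dots> = (\<Sum>n. SUP k. ennreal ((cmod (a n))\<^sup>2) * m n k)"
    by (rule ennreal_suminf_SUP_eq[symmetric]) (use inc in \<open>auto simp: incseq_def intro!: mult_left_mono\<close>)
  also have "\<dots> = (\<Sum>n. ennreal ((cmod (a n))\<^sup>2) * (SUP k. m n k))"
    by (simp add: SUP_mult_left_ennreal)
  finally show ?thesis
    by (simp only: M)
qed

section \<open>The moments of the Gaussian on the plane\<close>

lemma nn_integral_lborel_prod:
  fixes f :: "'a::euclidean_space \<times> 'b::euclidean_space \<Rightarrow> ennreal"
  assumes "f \<in> borel_measurable borel"
  shows "(\<integral>\<^sup>+p. f p \<partial>lborel) = (\<integral>\<^sup>+x. \<integral>\<^sup>+y. f (x, y) \<partial>lborel \<partial>lborel)"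
proof -
  have [measurable]: "f \<in> borel_measurable (borel \<Otimes>\<^sub>M borel)"
    using assms by (simp add: borel_prod)
  show ?thesis
    unfolding lborel_prod[symmetric] by (subst lborel.nn_integral_fst[symmetric]) auto
qed

definition bnorm :: "real \<Rightarrow> nat \<Rightarrow> real"
  where "bnorm \<alpha> n = pi / \<alpha> * fact n / \<alpha> ^ n"

lemma bnorm_pos: "\<alpha> > 0 \<Longrightarrow> bnorm \<alpha> n > 0"
  by (simp add: bnorm_def)

text \<open>The factor exp(b x) is |exp(b z / 2)|^2 for z = x + i y, the form in which it meets
  Parseval's identity. The integral factors into two Gaussian integrals on the line.\<close>

lemma nn_integral_exp_plane:
  fixes \<alpha> b :: real
  assumes \<alpha>: "\<alpha> > 0"
  shows "(\<integral>\<^sup>+p. ennreal (exp (b * fst p) * exp (- \<alpha> * (norm p)\<^sup>2)) \<partial>(lborel :: (real \<times> real) measure)) =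
    ennreal (pi / \<alpha> * exp (b\<^sup>2 / (4 * \<alpha>)))"
proof -
  have G: "(\<integral>\<^sup>+x. ennreal (exp (- \<alpha> * x\<^sup>2 + c * x)) \<partial>lborel) = ennreal (sqrt (pi / \<alpha>) * exp (c\<^sup>2 / (4 * \<alpha>)))" for c
    using has_bochner_integral_gaussian[OF \<alpha>, of c]
    by (subst nn_integral_eq_integral) (auto simp: has_bochner_integral_iff)
  have eq: "ennreal (exp (b * x) * exp (- \<alpha> * (norm (x, y))\<^sup>2)) =
      ennreal (exp (- \<alpha> * x\<^sup>2 + b * x)) * ennreal (exp (- \<alpha> * y\<^sup>2 + 0 * y))" for x y :: real
    by (simp add: norm_prod_def mult_exp_exp algebra_simps flip: ennreal_mult)
  have "(\<integral>\<^sup>+p. ennreal (exp (b * fst p) * exp (- \<alpha> * (norm p)\<^sup>2)) \<partial>(lborel :: (real \<times> real) measure)) =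
      (\<integral>\<^sup>+x. \<integral>\<^sup>+y. ennreal (exp (b * fst (x, y)) * exp (- \<alpha> * (norm (x, y::real))\<^sup>2)) \<partial>lborel \<partial>lborel)"
    by (rule nn_integral_lborel_prod[of "\<lambda>p. ennreal (exp (b * fst p) * exp (- \<alpha> * (norm p)\<^sup>2))"])
      (intro measurable_compose[OF _ measurable_ennreal] borel_measurable_continuous_onI continuous_intros)
  also have "\<dots> = ennreal (sqrt (pi / \<alpha>) * exp (b\<^sup>2 / (4 * \<alpha>))) * ennreal (sqrt (pi / \<alpha>) * exp (0\<^sup>2 / (4 * \<alpha>)))"
    unfolding fst_conv eq by (subst nn_integral_cmult) (simp, subst nn_integral_multc, simp, simp only: G)
  also have "\<dots> = ennreal (pi / \<alpha> * exp (b\<^sup>2 / (4 * \<alpha>)))"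
  proof -
    have "(r * e) * (r * exp (0\<^sup>2 / (4 * \<alpha>))) = (r * r) * e" for r e :: real
      by simp
    moreover have "sqrt (pi / \<alpha>) * sqrt (pi / \<alpha>) = pi / \<alpha>" "0 \<le> sqrt (pi / \<alpha>)"
      using \<alpha> by simp_all
    ultimately show ?thesis
      by (subst ennreal_mult[symmetric]) (simp_all only: mult_nonneg_nonneg exp_ge_zero)
  qed
  finally show ?thesis .
qed

lemma sums_of_suminf_ennreal:
  assumes "(\<Sum>n. ennreal (f n)) = ennreal x" "\<And>n. 0 \<le> f n" "0 \<le> x"
  shows "f sums x"
proof -
  have s: "summable f"
    by (rule summable_suminf_not_top) (use assms in auto)
  then have "ennreal (suminf f) = ennreal x"
    using assms by (subst suminf_ennreal2[symmetric]) auto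
  then have "suminf f = x"
    using assms s by (simp add: suminf_nonneg)
  with s show ?thesis by (simp add: sums_iff)
qed

text \<open>Parseval's identity for $e^{tz}$ turns the Gaussian integral into a generating
  function of the moments.\<close>

lemma plane_moments:
  assumes \<alpha>: "\<alpha> > 0"
  shows "(\<integral>\<^sup>+p. ennreal ((norm p) ^ (2 * n) * exp (- \<alpha> * (norm p)\<^sup>2)) \<partial>(lborel :: (real \<times> real) measure)) =
    ennreal (bnorm \<alpha> n)"
proof -
  define m where "m n = (\<integral>\<^sup>+p. ennreal ((norm p) ^ (2 * n) * exp (- \<alpha> * (norm p)\<^sup>2)) \<partial>(lborel :: (real \<times> real) measure))" for n
  have \<tau>: "(\<i>::complex)\<^sup>2 = - 1" by simp
  \<comment> \<open>The parameter is t = sqrt r: the squared Taylor coefficients of exp(t z) are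
    then r^n/(n!)^2, which makes the right-hand side a power series in r.\<close>
  have gen: "(\<Sum>n. ennreal (((sqrt r) ^ n / fact n)\<^sup>2) * m n) = ennreal (pi / \<alpha> * exp (r / \<alpha>))" if r: "r > 0" for r :: real
  proof -
    have sums: "(\<lambda>n. complex_of_real (sqrt r ^ n / fact n) * z ^ n) sums exp (of_real (sqrt r) * z)" for z
      using exp_converges[of "of_real (sqrt r) * z"]
      by (simp add: scaleR_conv_of_real power_mult_distrib field_simps)
    have "(cmod (exp (of_real (sqrt r) * plane \<i> p)))\<^sup>2 = exp (2 * sqrt r * fst p)" for p
      by (simp add: plane_def power2_eq_square mult_exp_exp)
    then have "(\<integral>\<^sup>+p. ennreal ((cmod (exp (of_real (sqrt r) * plane \<i> p)))\<^sup>2 * exp (- \<alpha> * (norm p)\<^sup>2)) \<partial>lborel) =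
        ennreal (pi / \<alpha> * exp ((2 * sqrt r)\<^sup>2 / (4 * \<alpha>)))"
      by (simp only: nn_integral_exp_plane[OF \<alpha>])
    also have "(2 * sqrt r)\<^sup>2 / (4 * \<alpha>) = r / \<alpha>"
      using r by (simp add: power_mult_distrib)
    finally show ?thesis
      using parseval_plane_moments[OF \<tau> \<alpha> sums] r
      by (simp add: m_def norm_divide norm_power borel_measurable_continuous_onI continuous_intros)
  qed
  \<comment> \<open>At r = 1 the series has a finite sum and each moment enters with a positive
    factor, so none is infinite. Only then can the moments be treated as real coefficients.\<close>
  have fin: "m n \<noteq> \<top>" for n
  proof
    assume "m n = \<top>"
    then have "ennreal (((sqrt 1) ^ n / fact n)\<^sup>2) * m n = \<top>"
      by (simp add: ennreal_mult_top)
    moreover have "ennreal (((sqrt 1) ^ n / fact n)\<^sup>2) * m n \<le> (\<Sum>n. ennreal (((sqrt 1) ^ n / fact n)\<^sup>2) * m n)"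
      using sum_le_suminf[of "\<lambda>n. ennreal (((sqrt 1) ^ n / fact n)\<^sup>2) * m n" "{n}"] by simp
    ultimately have "(\<Sum>n. ennreal (((sqrt 1) ^ n / fact n)\<^sup>2) * m n) = \<top>"
      by (simp only: top_unique)
    with gen[of 1] show False by simp
  qed
  define v where "v n = enn2real (m n)" for n
  have v: "m n = ennreal (v n)" "0 \<le> v n" for n
    using fin[of n] by (auto simp: v_def less_top)
  have "v n / (fact n)\<^sup>2 = pi / \<alpha> * (1 / \<alpha> ^ n / fact n)"
  proof (rule powser_unique_on_pos)
    fix r :: real assume r: "r > 0"
    have eq: "((sqrt r) ^ n / fact n)\<^sup>2 = r ^ n / (fact n)\<^sup>2" for n
      using r by (simp add: power_divide real_sqrt_power[symmetric])
    have "(\<Sum>n. ennreal (v n / (fact n)\<^sup>2 * r ^ n)) = (\<Sum>n. ennreal (((sqrt r) ^ n / fact n)\<^sup>2) * m n)"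
      unfolding eq v(1) using r v(2) by (intro suminf_cong) (simp add: field_simps flip: ennreal_mult)
    then show "(\<lambda>n. v n / (fact n)\<^sup>2 * r ^ n) sums (pi / \<alpha> * exp (r / \<alpha>))"
      unfolding gen[OF r] by (rule sums_of_suminf_ennreal) (use r v \<alpha> in auto)
    show "(\<lambda>n. pi / \<alpha> * (1 / \<alpha> ^ n / fact n) * r ^ n) sums (pi / \<alpha> * exp (r / \<alpha>))"
      using sums_mult[OF exp_converges[of "r / \<alpha>"], of "pi / \<alpha>"] by (simp add: power_divide field_simps)
  qed
  then have "v n = bnorm \<alpha> n"
    by (simp add: bnorm_def field_simps power2_eq_square)
  then show ?thesis
    using v(1)[of n] by (simp add: m_def)
qed

lemma parseval_plane:
  fixes a :: "nat \<Rightarrow> complex"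
  assumes \<tau>: "\<tau>\<^sup>2 = - 1" and \<alpha>: "\<alpha> > 0" and F: "\<And>z. (\<lambda>n. a n * z ^ n) sums F z"
    and Fm: "F \<in> borel_measurable borel"
  shows "(\<integral>\<^sup>+p. ennreal ((cmod (F (plane \<tau> p)))\<^sup>2 * exp (- \<alpha> * (norm p)\<^sup>2)) \<partial>lborel) =
    (\<Sum>n. ennreal ((cmod (a n))\<^sup>2 * bnorm \<alpha> n))"
  unfolding parseval_plane_moments[OF assms] plane_moments[OF \<alpha>]
  using bnorm_pos[OF \<alpha>] by (simp add: ennreal_mult less_imp_le)

section \<open>The Segal--Bargmann transform\<close>

text \<open>For either unit |x + \<tau> y| is the Euclidean norm, and a holomorphic \<open>F\<close>
  is Borel, so Lebesgue integrability reduces to finiteness of one nonnegative integral. This is the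
  form in which Parseval's identity applies.\<close>

lemma bargmann_iff:
  assumes \<tau>: "\<tau>\<^sup>2 = - 1"
  shows "F \<in> bargmann \<alpha> \<tau> \<longleftrightarrow> F holomorphic_on UNIV \<and>
    (\<integral>\<^sup>+p. ennreal ((cmod (F (plane \<tau> p)))\<^sup>2 * exp (- \<alpha> * (norm p)\<^sup>2)) \<partial>lborel) < \<infinity>"
proof (cases "F holomorphic_on UNIV")
  case True
  then have [measurable]: "F \<in> borel_measurable borel"
    by (intro borel_measurable_continuous_onI holomorphic_on_imp_continuous_on)
  let ?g = "\<lambda>p. (cmod (F (plane \<tau> p)))\<^sup>2 * exp (- \<alpha> * (norm p)\<^sup>2)"
  have "(\<lambda>(x, y). (cmod (F (of_real x + \<tau> * of_real y)))\<^sup>2 * exp (- \<alpha> * (cmod (of_real x + \<tau> * of_real y))\<^sup>2)) = ?g"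
    using norm_plane[OF \<tau>] by (auto simp: plane_def fun_eq_iff)
  then have "F \<in> bargmann \<alpha> \<tau> \<longleftrightarrow> integrable lebesgue ?g"
    using True by (simp add: bargmann_def)
  also have "\<dots> \<longleftrightarrow> integrable lborel ?g"
    by (rule integrable_completion) measurable
  also have "\<dots> \<longleftrightarrow> (\<integral>\<^sup>+p. ennreal (?g p) \<partial>lborel) < \<infinity>"
    by (subst integrable_iff_bounded) auto
  finally show ?thesis using True by simp
qed (simp add: bargmann_def)

lemma hnorm_bnorm: "s > 0 \<Longrightarrow> hnorm s n * bnorm (s / 2) n = 2 * (pi / s) * sqrt (pi / s)"
  by (simp add: hnorm_def bnorm_def power_divide field_simps)

lemma btransform_holomorphic:
  assumes s: "s > 0" and \<phi>: "\<phi> \<in> L2_complex lebesgue"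
  shows "btransform s \<phi> holomorphic_on UNIV"
proof -
  have "btransform s \<phi> holomorphic_on ball 0 r" for r
    by (rule power_series_holomorphic) (use btransform_sums[OF s \<phi>] in simp)
  then have "btransform s \<phi> field_differentiable at z" for z
    by (rule holomorphic_on_imp_differentiable_at[of _ "ball 0 (norm z + 1)"]) auto
  then show ?thesis
    by (simp add: holomorphic_on_def)
qed

text \<open>The Taylor coefficients are \<open>coef \<phi> n * hnorm s n\<close>. One factor
  \<open>hnorm\<close> combines with \<open>bnorm\<close> to a constant, and the other is the weight
  in Parseval's identity on the line.\<close>

lemma nn_integral_btransform:
  assumes s: "s > 0" and \<phi>: "\<phi> \<in> L2_complex lebesgue" and \<tau>: "\<tau>\<^sup>2 = - 1"
  shows "(\<integral>\<^sup>+p. ennreal ((cmod (btransform s \<phi> (plane \<tau> p)))\<^sup>2 * exp (- (s / 2) * (norm p)\<^sup>2)) \<partial>lborel) =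
    ennreal (2 * (pi / s) * sqrt (pi / s) * l2_sq lebesgue \<phi>)"
proof -
  interpret complete_orthogonal_system lebesgue "herm s" "hnorm s"
    by (rule complete_orthogonal_herm[OF s])
  let ?C = "2 * (pi / s) * sqrt (pi / s)"
  have C: "?C \<ge> 0" using s by simp
  have s2: "s / 2 > 0" using s by simp
  have [measurable]: "btransform s \<phi> \<in> borel_measurable borel"
    by (intro borel_measurable_continuous_onI holomorphic_on_imp_continuous_on btransform_holomorphic s \<phi>)
  have "(\<integral>\<^sup>+p. ennreal ((cmod (btransform s \<phi> (plane \<tau> p)))\<^sup>2 * exp (- (s / 2) * (norm p)\<^sup>2)) \<partial>lborel) =
      (\<Sum>n. ennreal ((cmod (coef \<phi> n * of_real (hnorm s n)))\<^sup>2 * bnorm (s / 2) n))"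
    by (rule parseval_plane[OF \<tau> s2 btransform_sums[OF s \<phi>, unfolded integral_k]]) measurable
  also have "\<dots> = (\<Sum>n. ennreal (?C * ((cmod (coef \<phi> n))\<^sup>2 * hnorm s n)))"
  proof (intro suminf_cong arg_cong[where f = ennreal])
    fix n
    have "(cmod (coef \<phi> n * of_real (hnorm s n)))\<^sup>2 * bnorm (s / 2) n =
        (cmod (coef \<phi> n))\<^sup>2 * hnorm s n * (hnorm s n * bnorm (s / 2) n)"
      by (simp add: norm_mult power2_eq_square)
    then show "(cmod (coef \<phi> n * of_real (hnorm s n)))\<^sup>2 * bnorm (s / 2) n = ?C * ((cmod (coef \<phi> n))\<^sup>2 * hnorm s n)"
      by (simp only: hnorm_bnorm[OF s] mult.commute)
  qed
  also have "\<dots> = ennreal (\<Sum>n. ?C * ((cmod (coef \<phi> n))\<^sup>2 * hnorm s n))"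
  proof (rule suminf_ennreal2)
    show "0 \<le> ?C * ((cmod (coef \<phi> n))\<^sup>2 * hnorm s n)" for n
      using s hnorm_pos[OF s, of n] by (intro mult_nonneg_nonneg) auto
    show "summable (\<lambda>n. ?C * ((cmod (coef \<phi> n))\<^sup>2 * hnorm s n))"
      by (intro summable_mult sums_summable[OF expansion(2)[OF \<phi>]])
  qed
  also have "\<dots> = ennreal (?C * l2_sq lebesgue \<phi>)"
    using sums_mult[OF expansion(2)[OF \<phi>], of ?C] by (simp only: sums_iff)
  finally show ?thesis .
qed

text \<open>By Parseval's identity, finiteness of the Bargmann norm is summability of |a_n|^2
  \<open>bnorm\<close> for the Taylor coefficients a_n. This is exactly what
  \<open>synthesis\<close> needs in order to produce a preimage with coefficients a_n /
  \<open>hnorm\<close>.\<close>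

lemma btransform_surj:
  assumes s: "s > 0" and \<tau>: "\<tau>\<^sup>2 = - 1" and F: "F \<in> bargmann (s / 2) \<tau>"
  obtains \<phi> where "\<phi> \<in> L2_complex lebesgue" "btransform s \<phi> = F"
proof -
  interpret complete_orthogonal_system lebesgue "herm s" "hnorm s"
    by (rule complete_orthogonal_herm[OF s])
  have s2: "s / 2 > 0" using s by simp
  have hol: "F holomorphic_on UNIV"
    using F by (simp add: bargmann_def)
  then have Fm: "F \<in> borel_measurable borel"
    by (intro borel_measurable_continuous_onI holomorphic_on_imp_continuous_on)
  define a where "a n = (deriv ^^ n) F 0 / fact n" for n
  have a: "(\<lambda>n. a n * z ^ n) sums F z" for z
  proof -
    have "F holomorphic_on ball 0 (norm z + 1)"
      by (rule holomorphic_on_subset[OF hol]) simp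
    from holomorphic_power_series[OF this, of z] show ?thesis
      by (simp add: a_def)
  qed
  have "(\<Sum>n. ennreal ((cmod (a n))\<^sup>2 * bnorm (s / 2) n)) < \<infinity>"
    using F unfolding bargmann_iff[OF \<tau>] parseval_plane[OF \<tau> s2 a Fm] by simp
  then have sa: "summable (\<lambda>n. (cmod (a n))\<^sup>2 * bnorm (s / 2) n)"
    by (intro summable_suminf_not_top) (auto simp: bnorm_pos[OF s2] less_imp_le)
  define c where "c n = a n / of_real (hnorm s n)" for n
  let ?C = "2 * (pi / s) * sqrt (pi / s)"
  have "(cmod (c n))\<^sup>2 * hnorm s n = (cmod (a n))\<^sup>2 * bnorm (s / 2) n / ?C" for n
    unfolding hnorm_bnorm[OF s, of n, symmetric] using hnorm_pos[OF s, of n] bnorm_pos[OF s2, of n]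
    by (simp add: c_def norm_divide power_divide power2_eq_square field_simps)
  with sa have "summable (\<lambda>n. (cmod (c n))\<^sup>2 * hnorm s n)"
    by (simp only: summable_divide)
  then obtain \<phi> where \<phi>: "\<phi> \<in> L2_complex lebesgue" "coef \<phi> = c"
    by (rule synthesis)
  have an: "coef \<phi> n * of_real (hnorm s n) = a n" for n
    using hnorm_pos[OF s, of n] by (simp add: \<phi>(2) c_def)
  have "btransform s \<phi> = F"
  proof
    fix z
    show "btransform s \<phi> z = F z"
      using btransform_sums[OF s \<phi>(1), of z] a[of z] unfolding integral_k an by (rule sums_unique2)
  qed
  with \<phi>(1) show thesis
    by (rule that)
qed

section \<open>Idempotent components\<close>

lemma idem_linear [simp]:
  "idem_plus 0 = 0" "idem_minus 0 = 0" "idem_plus 1 = 1" "idem_minus 1 = 1"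
  "idem_plus (Z + W) = idem_plus Z + idem_plus W" "idem_minus (Z + W) = idem_minus Z + idem_minus W"
  "idem_plus (Z - W) = idem_plus Z - idem_plus W" "idem_minus (Z - W) = idem_minus Z - idem_minus W"
  "idem_plus (- Z) = - idem_plus Z" "idem_minus (- Z) = - idem_minus Z"
  "idem_plus (r *\<^sub>R Z) = r *\<^sub>R idem_plus Z" "idem_minus (r *\<^sub>R Z) = r *\<^sub>R idem_minus Z"
  by (simp_all add: idem_plus_def idem_minus_def algebra_simps)

lemma idem_values [simp]:
  "idem_plus e_plus = 1" "idem_minus e_plus = 0" "idem_plus e_minus = 0" "idem_minus e_minus = 1"
  "idem_plus (of_cx a) = a" "idem_minus (of_cx a) = a"
  by (simp_all add: idem_plus_def idem_minus_def of_cx_def e_plus_def e_minus_def bc_j_def complex_eq_iff)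

lemma idem_of_real [simp]:
  "idem_plus (of_real r) = of_real r" "idem_minus (of_real r) = of_real r"
  by (simp_all only: of_real_def idem_linear)

lemma idem_cnj_exp [simp]:
  "idem_plus (bc_cnj Z) = cnj (idem_plus Z)" "idem_minus (bc_cnj Z) = cnj (idem_minus Z)"
  "idem_plus (bc_exp Z) = exp (idem_plus Z)" "idem_minus (bc_exp Z) = exp (idem_minus Z)"
  by (simp_all only: bc_cnj_def bc_exp_def idem_combine)

lemma idem_power [simp]:
  "idem_plus (Z ^ n) = idem_plus Z ^ n" "idem_minus (Z ^ n) = idem_minus Z ^ n"
  by (induction n) simp_all

lemma idem_sum [simp]:
  "idem_plus (sum f A) = (\<Sum>x\<in>A. idem_plus (f x))" "idem_minus (sum f A) = (\<Sum>x\<in>A. idem_minus (f x))"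
  by (induction A rule: infinite_finite_induct) simp_all

lemma bicomplex_eq_idem: "Z = W \<longleftrightarrow> idem_plus Z = idem_plus W \<and> idem_minus Z = idem_minus W"
  using idem_decomp[of Z] idem_decomp[of W] by auto

lemma bounded_linear_idem: "bounded_linear idem_plus" "bounded_linear idem_minus"
  by (rule linear_conv_bounded_linear[THEN iffD1], rule linearI; simp)+

lemma bounded_linear_of_cx_mult: "bounded_linear (\<lambda>a. of_cx a * Z)"
  by (rule linear_conv_bounded_linear[THEN iffD1], rule linearI)
    (simp_all add: bicomplex_eq_iff of_cx_def algebra_simps)

lemma integrable_bicomplex_iff:
  "integrable M f \<longleftrightarrow> integrable M (\<lambda>x. idem_plus (f x)) \<and> integrable M (\<lambda>x. idem_minus (f x))"
proof safe
  assume "integrable M f"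
  then show "integrable M (\<lambda>x. idem_plus (f x))" "integrable M (\<lambda>x. idem_minus (f x))"
    by (simp_all add: integrable_bounded_linear[OF bounded_linear_idem(1)] integrable_bounded_linear[OF bounded_linear_idem(2)])
next
  assume "integrable M (\<lambda>x. idem_plus (f x))" "integrable M (\<lambda>x. idem_minus (f x))"
  then have "integrable M (\<lambda>x. of_cx (idem_plus (f x)) * e_plus + of_cx (idem_minus (f x)) * e_minus)"
    by (intro Bochner_Integration.integrable_add integrable_bounded_linear[OF bounded_linear_of_cx_mult])
  then show "integrable M f"
    by (simp only: idem_decomp[symmetric])
qed

lemma idem_integral:
  assumes "integrable M f"
  shows "idem_plus (integral\<^sup>L M f) = (\<integral>x. idem_plus (f x) \<partial>M)"
    and "idem_minus (integral\<^sup>L M f) = (\<integral>x. idem_minus (f x) \<partial>M)"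
  using assms by (simp_all add: integral_bounded_linear[OF bounded_linear_idem(1)] integral_bounded_linear[OF bounded_linear_idem(2)])

section \<open>The bicomplex \<open>L\<^sup>2\<close> norm\<close>

abbreviation plus_part :: "('a \<Rightarrow> bicomplex) \<Rightarrow> 'a \<Rightarrow> complex"
  where "plus_part f \<equiv> \<lambda>x. idem_plus (f x)"

abbreviation minus_part :: "('a \<Rightarrow> bicomplex) \<Rightarrow> 'a \<Rightarrow> complex"
  where "minus_part f \<equiv> \<lambda>x. idem_minus (f x)"

lemma L2_bc_iff: "f \<in> L2_bc M \<longleftrightarrow> plus_part f \<in> L2_complex M \<and> minus_part f \<in> L2_complex M"
  by (simp add: L2_bc_def)

lemma L2_bc_ops:
  "f \<in> L2_bc M \<Longrightarrow> g \<in> L2_bc M \<Longrightarrow> (\<lambda>x. f x + g x) \<in> L2_bc M"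
  "f \<in> L2_bc M \<Longrightarrow> g \<in> L2_bc M \<Longrightarrow> (\<lambda>x. f x - g x) \<in> L2_bc M"
  "f \<in> L2_bc M \<Longrightarrow> (\<lambda>x. c * f x) \<in> L2_bc M"
  "(\<lambda>x. 0) \<in> L2_bc M"
  by (simp_all add: L2_bc_iff L2_add L2_diff L2_cmult)

lemma idem_inner_bc:
  assumes "f \<in> L2_bc M" "g \<in> L2_bc M"
  shows "idem_plus (inner_bc M f g) = (\<integral>x. idem_plus (f x) * cnj (idem_plus (g x)) \<partial>M)"
    and "idem_minus (inner_bc M f g) = (\<integral>x. idem_minus (f x) * cnj (idem_minus (g x)) \<partial>M)"
proof -
  have "integrable M (\<lambda>x. f x * bc_cnj (g x))"
    using assms by (simp add: integrable_bicomplex_iff L2_bc_iff L2_mult_integrable L2_cnj)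
  then show "idem_plus (inner_bc M f g) = (\<integral>x. idem_plus (f x) * cnj (idem_plus (g x)) \<partial>M)"
    and "idem_minus (inner_bc M f g) = (\<integral>x. idem_minus (f x) * cnj (idem_minus (g x)) \<partial>M)"
    by (simp_all add: inner_bc_def idem_integral)
qed

lemma integral_mult_cnj: "(\<integral>x. f x * cnj (f x) \<partial>M) = complex_of_real (l2_sq M f)"
  unfolding l2_sq_def complex_norm_square[symmetric] by (rule integral_complex_of_real)

text \<open>The modulus of the bicomplex number <f, f> is a quadratic mean of the two squared
  component norms, not their sum. Convergence is therefore transferred to components through the two
  inequalities that follow.\<close>

lemma norm_bc_sq:
  assumes "f \<in> L2_bc M"
  shows "(norm_bc M f)\<^sup>2 = sqrt (((l2_sq M (plus_part f))\<^sup>2 + (l2_sq M (minus_part f))\<^sup>2) / 2)"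
  using assms by (simp add: norm_bc_def norm_bicomplex_def idem_inner_bc integral_mult_cnj)

lemma norm_bc_nonneg [simp]: "0 \<le> norm_bc M f"
  by (simp add: norm_bc_def)

lemma l2_sq_le_norm_bc:
  assumes "f \<in> L2_bc M"
  shows "l2_sq M (plus_part f) \<le> 2 * (norm_bc M f)\<^sup>2" "l2_sq M (minus_part f) \<le> 2 * (norm_bc M f)\<^sup>2"
proof -
  let ?a = "l2_sq M (plus_part f)" and ?b = "l2_sq M (minus_part f)"
  have "(?a / 2)\<^sup>2 \<le> (?a\<^sup>2 + ?b\<^sup>2) / 2" "(?b / 2)\<^sup>2 \<le> (?a\<^sup>2 + ?b\<^sup>2) / 2"
    by (simp_all add: power2_eq_square)
  then have "?a / 2 \<le> (norm_bc M f)\<^sup>2" "?b / 2 \<le> (norm_bc M f)\<^sup>2"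
    unfolding norm_bc_sq[OF assms] by (simp_all only: real_le_rsqrt)
  then show "?a \<le> 2 * (norm_bc M f)\<^sup>2" "?b \<le> 2 * (norm_bc M f)\<^sup>2"
    by simp_all
qed

lemma norm_bc_le_l2_sq:
  assumes "f \<in> L2_bc M"
  shows "(norm_bc M f)\<^sup>2 \<le> l2_sq M (plus_part f) + l2_sq M (minus_part f)"
  unfolding norm_bc_sq[OF assms]
  by (rule real_le_lsqrt) (simp_all add: power2_eq_square algebra_simps)

lemma norm_bc_tendsto_0_iff:
  assumes "\<And>n::nat. f n \<in> L2_bc M"
  shows "(\<lambda>n. norm_bc M (f n)) \<longlonglongrightarrow> 0 \<longleftrightarrow>
    (\<lambda>n. l2_sq M (plus_part (f n))) \<longlonglongrightarrow> 0 \<and> (\<lambda>n. l2_sq M (minus_part (f n))) \<longlonglongrightarrow> 0"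
proof safe
  assume "(\<lambda>n. norm_bc M (f n)) \<longlonglongrightarrow> 0"
  then have *: "(\<lambda>n. 2 * (norm_bc M (f n))\<^sup>2) \<longlonglongrightarrow> 0"
    by (auto intro!: tendsto_eq_intros)
  show "(\<lambda>n. l2_sq M (plus_part (f n))) \<longlonglongrightarrow> 0" "(\<lambda>n. l2_sq M (minus_part (f n))) \<longlonglongrightarrow> 0"
    by (rule Lim_null_comparison[OF _ *], simp add: l2_sq_le_norm_bc assms)+
next
  assume "(\<lambda>n. l2_sq M (plus_part (f n))) \<longlonglongrightarrow> 0" "(\<lambda>n. l2_sq M (minus_part (f n))) \<longlonglongrightarrow> 0"
  from tendsto_add[OF this] have "(\<lambda>n. l2_sq M (plus_part (f n)) + l2_sq M (minus_part (f n))) \<longlonglongrightarrow> 0"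
    by simp
  then have "(\<lambda>n. (norm_bc M (f n))\<^sup>2) \<longlonglongrightarrow> 0"
    by (rule Lim_null_comparison[rotated]) (simp add: norm_bc_le_l2_sq assms)
  from tendsto_real_sqrt[OF this] show "(\<lambda>n. norm_bc M (f n)) \<longlonglongrightarrow> 0"
    by simp
qed

lemma L2_bc_complete:
  assumes u: "\<And>n::nat. u n \<in> L2_bc M"
    and C: "\<And>e. e > 0 \<Longrightarrow> \<exists>N. \<forall>m\<ge>N. \<forall>n\<ge>N. norm_bc M (\<lambda>x. u m x - u n x) < e"
  obtains f where "f \<in> L2_bc M" "(\<lambda>n. norm_bc M (\<lambda>x. u n x - f x)) \<longlonglongrightarrow> 0"
proof -
  have Cauchy: "\<exists>N. \<forall>m\<ge>N. \<forall>n\<ge>N. l2_sq M (\<lambda>x. idem_plus (u m x) - idem_plus (u n x)) < e \<and>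
      l2_sq M (\<lambda>x. idem_minus (u m x) - idem_minus (u n x)) < e" if "e > 0" for e
  proof -
    \<comment> \<open>Each component's squared norm is at most twice the square of
      \<open>norm_bc\<close>, hence the value e/2.\<close>
    from C[of "sqrt (e / 2)"] that obtain N
      where N: "\<And>m n. m \<ge> N \<Longrightarrow> n \<ge> N \<Longrightarrow> norm_bc M (\<lambda>x. u m x - u n x) < sqrt (e / 2)"
      by auto
    have "l2_sq M (\<lambda>x. idem_plus (u m x) - idem_plus (u n x)) < e \<and>
      l2_sq M (\<lambda>x. idem_minus (u m x) - idem_minus (u n x)) < e" if "m \<ge> N" "n \<ge> N" for m n
    proof -
      have "(norm_bc M (\<lambda>x. u m x - u n x))\<^sup>2 < (sqrt (e / 2))\<^sup>2"
        using N[OF that] by (intro power_strict_mono) auto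
      then have "2 * (norm_bc M (\<lambda>x. u m x - u n x))\<^sup>2 < e"
        using \<open>e > 0\<close> by simp
      then show ?thesis
        using l2_sq_le_norm_bc[OF L2_bc_ops(2)[OF u[of m] u[of n]]] by simp
    qed
    then show ?thesis by blast
  qed
  have C': "\<exists>N. \<forall>m\<ge>N. \<forall>n\<ge>N. l2_sq M (\<lambda>x. idem_plus (u m x) - idem_plus (u n x)) < e"
    "\<exists>N. \<forall>m\<ge>N. \<forall>n\<ge>N. l2_sq M (\<lambda>x. idem_minus (u m x) - idem_minus (u n x)) < e" if "e > 0" for e
    using Cauchy[OF that] by blast+
  have u': "plus_part (u n) \<in> L2_complex M" "minus_part (u n) \<in> L2_complex M" for n
    using u[of n] by (simp_all add: L2_bc_iff)
  have "\<exists>g\<in>L2_complex M. (\<lambda>n. l2_sq M (\<lambda>x. idem_plus (u n x) - g x)) \<longlonglongrightarrow> 0"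
    by (rule L2_complete[OF u'(1) C'(1)])
  then obtain g where g: "g \<in> L2_complex M" "(\<lambda>n. l2_sq M (\<lambda>x. idem_plus (u n x) - g x)) \<longlonglongrightarrow> 0"
    by blast
  have "\<exists>h\<in>L2_complex M. (\<lambda>n. l2_sq M (\<lambda>x. idem_minus (u n x) - h x)) \<longlonglongrightarrow> 0"
    by (rule L2_complete[OF u'(2) C'(2)])
  then obtain h where h: "h \<in> L2_complex M" "(\<lambda>n. l2_sq M (\<lambda>x. idem_minus (u n x) - h x)) \<longlonglongrightarrow> 0"
    by blast
  define f where "f x = of_cx (g x) * e_plus + of_cx (h x) * e_minus" for x
  have f: "f \<in> L2_bc M"
    using g h by (simp add: L2_bc_iff f_def)
  have "(\<lambda>n. norm_bc M (\<lambda>x. u n x - f x)) \<longlonglongrightarrow> 0"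
    using g h by (subst norm_bc_tendsto_0_iff) (simp_all add: L2_bc_ops u f, simp add: f_def)
  with f show thesis by (rule that)
qed

section \<open>Transfer along an isometry\<close>

lemma
  assumes S: "bc_isometry_onto M N H S"
  shows isometry_image: "S ` L2_bc M = H"
    and isometry_AE: "f \<in> L2_bc M \<Longrightarrow> g \<in> L2_bc M \<Longrightarrow> AE x in M. f x = g x \<Longrightarrow> S f = S g"
    and isometry_add: "f \<in> L2_bc M \<Longrightarrow> g \<in> L2_bc M \<Longrightarrow> S (\<lambda>x. f x + g x) = (\<lambda>y. S f y + S g y)"
    and isometry_cmult: "f \<in> L2_bc M \<Longrightarrow> S (\<lambda>x. c * f x) = (\<lambda>y. c * S f y)"
    and isometry_norm: "f \<in> L2_bc M \<Longrightarrow> norm_bc N (S f) = norm_bc M f"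
proof -
  note 1 = S[unfolded bc_isometry_onto_def]
  note 2 = conjunct2[OF 1] note 3 = conjunct2[OF 2] note 4 = conjunct2[OF 3] note 5 = conjunct2[OF 4]
  show "S ` L2_bc M = H" by (rule conjunct1[OF 1])
  show "f \<in> L2_bc M \<Longrightarrow> g \<in> L2_bc M \<Longrightarrow> AE x in M. f x = g x \<Longrightarrow> S f = S g"
    by (rule conjunct1[OF 2, rule_format])
  show "f \<in> L2_bc M \<Longrightarrow> g \<in> L2_bc M \<Longrightarrow> S (\<lambda>x. f x + g x) = (\<lambda>y. S f y + S g y)"
    by (rule conjunct1[OF 3, rule_format])
  show "f \<in> L2_bc M \<Longrightarrow> S (\<lambda>x. c * f x) = (\<lambda>y. c * S f y)"
    by (rule conjunct1[OF 4, rule_format])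
  show "f \<in> L2_bc M \<Longrightarrow> norm_bc N (S f) = norm_bc M f"
    by (rule 5[rule_format])
qed

lemma isometry_diff:
  assumes S: "bc_isometry_onto M N H S" and f: "f \<in> L2_bc M" and g: "g \<in> L2_bc M"
  shows "S (\<lambda>x. f x - g x) = (\<lambda>y. S f y - S g y)"
proof -
  have "S (\<lambda>x. f x + (- 1) * g x) = (\<lambda>y. S f y + S (\<lambda>x. (- 1) * g x) y)"
    by (rule isometry_add[OF S f L2_bc_ops(3)[OF g]])
  also have "S (\<lambda>x. (- 1) * g x) = (\<lambda>y. (- 1) * S g y)"
    by (rule isometry_cmult[OF S g])
  finally show ?thesis by simp
qed

lemma isometry_zero:
  assumes S: "bc_isometry_onto M N H S"
  shows "S (\<lambda>x. 0) = (\<lambda>y. 0)"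
  using isometry_diff[OF S L2_bc_ops(4) L2_bc_ops(4)] by simp

lemma isometry_sum:
  assumes S: "bc_isometry_onto M N H S" and b: "\<And>n::nat. b n \<in> L2_bc M"
  shows "S (\<lambda>x. \<Sum>n<k. c n * b n x) = (\<lambda>y. \<Sum>n<k. c n * S (b n) y) \<and> (\<lambda>x. \<Sum>n<k. c n * b n x) \<in> L2_bc M"
proof (induction k)
  case 0
  show ?case using isometry_zero[OF S] L2_bc_ops(4) by simp
next
  case (Suc k)
  have "S (\<lambda>x. (\<Sum>n<k. c n * b n x) + c k * b k x) = (\<lambda>y. S (\<lambda>x. \<Sum>n<k. c n * b n x) y + S (\<lambda>x. c k * b k x) y)"
    by (rule isometry_add[OF S _ L2_bc_ops(3)[OF b]]) (use Suc in simp)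
  moreover have "S (\<lambda>x. c k * b k x) = (\<lambda>y. c k * S (b k) y)"
    by (rule isometry_cmult[OF S b])
  ultimately show ?case
    using Suc L2_bc_ops(1)[OF _ L2_bc_ops(3)[OF b]] by simp
qed

lemma l2_sq_eq_0:
  assumes "f \<in> L2_complex M" "l2_sq M f = 0"
  shows "AE x in M. f x = 0"
  using integral_nonneg_eq_0_iff_AE[OF L2_complexD(2)[OF assms(1)]] assms(2) by (simp add: l2_sq_def)

lemma norm_bc_eq_0:
  assumes f: "f \<in> L2_bc M" and "norm_bc M f = 0"
  shows "AE x in M. f x = 0"
proof -
  have "l2_sq M (plus_part f) = 0" "l2_sq M (minus_part f) = 0"
    using l2_sq_le_norm_bc[OF f] assms(2) by (auto intro: antisym)
  then have "AE x in M. idem_plus (f x) = 0" "AE x in M. idem_minus (f x) = 0"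
    using f by (simp_all add: L2_bc_iff l2_sq_eq_0)
  then show ?thesis
    by eventually_elim (simp add: bicomplex_eq_idem)
qed

text \<open>Cauchy sequences are pulled back along \<open>S\<close>, where
  \<open>L2_bc_complete\<close> gives a limit. Definiteness holds for genuine functions because a
  preimage of norm 0 vanishes almost everywhere, and \<open>S\<close> does not see null
  sets.\<close>

lemma bc_hilbert_of_isometry:
  assumes S: "bc_isometry_onto M N H S" and H: "H \<subseteq> L2_bc N"
  shows "bc_hilbert N H"
  unfolding bc_hilbert_def
proof (intro conjI ballI allI impI)
  have im: "S ` L2_bc M = H"
    by (rule isometry_image[OF S])
  have pre: "\<exists>g. f = S g \<and> g \<in> L2_bc M" if "f \<in> H" for f
  proof -
    have "f \<in> S ` L2_bc M"
      unfolding im by (rule that)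
    then show ?thesis
      by (rule imageE) blast
  qed
  have mem: "S g \<in> H" if "g \<in> L2_bc M" for g
    unfolding im[symmetric] using that by (rule imageI)
  show "H \<subseteq> L2_bc N" by (rule H)
  show "(\<lambda>_. 0) \<in> H"
    using mem[OF L2_bc_ops(4)] unfolding isometry_zero[OF S] .
  show "(\<lambda>x. f x + g x) \<in> H" if fg: "f \<in> H" "g \<in> H" for f g
  proof -
    obtain f' where f': "f = S f'" "f' \<in> L2_bc M"
      using pre[OF fg(1)] by blast
    obtain g' where g': "g = S g'" "g' \<in> L2_bc M"
      using pre[OF fg(2)] by blast
    show ?thesis
      unfolding f'(1) g'(1) isometry_add[OF S f'(2) g'(2), symmetric] by (intro mem L2_bc_ops f' g')
  qed
  show "(\<lambda>x. c * f x) \<in> H" if f: "f \<in> H" for c f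
  proof -
    obtain f' where f': "f = S f'" "f' \<in> L2_bc M"
      using pre[OF f] by blast
    show ?thesis
      unfolding f'(1) isometry_cmult[OF S f'(2), symmetric] by (intro mem L2_bc_ops f')
  qed
  show "f = (\<lambda>_. 0)" if f: "f \<in> H" "norm_bc N f = 0" for f
  proof -
    obtain g where g: "f = S g" "g \<in> L2_bc M"
      using pre[OF f(1)] by blast
    have "norm_bc M g = 0"
      using f(2) unfolding g(1) isometry_norm[OF S g(2)] .
    then have "AE x in M. g x = 0"
      by (rule norm_bc_eq_0[OF g(2)])
    then have "S g = S (\<lambda>x. 0)"
      by (rule isometry_AE[OF S g(2) L2_bc_ops(4)])
    then show ?thesis
      using g isometry_zero[OF S] by simp
  qed
  show "\<exists>f\<in>H. (\<lambda>n. norm_bc N (\<lambda>x. u n x - f x)) \<longlonglongrightarrow> 0"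
    if u: "(\<forall>n::nat. u n \<in> H) \<and> (\<forall>e>0. \<exists>N'. \<forall>m\<ge>N'. \<forall>n\<ge>N'. norm_bc N (\<lambda>x. u m x - u n x) < e)" for u
  proof -
    have "\<forall>n. \<exists>v. u n = S v \<and> v \<in> L2_bc M"
      using u pre by blast
    then obtain v where v: "\<forall>n. u n = S (v n) \<and> v n \<in> L2_bc M"
      by (rule choice[THEN exE])
    then have v1: "u n = S (v n)" and v2: "v n \<in> L2_bc M" for n
      by blast+
    have diff: "norm_bc N (\<lambda>x. u m x - S g x) = norm_bc M (\<lambda>x. v m x - g x)" if "g \<in> L2_bc M" for m g
      unfolding v1 isometry_diff[OF S v2 that, symmetric] by (rule isometry_norm[OF S L2_bc_ops(2)[OF v2 that]])
    have diff': "norm_bc N (\<lambda>x. u m x - u n x) = norm_bc M (\<lambda>x. v m x - v n x)" for m n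
      using diff[OF v2] by (simp only: v1)
    have Cv: "\<exists>N'. \<forall>m\<ge>N'. \<forall>n\<ge>N'. norm_bc M (\<lambda>x. v m x - v n x) < e" if "e > 0" for e
      using u that unfolding diff' by blast
    obtain g where g: "g \<in> L2_bc M" "(\<lambda>n. norm_bc M (\<lambda>x. v n x - g x)) \<longlonglongrightarrow> 0"
      by (rule L2_bc_complete[where u = v, OF v2 Cv])
    show ?thesis
      by (rule bexI[OF _ mem[OF g(1)]]) (simp only: diff[OF g(1)] g(2))
  qed
qed

lemma isometry_norm_expansion:
  assumes S: "bc_isometry_onto M N H S" and b: "\<And>n::nat. b n \<in> L2_bc M" and f: "f \<in> L2_bc M"
  shows "norm_bc N (\<lambda>y. S f y - (\<Sum>n<k. c n * S (b n) y)) = norm_bc M (\<lambda>x. f x - (\<Sum>n<k. c n * b n x))"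
proof -
  note sum = isometry_sum[OF S b, where k = k and c = c]
  show ?thesis
    unfolding isometry_norm[OF S L2_bc_ops(2)[OF f conjunct2[OF sum]], symmetric]
      isometry_diff[OF S f conjunct2[OF sum]] conjunct1[OF sum] ..
qed

section \<open>Integration over the bicomplex numbers\<close>

definition point1 :: "bicomplex \<Rightarrow> real \<times> real" where "point1 Z = (x1 Z, y1 Z)"
definition point2 :: "bicomplex \<Rightarrow> real \<times> real" where "point2 Z = (x2 Z, y2 Z)"

lemma coordinates_inner:
  "x1 Z = Z \<bullet> Bicomplex 1 0" "y1 Z = Z \<bullet> Bicomplex \<i> 0" "x2 Z = Z \<bullet> Bicomplex 0 1" "y2 Z = Z \<bullet> Bicomplex 0 \<i>"
  by (simp_all add: x1_def y1_def x2_def y2_def inner_bicomplex_def inner_complex_def)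

lemma point_measurable [measurable]:
  "point1 \<in> borel_measurable borel" "point2 \<in> borel_measurable borel"
  unfolding point1_def point2_def coordinates_inner
  by (intro borel_measurable_continuous_onI continuous_intros)+

definition bc_of_points :: "(real \<times> real) \<times> (real \<times> real) \<Rightarrow> bicomplex"
  where "bc_of_points p = fst (fst p) *\<^sub>R Bicomplex 1 0 + snd (fst p) *\<^sub>R Bicomplex \<i> 0 +
    fst (snd p) *\<^sub>R Bicomplex 0 1 + snd (snd p) *\<^sub>R Bicomplex 0 \<i>"

lemma point_bc_of_points [simp]:
  "point1 (bc_of_points p) = fst p" "point2 (bc_of_points p) = snd p"
  by (simp_all add: point1_def point2_def bc_of_points_def x1_def y1_def x2_def y2_def)

lemma bc_of_points_measurable [measurable]: "bc_of_points \<in> borel_measurable borel"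
  unfolding bc_of_points_def by (intro borel_measurable_continuous_onI continuous_intros)

lemma emeasure_lborel_box_plane:
  fixes a b c d :: real
  assumes "a \<le> c" "b \<le> d"
  shows "emeasure lborel (box (a, b) (c, d)) = ennreal ((c - a) * (d - b))"
proof -
  have "box (a, b) (c, d) = box a c \<times> box b d"
    by (auto simp: box_def Basis_prod_def)
  then show ?thesis
    unfolding lborel_prod[symmetric] using assms
    by (simp add: lborel.emeasure_pair_measure_Times ennreal_mult)
qed

text \<open>Lebesgue measure is characterised by its values on boxes. As 1, i, j, ij are the
  coordinate directions, a box pulls back to a product of two planar boxes of the same total
  volume.\<close>

lemma lborel_bicomplex: "lborel = distr lborel borel bc_of_points"
proof (rule lborel_eqI)
  fix l u :: bicomplex
  assume le: "\<And>b. b \<in> Basis \<Longrightarrow> l \<bullet> b \<le> u \<bullet> b"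
  have le': "x1 l \<le> x1 u" "y1 l \<le> y1 u" "x2 l \<le> x2 u" "y2 l \<le> y2 u"
    unfolding coordinates_inner by (rule le, simp add: Basis_bicomplex_eq)+
  have "bc_of_points -` box l u = box (point1 l) (point1 u) \<times> box (point2 l) (point2 u)"
  proof -
    have "bc_of_points p \<in> box l u \<longleftrightarrow> fst p \<in> box (point1 l) (point1 u) \<and> snd p \<in> box (point2 l) (point2 u)" for p
      using point_bc_of_points[of p]
      by (cases p) (auto simp: box_def Basis_bicomplex_eq Basis_prod_def coordinates_inner[symmetric] point1_def point2_def)
    then show ?thesis by (auto simp: set_eq_iff mem_Times_iff)
  qed
  then have "emeasure (distr lborel borel bc_of_points) (box l u) =
      emeasure lborel (box (point1 l) (point1 u) \<times> box (point2 l) (point2 u))"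
    by (subst emeasure_distr) auto
  also have "\<dots> = emeasure lborel (box (point1 l) (point1 u)) * emeasure lborel (box (point2 l) (point2 u))"
    unfolding lborel_prod[symmetric, where 'a = "real \<times> real" and 'b = "real \<times> real"]
    by (rule lborel.emeasure_pair_measure_Times) auto
  also have "\<dots> = ennreal ((x1 u - x1 l) * (y1 u - y1 l) * ((x2 u - x2 l) * (y2 u - y2 l)))"
    unfolding point1_def point2_def using le' by (simp add: emeasure_lborel_box_plane ennreal_mult)
  also have "(x1 u - x1 l) * (y1 u - y1 l) * ((x2 u - x2 l) * (y2 u - y2 l)) = (\<Prod>b\<in>Basis. (u - l) \<bullet> b)"
    unfolding Basis_bicomplex_eq by (simp add: inner_diff_left flip: coordinates_inner)
  finally show "emeasure (distr lborel borel bc_of_points) (box l u) = (\<Prod>b\<in>Basis. (u - l) \<bullet> b)" .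
qed simp

lemma nn_integral_lebesgue_bc:
  assumes [measurable]: "f \<in> borel_measurable borel" "g \<in> borel_measurable borel"
  shows "(\<integral>\<^sup>+Z. f (point1 Z) * g (point2 Z) \<partial>lebesgue_bc) =
    ennreal (1/4) * ((\<integral>\<^sup>+p. f p \<partial>lborel) * (\<integral>\<^sup>+p. g p \<partial>lborel))"
proof -
  let ?h = "\<lambda>Z. f (point1 Z) * g (point2 Z)"
  have h [measurable]: "?h \<in> borel_measurable borel"
    by measurable
  have "(\<integral>\<^sup>+Z. ?h Z \<partial>lebesgue_bc) = (\<integral>\<^sup>+Z. 1/4 * ?h Z \<partial>lebesgue)"
    unfolding lebesgue_bc_def by (rule nn_integral_density) (auto intro: measurable_completion)
  also have "\<dots> = (\<integral>\<^sup>+Z. 1/4 * ?h Z \<partial>lborel)"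
    by (rule nn_integral_completion)
  also have "\<dots> = 1/4 * (\<integral>\<^sup>+Z. ?h Z \<partial>lborel)"
    by (rule nn_integral_cmult) simp
  also have "(\<integral>\<^sup>+Z. ?h Z \<partial>lborel) = (\<integral>\<^sup>+p. ?h (bc_of_points p) \<partial>lborel)"
    by (subst lborel_bicomplex) (rule nn_integral_distr, auto)
  also have "\<dots> = (\<integral>\<^sup>+p. \<integral>\<^sup>+q. ?h (bc_of_points (p, q)) \<partial>lborel \<partial>lborel)"
    by (rule nn_integral_lborel_prod) measurable
  also have "\<dots> = (\<integral>\<^sup>+p. f p \<partial>lborel) * (\<integral>\<^sup>+p. g p \<partial>lborel)"
    by (simp add: nn_integral_cmult nn_integral_multc)
  also have "(1/4 :: ennreal) = ennreal (1/4)"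
    by (metis ennreal_1 ennreal_divide_numeral zero_le_one)
  finally show ?thesis .
qed

lemma nn_integral_gaussian_plane:
  assumes "\<alpha> > 0"
  shows "(\<integral>\<^sup>+p. ennreal (exp (- \<alpha> * (norm p)\<^sup>2)) \<partial>(lborel :: (real \<times> real) measure)) = ennreal (pi / \<alpha>)"
  using nn_integral_exp_plane[OF assms, of 0] by simp

text \<open>This is e^(-(s/2)|Z^e|^2): the exponent has s/4 because |Z^e|^2 is half the sum of the
  four squares, see \<open>exp_norm_Z_e\<close>.\<close>

definition weight :: "real \<Rightarrow> bicomplex \<Rightarrow> real"
  where "weight s Z = exp (- (s / 4) * ((norm (point1 Z))\<^sup>2 + (norm (point2 Z))\<^sup>2))"

lemma weight_sq:
  "(weight s Z)\<^sup>2 = exp (- (s / 2) * (norm (point1 Z))\<^sup>2) * exp (- (s / 2) * (norm (point2 Z))\<^sup>2)"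
  by (simp add: weight_def power2_eq_square mult_exp_exp algebra_simps)

lemma weight_measurable [measurable]: "weight s \<in> borel_measurable borel"
  unfolding weight_def by measurable

text \<open>The plane on which \<open>f\<close> does not depend contributes the Gaussian integral 2
  pi/s; with the factor 1/4 of the measure this is pi/(2s).\<close>

lemma nn_integral_weight:
  fixes f :: "real \<times> real \<Rightarrow> real"
  assumes s: "s > 0" and [measurable]: "f \<in> borel_measurable borel" and pt: "pt = point1 \<or> pt = point2"
    and nn: "\<And>p. 0 \<le> f p"
  shows "(\<integral>\<^sup>+Z. ennreal ((weight s Z)\<^sup>2 * f (pt Z)) \<partial>lebesgue_bc) =
    ennreal (pi / (2 * s)) * (\<integral>\<^sup>+p. ennreal (f p * exp (- (s / 2) * (norm p)\<^sup>2)) \<partial>lborel)"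
proof -
  let ?e = "\<lambda>p :: real \<times> real. ennreal (exp (- (s / 2) * (norm p)\<^sup>2))"
  let ?f = "\<lambda>p. ennreal (f p * exp (- (s / 2) * (norm p)\<^sup>2))"
  have m [measurable]: "?e \<in> borel_measurable borel" "?f \<in> borel_measurable borel"
    by measurable
  have e: "(\<integral>\<^sup>+p. ?e p \<partial>lborel) = ennreal (2 * pi / s)"
    using nn_integral_gaussian_plane[of "s / 2"] s by simp
  have c: "ennreal (1/4) * (ennreal (2 * pi / s) * x) = ennreal (pi / (2 * s)) * x" for x
    using s by (simp add: mult.assoc[symmetric] flip: ennreal_mult)
  from pt show ?thesis
  proof
    assume pt: "pt = point1"
    have "ennreal ((weight s Z)\<^sup>2 * f (pt Z)) = ?f (point1 Z) * ?e (point2 Z)" for Z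
      using nn by (simp add: weight_sq pt mult_ac flip: ennreal_mult)
    then show ?thesis
      using nn_integral_lebesgue_bc[OF m(2) m(1)] by (simp only: e mult.commute[of _ "ennreal (2 * pi / s)"] c)
  next
    assume pt: "pt = point2"
    have "ennreal ((weight s Z)\<^sup>2 * f (pt Z)) = ?e (point1 Z) * ?f (point2 Z)" for Z
      using nn by (simp add: weight_sq pt mult_ac flip: ennreal_mult)
    then show ?thesis
      using nn_integral_lebesgue_bc[OF m(1) m(2)] by (simp only: e c)
  qed
qed

section \<open>The components of the transform\<close>

lemma btransform_linear:
  assumes "s > 0" "f \<in> L2_complex lebesgue" "g \<in> L2_complex lebesgue"
  shows "btransform s (\<lambda>t. f t + g t) z = btransform s f z + btransform s g z"
    and "btransform s (\<lambda>t. c * f t) z = c * btransform s f z"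
  using L2_mult_integrable[OF assms(2) bkernel_L2[OF assms(1), of z]]
    L2_mult_integrable[OF assms(3) bkernel_L2[OF assms(1), of z]]
  by (simp_all add: btransform_def distrib_right mult.assoc)

lemma btransform_cong_AE:
  assumes "s > 0" "f \<in> L2_complex lebesgue" "g \<in> L2_complex lebesgue" "AE t in lebesgue. f t = g t"
  shows "btransform s f z = btransform s g z"
  unfolding btransform_def
  by (rule integral_cong_AE)
    (use assms in \<open>auto intro!: borel_measurable_integrable L2_mult_integrable bkernel_L2\<close>)

lemma btransform_herm:
  assumes s: "s > 0"
  shows "btransform s (\<lambda>t. of_real (herm s n t)) z = of_real (hnorm s n) * z ^ n"
proof (rule sums_unique2)
  have J: "(\<integral>t. complex_of_real (herm s n t) * of_real (herm s m t) \<partial>lebesgue) = (if n = m then of_real (hnorm s m) else 0)" for m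
    unfolding of_real_mult[symmetric] integral_complex_of_real herm_orthogonal[OF s] by simp
  show "(\<lambda>m. (if n = m then of_real (hnorm s m) else 0) * z ^ m) sums btransform s (\<lambda>t. of_real (herm s n t)) z"
    using btransform_sums[OF s herm_L2[OF s], of n z] unfolding J .
  have "(\<lambda>m. (if n = m then of_real (hnorm s m) else 0) * z ^ m) =
      (\<lambda>m. if m = n then of_real (hnorm s m) * z ^ m else 0)"
    by auto
  then show "(\<lambda>m. (if n = m then of_real (hnorm s m) else 0) * z ^ m) sums (of_real (hnorm s n) * z ^ n)"
    using sums_single[of n "\<lambda>m. of_real (hnorm s m) * z ^ m"] by (simp only:)
qed

text \<open>The common shape of both idempotent components of the transform, see
  \<open>idem_S0\<close>. The exponent is 5/4 = 1/4 + 1, from the normalisation and from the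
  prefactor \<sigma>/\<pi>.\<close>

definition component :: "real \<Rightarrow> complex \<Rightarrow> (bicomplex \<Rightarrow> real \<times> real) \<Rightarrow> (real \<Rightarrow> complex) \<Rightarrow> bicomplex \<Rightarrow> complex"
  where "component s \<tau> pt \<phi> Z = of_real (weight s Z) * (of_real ((s / pi) powr (5/4)) * btransform s \<phi> (plane \<tau> (pt Z)))"

lemma component_isometry:
  assumes s: "s > 0" and \<tau>: "\<tau>\<^sup>2 = - 1" and pt: "pt = point1 \<or> pt = point2" and \<phi>: "\<phi> \<in> L2_complex lebesgue"
  shows "component s \<tau> pt \<phi> \<in> L2_complex lebesgue_bc" "l2_sq lebesgue_bc (component s \<tau> pt \<phi>) = l2_sq lebesgue \<phi>"
proof -
  let ?q = "((s / pi) powr (5/4))\<^sup>2"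
  let ?B = "\<lambda>p. (cmod (btransform s \<phi> (plane \<tau> p)))\<^sup>2"
  have [measurable]: "btransform s \<phi> \<in> borel_measurable borel"
    by (intro borel_measurable_continuous_onI holomorphic_on_imp_continuous_on btransform_holomorphic s \<phi>)
  have [measurable]: "pt \<in> borel_measurable borel"
    using pt by auto
  have "component s \<tau> pt \<phi> \<in> borel_measurable borel"
    unfolding component_def by measurable
  then have m: "component s \<tau> pt \<phi> \<in> borel_measurable lebesgue_bc"
    unfolding lebesgue_bc_def by (simp add: measurable_completion)
  have const: "?q * (pi / (2 * s)) * (2 * (pi / s) * sqrt (pi / s)) = 1"
  proof -
    \<comment> \<open>In terms of this square root the fractional powers become integral ones, and
      the product is r^5 / (2 r^2) * 2 / r^3 = 1.\<close>
    define r where "r = sqrt (s / pi)"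
    have r: "r > 0" "s / pi = r\<^sup>2" using s by (simp_all add: r_def)
    have "?q = (s / pi) powr (5/2)"
      by (simp add: power2_eq_square flip: powr_add)
    also have "\<dots> = r ^ 5"
      using r by (simp add: powr_powr flip: powr_realpow powr_numeral)
    finally have q: "?q = r ^ 5" .
    have "pi / s = 1 / r\<^sup>2"
      using r s by (simp add: field_simps)
    then have "sqrt (pi / s) = 1 / r" "pi / (2 * s) = 1 / (2 * r\<^sup>2)" "pi / s = 1 / r\<^sup>2"
      using r by (simp_all add: real_sqrt_divide field_simps)
    then show ?thesis
      using r unfolding q by (simp add: field_simps eval_nat_numeral)
  qed
  have "(\<integral>\<^sup>+Z. ennreal ((cmod (component s \<tau> pt \<phi> Z))\<^sup>2) \<partial>lebesgue_bc) =
      (\<integral>\<^sup>+Z. ennreal ((weight s Z)\<^sup>2 * (?q * ?B (pt Z))) \<partial>lebesgue_bc)"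
    by (simp add: component_def norm_mult power_mult_distrib)
  also have "\<dots> = ennreal (pi / (2 * s)) * (\<integral>\<^sup>+p. ennreal (?q * ?B p * exp (- (s / 2) * (norm p)\<^sup>2)) \<partial>lborel)"
    by (rule nn_integral_weight[OF s _ pt]) auto
  also have "(\<integral>\<^sup>+p. ennreal (?q * ?B p * exp (- (s / 2) * (norm p)\<^sup>2)) \<partial>lborel) =
      (\<integral>\<^sup>+p. ennreal ?q * ennreal (?B p * exp (- (s / 2) * (norm p)\<^sup>2)) \<partial>lborel)"
    by (simp add: mult.assoc ennreal_mult)
  also have "\<dots> = ennreal ?q * (\<integral>\<^sup>+p. ennreal (?B p * exp (- (s / 2) * (norm p)\<^sup>2)) \<partial>lborel)"
    by (rule nn_integral_cmult) measurable
  also have "\<dots> = ennreal ?q * ennreal (2 * (pi / s) * sqrt (pi / s) * l2_sq lebesgue \<phi>)"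
    by (simp only: nn_integral_btransform[OF s \<phi> \<tau>])
  also have "ennreal (pi / (2 * s)) * (ennreal ?q * ennreal (2 * (pi / s) * sqrt (pi / s) * l2_sq lebesgue \<phi>)) =
      ennreal (?q * (pi / (2 * s)) * (2 * (pi / s) * sqrt (pi / s)) * l2_sq lebesgue \<phi>)"
    using s by (simp add: mult_ac flip: ennreal_mult)
  also have "\<dots> = ennreal (l2_sq lebesgue \<phi>)"
    by (simp only: const mult_1)
  finally have eq: "(\<integral>\<^sup>+Z. ennreal ((cmod (component s \<tau> pt \<phi> Z))\<^sup>2) \<partial>lebesgue_bc) = ennreal (l2_sq lebesgue \<phi>)" .
  show L2: "component s \<tau> pt \<phi> \<in> L2_complex lebesgue_bc"
    by (rule L2_complexI_nn[OF m]) (simp add: eq)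
  show "l2_sq lebesgue_bc (component s \<tau> pt \<phi>) = l2_sq lebesgue \<phi>"
    using eq unfolding nn_integral_l2_sq[OF L2] by simp
qed

lemma component_linear:
  assumes "s > 0" "f \<in> L2_complex lebesgue" "g \<in> L2_complex lebesgue"
  shows "component s \<tau> pt (\<lambda>t. f t + g t) Z = component s \<tau> pt f Z + component s \<tau> pt g Z"
    and "component s \<tau> pt (\<lambda>t. c * f t) Z = c * component s \<tau> pt f Z"
  by (simp_all add: component_def btransform_linear[OF assms] algebra_simps)

section \<open>Polarization: from norms to inner products\<close>

lemma l2_sq_add:
  assumes f: "f \<in> L2_complex M" and g: "g \<in> L2_complex M"
  shows "l2_sq M (\<lambda>x. f x + c * g x) =
    l2_sq M f + 2 * Re (cnj c * (\<integral>x. f x * cnj (g x) \<partial>M)) + (cmod c)\<^sup>2 * l2_sq M g"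
proof -
  have i: "integrable M (\<lambda>x. cnj c * (f x * cnj (g x)))"
    by (intro integrable_mult_right L2_mult_integrable f L2_cnj g)
  have eq: "(cmod (f x + c * g x))\<^sup>2 =
      (cmod (f x))\<^sup>2 + 2 * Re (cnj c * (f x * cnj (g x))) + (cmod c)\<^sup>2 * (cmod (g x))\<^sup>2" for x
    unfolding cmod_power2 by (simp add: power2_eq_square algebra_simps)
  have "(\<integral>x. Re (cnj c * (f x * cnj (g x))) \<partial>M) = Re (cnj c * (\<integral>x. f x * cnj (g x) \<partial>M))"
    using integral_Re[OF i] by (simp only: integral_mult_right_zero)
  then show ?thesis
    unfolding l2_sq_def eq using L2_complexD(2)[OF f] L2_complexD(2)[OF g] integrable_Re[OF i]
    by (simp del: times_complex.sel)
qed

text \<open>Compare the squared norms of f + c g on both sides; c = 1 recovers the real part of the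
  inner product and c = i the imaginary part.\<close>

lemma component_inner:
  assumes s: "s > 0" and \<tau>: "\<tau>\<^sup>2 = - 1" and pt: "pt = point1 \<or> pt = point2"
    and f: "f \<in> L2_complex lebesgue" and g: "g \<in> L2_complex lebesgue"
  shows "(\<integral>Z. component s \<tau> pt f Z * cnj (component s \<tau> pt g Z) \<partial>lebesgue_bc) = (\<integral>t. f t * cnj (g t) \<partial>lebesgue)"
proof -
  let ?I = "\<integral>Z. component s \<tau> pt f Z * cnj (component s \<tau> pt g Z) \<partial>lebesgue_bc"
  let ?J = "\<integral>t. f t * cnj (g t) \<partial>lebesgue"
  note iso = component_isometry[OF s \<tau> pt]
  have "Re (cnj c * ?I) = Re (cnj c * ?J)" for c
  proof -
    have "component s \<tau> pt (\<lambda>t. f t + c * g t) = (\<lambda>Z. component s \<tau> pt f Z + c * component s \<tau> pt g Z)"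
      using component_linear(1)[OF s f L2_cmult[OF g]] component_linear(2)[OF s g g] by (simp add: fun_eq_iff)
    then have "l2_sq lebesgue_bc (\<lambda>Z. component s \<tau> pt f Z + c * component s \<tau> pt g Z) = l2_sq lebesgue (\<lambda>t. f t + c * g t)"
      using iso(2)[OF L2_add[OF f L2_cmult[OF g]]] by metis
    then show ?thesis
      by (simp add: l2_sq_add iso f g del: times_complex.sel)
  qed
  from this[of 1] this[of \<i>] show ?thesis
    by (simp add: complex_eq_iff)
qed

section \<open>The bicomplex transform\<close>

lemma btransform_in_bargmann:
  assumes "s > 0" "\<phi> \<in> L2_complex lebesgue" "\<tau>\<^sup>2 = - 1"
  shows "btransform s \<phi> \<in> bargmann (s / 2) \<tau>"
  unfolding bargmann_iff[OF assms(3)] nn_integral_btransform[OF assms]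
  by (simp add: btransform_holomorphic assms)

text \<open>The exponents of the two sides differ by $\frac{s}{4} y^2 (\tau^2 + 1) = 0$.\<close>

lemma kernel_identity:
  assumes \<tau>: "\<tau>\<^sup>2 = - 1"
  shows "exp (s *\<^sub>R (\<tau> * (of_real t - (1/2) *\<^sub>R of_real x) * of_real y)) * of_real (exp (- (s / 2) * (t - x)\<^sup>2)) =
    of_real (exp (- (s / 4) * (norm (x, y))\<^sup>2)) * bkernel s (plane \<tau> (x, y)) t"
proof -
  define X Y T s' where "X = complex_of_real x" "Y = complex_of_real y" "T = complex_of_real t" "s' = complex_of_real s"
  have "s' * (\<tau> * (T - X / 2) * Y) + (- (s' / 2) * (T - X)\<^sup>2) =
      (- (s' / 4) * (X\<^sup>2 + Y\<^sup>2)) + (- (s' / 2) * T\<^sup>2 + s' * T * (X + \<tau> * Y) - s' / 4 * (X + \<tau> * Y)\<^sup>2)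
      + s' / 4 * Y\<^sup>2 * (\<tau>\<^sup>2 + 1)"
    by (simp add: field_simps power2_eq_square)
  then have "exp (s' * (\<tau> * (T - X / 2) * Y)) * exp (- (s' / 2) * (T - X)\<^sup>2) =
      exp (- (s' / 4) * (X\<^sup>2 + Y\<^sup>2)) * exp (- (s' / 2) * T\<^sup>2 + s' * T * (X + \<tau> * Y) - s' / 4 * (X + \<tau> * Y)\<^sup>2)"
    using \<tau> by (simp add: mult_exp_exp)
  then show ?thesis
    by (simp add: X_Y_T_s'_def bkernel_def plane_def norm_prod_def scaleR_conv_of_real exp_of_real[symmetric])
qed

section \<open>The bicomplex transform for fixed \<open>\<sigma>\<close>, \<open>\<nu>\<close> and
  \<open>\<mu>\<close>\<close>

locale bicomplex_bargmann =
  fixes \<sigma> :: real and \<nu> \<mu> :: bicomplex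
  assumes \<sigma>: "\<sigma> > 0" and \<nu>: "\<nu>\<^sup>2 = -1" and \<mu>: "\<mu>\<^sup>2 = -1"
begin

lemma units: "(idem_plus \<nu>)\<^sup>2 = - 1" "(idem_minus \<mu>)\<^sup>2 = - 1"
  using arg_cong[OF \<nu>, of idem_plus] arg_cong[OF \<mu>, of idem_minus] by simp_all

text \<open>The idempotents decouple the two planes: the e_+ component involves only x_1, y_1 and
  the e_- component only x_2, y_2. The conjugation disappears because \<open>psi0\<close> is real,
  and \<open>kernel_identity\<close> extracts the Gaussian of that plane.\<close>

lemma idem_V_integrand:
  "idem_plus (V_integrand \<sigma> \<nu> \<mu> \<phi> (psi0 \<sigma>) Z t) =
    of_real (exp (- (\<sigma> / 4) * (norm (point1 Z))\<^sup>2)) *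
    (idem_plus (\<phi> t) * bkernel \<sigma> (plane (idem_plus \<nu>) (point1 Z)) t)"
  "idem_minus (V_integrand \<sigma> \<nu> \<mu> \<phi> (psi0 \<sigma>) Z t) =
    of_real (exp (- (\<sigma> / 4) * (norm (point2 Z))\<^sup>2)) *
    (idem_minus (\<phi> t) * bkernel \<sigma> (plane (idem_minus \<mu>) (point2 Z)) t)"
proof -
  have "idem_plus (V_integrand \<sigma> \<nu> \<mu> \<phi> (psi0 \<sigma>) Z t) = idem_plus (\<phi> t) *
      (exp (\<sigma> *\<^sub>R (idem_plus \<nu> * (of_real t - (1/2) *\<^sub>R of_real (x1 Z)) * of_real (y1 Z))) *
       of_real (exp (- (\<sigma> / 2) * (t - x1 Z)\<^sup>2)))"
    by (simp add: V_integrand_def psi0_def X_e_def Y_e_def)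
  then show "idem_plus (V_integrand \<sigma> \<nu> \<mu> \<phi> (psi0 \<sigma>) Z t) =
      of_real (exp (- (\<sigma> / 4) * (norm (point1 Z))\<^sup>2)) *
      (idem_plus (\<phi> t) * bkernel \<sigma> (plane (idem_plus \<nu>) (point1 Z)) t)"
    unfolding kernel_identity[OF units(1)] point1_def by (simp only: mult.left_commute)
  have "idem_minus (V_integrand \<sigma> \<nu> \<mu> \<phi> (psi0 \<sigma>) Z t) = idem_minus (\<phi> t) *
      (exp (\<sigma> *\<^sub>R (idem_minus \<mu> * (of_real t - (1/2) *\<^sub>R of_real (x2 Z)) * of_real (y2 Z))) *
       of_real (exp (- (\<sigma> / 2) * (t - x2 Z)\<^sup>2)))"
    by (simp add: V_integrand_def psi0_def X_e_def Y_e_def)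
  then show "idem_minus (V_integrand \<sigma> \<nu> \<mu> \<phi> (psi0 \<sigma>) Z t) =
      of_real (exp (- (\<sigma> / 4) * (norm (point2 Z))\<^sup>2)) *
      (idem_minus (\<phi> t) * bkernel \<sigma> (plane (idem_minus \<mu>) (point2 Z)) t)"
    unfolding kernel_identity[OF units(2)] point2_def by (simp only: mult.left_commute)
qed

text \<open>Ensures that the transform is given by a genuine integral and not by the default value 0
  of a divergent one.\<close>

lemma V_integrand_integrable:
  assumes "\<phi> \<in> L2_bc lebesgue"
  shows "integrable lebesgue (V_integrand \<sigma> \<nu> \<mu> \<phi> (psi0 \<sigma>) Z)"
  unfolding integrable_bicomplex_iff idem_V_integrand
  using assms by (auto simp only: L2_bc_iff intro!: integrable_mult_right L2_mult_integrable bkernel_L2[OF \<sigma>])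

text \<open>The daggered prefactor supplies each component with the Gaussian of the other plane.
  With the Gaussian of its own plane from the integral this makes up the full
  \<open>weight\<close>.\<close>

lemma idem_S0:
  assumes \<phi>: "\<phi> \<in> L2_bc lebesgue"
  shows "idem_plus (S0_transform \<sigma> \<nu> \<mu> \<phi> Z) = component \<sigma> (idem_plus \<nu>) point1 (plus_part \<phi>) Z"
    and "idem_minus (S0_transform \<sigma> \<nu> \<mu> \<phi> Z) = component \<sigma> (idem_minus \<mu>) point2 (minus_part \<phi>) Z"
proof -
  note I = idem_integral[OF V_integrand_integrable[OF \<phi>], of Z, unfolded idem_V_integrand integral_mult_right_zero,
      folded btransform_def]
  have c: "(\<sigma> / pi) powr (5/4) = (\<sigma> / pi) powr (1/4) * (\<sigma> / pi)"
    using \<sigma> powr_add[of "\<sigma> / pi" "1/4" 1] by simp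
  have E: "idem_plus (bc_exp (- (\<sigma> / 4) *\<^sub>R ((X_e_dagger Z)\<^sup>2 + (Y_e_dagger Z)\<^sup>2))) =
      of_real (exp (- (\<sigma> / 4) * (norm (point2 Z))\<^sup>2))"
    "idem_minus (bc_exp (- (\<sigma> / 4) *\<^sub>R ((X_e_dagger Z)\<^sup>2 + (Y_e_dagger Z)\<^sup>2))) =
      of_real (exp (- (\<sigma> / 4) * (norm (point1 Z))\<^sup>2))"
    by (simp_all add: X_e_dagger_def Y_e_dagger_def point1_def point2_def norm_prod_def scaleR_conv_of_real
        exp_of_real[symmetric])
  have w: "weight \<sigma> Z = exp (- (\<sigma> / 4) * (norm (point1 Z))\<^sup>2) * exp (- (\<sigma> / 4) * (norm (point2 Z))\<^sup>2)"
    by (simp only: weight_def exp_add[symmetric] distrib_left)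
  show "idem_plus (S0_transform \<sigma> \<nu> \<mu> \<phi> Z) = component \<sigma> (idem_plus \<nu>) point1 (plus_part \<phi>) Z"
    unfolding S0_transform_def V_transform_def component_def idem_linear idem_plus_times E I w c
    by (simp only: scaleR_conv_of_real of_real_mult mult_ac)
  show "idem_minus (S0_transform \<sigma> \<nu> \<mu> \<phi> Z) = component \<sigma> (idem_minus \<mu>) point2 (minus_part \<phi>) Z"
    unfolding S0_transform_def V_transform_def component_def idem_linear idem_minus_times E I w c
    by (simp only: scaleR_conv_of_real of_real_mult mult_ac)
qed

lemma idem_z: "idem_plus (z1_nu \<nu> Z) = plane (idem_plus \<nu>) (point1 Z)" "idem_minus (z2_mu \<mu> Z) = plane (idem_minus \<mu>) (point2 Z)"
  by (simp_all add: z1_nu_def z2_mu_def plane_def point1_def point2_def)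

lemma idem_Z_e:
  "idem_plus (Z_e \<nu> \<mu> Z) = plane (idem_plus \<nu>) (point1 Z)" "idem_minus (Z_e \<nu> \<mu> Z) = plane (idem_minus \<mu>) (point2 Z)"
  by (simp_all add: Z_e_def idem_z)

lemma exp_norm_Z_e: "exp (- (\<sigma> / 2) * (norm (Z_e \<nu> \<mu> Z))\<^sup>2) = weight \<sigma> Z"
  by (simp add: norm_bicomplex_def idem_Z_e norm_plane units weight_def)

text \<open>Both inclusions reduce to the complex case: \<open>btransform_surj\<close> for functions
  of the target space and \<open>btransform_in_bargmann\<close> for images, with the constant
  (\<sigma>/\<pi>)^(5/4) moved inside the transform by linearity.\<close>

lemma M_space_eq: "M_space \<sigma> \<nu> \<mu> = S0_transform \<sigma> \<nu> \<mu> ` L2_bc lebesgue"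
proof (intro equalityI subsetI)
  let ?C = "complex_of_real ((\<sigma> / pi) powr (5/4))"
  have C: "?C \<noteq> 0" using \<sigma> by simp
  fix f assume "f \<in> M_space \<sigma> \<nu> \<mu>"
  then obtain F G where FG: "F \<in> bargmann (\<sigma> / 2) (idem_plus \<nu>)" "G \<in> bargmann (\<sigma> / 2) (idem_minus \<mu>)"
    and f: "f = (\<lambda>Z. weight \<sigma> Z *\<^sub>R
      (of_cx (F (plane (idem_plus \<nu>) (point1 Z))) * e_plus + of_cx (G (plane (idem_minus \<mu>) (point2 Z))) * e_minus))"
    unfolding M_space_def idem_z exp_norm_Z_e by blast
  obtain g where g: "g \<in> L2_complex lebesgue" "btransform \<sigma> g = F"
    using btransform_surj[OF \<sigma> units(1) FG(1)] .
  obtain h where h: "h \<in> L2_complex lebesgue" "btransform \<sigma> h = G"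
    using btransform_surj[OF \<sigma> units(2) FG(2)] .
  define \<phi> where "\<phi> t = of_cx (1 / ?C * g t) * e_plus + of_cx (1 / ?C * h t) * e_minus" for t
  have p: "plus_part \<phi> = (\<lambda>t. 1 / ?C * g t)" "minus_part \<phi> = (\<lambda>t. 1 / ?C * h t)"
    by (simp_all only: \<phi>_def idem_combine)
  have \<phi>: "\<phi> \<in> L2_bc lebesgue"
    unfolding L2_bc_iff p by (intro conjI L2_cmult g h)
  have "S0_transform \<sigma> \<nu> \<mu> \<phi> Z = f Z" for Z
    unfolding bicomplex_eq_idem idem_S0[OF \<phi>] p component_def btransform_linear(2)[OF \<sigma> g(1) g(1)]
      btransform_linear(2)[OF \<sigma> h(1) h(1)] g(2) h(2) f
    using C by (simp only: idem_linear idem_combine scaleR_conv_of_real) simp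
  then have "f = S0_transform \<sigma> \<nu> \<mu> \<phi>"
    by (simp add: fun_eq_iff)
  with \<phi> show "f \<in> S0_transform \<sigma> \<nu> \<mu> ` L2_bc lebesgue"
    by blast
next
  let ?C = "complex_of_real ((\<sigma> / pi) powr (5/4))"
  fix f assume "f \<in> S0_transform \<sigma> \<nu> \<mu> ` L2_bc lebesgue"
  then obtain \<phi> where \<phi>: "\<phi> \<in> L2_bc lebesgue" and f: "f = S0_transform \<sigma> \<nu> \<mu> \<phi>"
    by blast
  then have p: "plus_part \<phi> \<in> L2_complex lebesgue" "minus_part \<phi> \<in> L2_complex lebesgue"
    by (simp_all add: L2_bc_iff)
  define F where "F = btransform \<sigma> (\<lambda>t. ?C * idem_plus (\<phi> t))"
  define G where "G = btransform \<sigma> (\<lambda>t. ?C * idem_minus (\<phi> t))"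
  have "f Z = weight \<sigma> Z *\<^sub>R
      (of_cx (F (plane (idem_plus \<nu>) (point1 Z))) * e_plus + of_cx (G (plane (idem_minus \<mu>) (point2 Z))) * e_minus)" for Z
    unfolding bicomplex_eq_idem f idem_S0[OF \<phi>] component_def F_def G_def
      btransform_linear(2)[OF \<sigma> p(1) p(1)] btransform_linear(2)[OF \<sigma> p(2) p(2)]
    by (simp only: idem_linear idem_combine scaleR_conv_of_real) simp
  moreover have "F \<in> bargmann (\<sigma> / 2) (idem_plus \<nu>)" "G \<in> bargmann (\<sigma> / 2) (idem_minus \<mu>)"
    unfolding F_def G_def by (intro btransform_in_bargmann \<sigma> units L2_cmult p)+
  ultimately show "f \<in> M_space \<sigma> \<nu> \<mu>"
    unfolding M_space_def idem_z exp_norm_Z_e by (intro CollectI exI[of _ F] exI[of _ G]) auto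
qed

section \<open>Isometry, inner products and the Hilbert space property\<close>

lemma S0_L2:
  assumes \<phi>: "\<phi> \<in> L2_bc lebesgue"
  shows "S0_transform \<sigma> \<nu> \<mu> \<phi> \<in> L2_bc lebesgue_bc"
  unfolding L2_bc_iff idem_S0[OF \<phi>]
  using \<phi> by (auto simp: L2_bc_iff intro: component_isometry[OF \<sigma>] units)

text \<open>A bicomplex scalar acts on the idempotent components by two separate complex scalars, so
  complex linearity of each component suffices. Both squared component norms are preserved, hence so
  is any function of them, in particular \<open>norm_bc\<close>.\<close>

lemma S0_isometry: "bc_isometry_onto lebesgue lebesgue_bc (M_space \<sigma> \<nu> \<mu>) (S0_transform \<sigma> \<nu> \<mu>)"
  unfolding bc_isometry_onto_def
proof (intro conjI ballI allI impI)
  show "S0_transform \<sigma> \<nu> \<mu> ` L2_bc lebesgue = M_space \<sigma> \<nu> \<mu>"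
    by (rule M_space_eq[symmetric])
next
  fix f g :: "real \<Rightarrow> bicomplex" assume f: "f \<in> L2_bc lebesgue" and g: "g \<in> L2_bc lebesgue"
  have parts: "plus_part f \<in> L2_complex lebesgue" "minus_part f \<in> L2_complex lebesgue"
    "plus_part g \<in> L2_complex lebesgue" "minus_part g \<in> L2_complex lebesgue"
    using f g by (simp_all add: L2_bc_iff)
  show "S0_transform \<sigma> \<nu> \<mu> (\<lambda>x. f x + g x) = (\<lambda>y. S0_transform \<sigma> \<nu> \<mu> f y + S0_transform \<sigma> \<nu> \<mu> g y)"
    by (intro ext, unfold bicomplex_eq_idem idem_linear idem_S0[OF L2_bc_ops(1)[OF f g]] idem_S0[OF f] idem_S0[OF g])
      (intro conjI component_linear(1) \<sigma> parts)
  show "S0_transform \<sigma> \<nu> \<mu> f = S0_transform \<sigma> \<nu> \<mu> g" if "AE x in lebesgue. f x = g x"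
  proof -
    have ae: "AE x in lebesgue. idem_plus (f x) = idem_plus (g x)" "AE x in lebesgue. idem_minus (f x) = idem_minus (g x)"
      using that by (auto elim: AE_mp)
    show ?thesis
      by (intro ext, unfold bicomplex_eq_idem idem_S0[OF f] idem_S0[OF g] component_def
          btransform_cong_AE[OF \<sigma> parts(1) parts(3) ae(1)] btransform_cong_AE[OF \<sigma> parts(2) parts(4) ae(2)]) simp
  qed
next
  fix c and f :: "real \<Rightarrow> bicomplex" assume f: "f \<in> L2_bc lebesgue"
  then have parts: "plus_part f \<in> L2_complex lebesgue" "minus_part f \<in> L2_complex lebesgue"
    by (simp_all add: L2_bc_iff)
  show "S0_transform \<sigma> \<nu> \<mu> (\<lambda>x. c * f x) = (\<lambda>y. c * S0_transform \<sigma> \<nu> \<mu> f y)"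
    by (intro ext, unfold bicomplex_eq_idem idem_plus_times idem_minus_times idem_S0[OF L2_bc_ops(3)[OF f]] idem_S0[OF f])
      (intro conjI component_linear(2)[OF \<sigma> parts(1) parts(1)] component_linear(2)[OF \<sigma> parts(2) parts(2)])
  have "(norm_bc lebesgue_bc (S0_transform \<sigma> \<nu> \<mu> f))\<^sup>2 = (norm_bc lebesgue f)\<^sup>2"
    unfolding norm_bc_sq[OF S0_L2[OF f]] norm_bc_sq[OF f] idem_S0[OF f]
    by (simp only: component_isometry[OF \<sigma> units(1) disjI1[OF refl] parts(1)]
        component_isometry[OF \<sigma> units(2) disjI2[OF refl] parts(2)])
  then show "norm_bc lebesgue_bc (S0_transform \<sigma> \<nu> \<mu> f) = norm_bc lebesgue f"
    by simp
qed

lemma S0_inner: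
  assumes f: "f \<in> L2_bc lebesgue" and g: "g \<in> L2_bc lebesgue"
  shows "inner_bc lebesgue_bc (S0_transform \<sigma> \<nu> \<mu> f) (S0_transform \<sigma> \<nu> \<mu> g) = inner_bc lebesgue f g"
  unfolding bicomplex_eq_idem idem_inner_bc[OF S0_L2[OF f] S0_L2[OF g]] idem_inner_bc[OF f g] idem_S0[OF f] idem_S0[OF g]
  using f g unfolding L2_bc_iff
  by (intro conjI component_inner \<sigma> units disjI1[OF refl] disjI2[OF refl]) auto

lemma M_space_hilbert: "bc_hilbert lebesgue_bc (M_space \<sigma> \<nu> \<mu>)"
  by (rule bc_hilbert_of_isometry[OF S0_isometry]) (use S0_L2 in \<open>auto simp: M_space_eq\<close>)

section \<open>The orthogonal basis and its norms\<close>

definition herm_scale :: "nat \<Rightarrow> real"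
  where "herm_scale n = (\<sigma> / pi) powr (3/4) * \<sigma> ^ n / ((\<sigma> / pi) powr (5/4) * hnorm \<sigma> n)"

definition herm_bc :: "nat \<Rightarrow> real \<Rightarrow> bicomplex"
  where "herm_bc n t = of_real (herm_scale n * herm \<sigma> n t)"

lemma herm_scale_pos: "herm_scale n > 0"
  using \<sigma> hnorm_pos[OF \<sigma>, of n] by (simp add: herm_scale_def)

lemma idem_herm_bc:
  "plus_part (herm_bc n) = (\<lambda>t. of_real (herm_scale n) * of_real (herm \<sigma> n t))"
  "minus_part (herm_bc n) = (\<lambda>t. of_real (herm_scale n) * of_real (herm \<sigma> n t))"
  by (simp_all add: herm_bc_def fun_eq_iff)

lemma herm_bc_L2: "herm_bc n \<in> L2_bc lebesgue"
  unfolding L2_bc_iff idem_herm_bc by (intro conjI L2_cmult herm_L2 \<sigma>)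

text \<open>The value of \<open>herm_scale\<close> is dictated by this identity: the component of a
  Hermite function is the monomial z^n with factor (\<sigma>/\<pi>)^(5/4) \<open>hnorm\<close>,
  which has to become (\<sigma>/\<pi>)^(3/4) \<sigma>^n.\<close>

lemma S0_herm_bc: "S0_transform \<sigma> \<nu> \<mu> (herm_bc n) = phi_n \<sigma> \<nu> \<mu> n"
proof
  fix Z
  have eq: "of_real ((\<sigma> / pi) powr (5/4)) * btransform \<sigma> (\<lambda>t. of_real (herm_scale n) * of_real (herm \<sigma> n t)) z =
      of_real ((\<sigma> / pi) powr (3/4) * \<sigma> ^ n) * z ^ n" for z :: complex
  proof -
    have c: "(\<sigma> / pi) powr (5/4) * (herm_scale n * hnorm \<sigma> n) = (\<sigma> / pi) powr (3/4) * \<sigma> ^ n"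
      using \<sigma> hnorm_pos[OF \<sigma>, of n] by (simp add: herm_scale_def)
    show ?thesis
      unfolding btransform_linear(2)[OF \<sigma> herm_L2[OF \<sigma>] herm_L2[OF \<sigma>]] btransform_herm[OF \<sigma>] c[symmetric]
      by (simp only: of_real_mult mult.assoc)
  qed
  show "S0_transform \<sigma> \<nu> \<mu> (herm_bc n) Z = phi_n \<sigma> \<nu> \<mu> n Z"
    unfolding bicomplex_eq_idem idem_S0[OF herm_bc_L2] idem_herm_bc component_def eq phi_n_def exp_norm_Z_e
      idem_linear idem_power idem_Z_e
    by (simp add: scaleR_conv_of_real mult_ac)
qed

lemma orthogonal_phi_n:
  assumes "m \<noteq> n"
  shows "inner_bc lebesgue_bc (phi_n \<sigma> \<nu> \<mu> m) (phi_n \<sigma> \<nu> \<mu> n) = 0"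
proof -
  have "(\<integral>t. complex_of_real (herm_scale m) * of_real (herm \<sigma> m t) * cnj (of_real (herm_scale n) * of_real (herm \<sigma> n t)) \<partial>lebesgue) =
      (\<integral>t. of_real (herm_scale m * herm_scale n) * of_real (herm \<sigma> m t * herm \<sigma> n t) \<partial>lebesgue)"
    by (simp add: mult_ac)
  also have "\<dots> = 0"
    unfolding integral_mult_right_zero integral_complex_of_real herm_orthogonal[OF \<sigma>] using assms by simp
  finally show ?thesis
    unfolding S0_herm_bc[symmetric] S0_inner[OF herm_bc_L2 herm_bc_L2] bicomplex_eq_idem
      idem_inner_bc[OF herm_bc_L2 herm_bc_L2] idem_herm_bc[THEN fun_cong] by simp
qed

text \<open>Pulled back along the isometry, a bicomplex expansion is a pair of complex Hermite
  expansions, one for each idempotent coordinate of the coefficients.\<close>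

lemma phi_n_expansion:
  assumes \<phi>: "\<phi> \<in> L2_bc lebesgue"
  shows "\<exists>!c. (\<lambda>N. norm_bc lebesgue_bc (\<lambda>Z. S0_transform \<sigma> \<nu> \<mu> \<phi> Z - (\<Sum>n<N. c n * phi_n \<sigma> \<nu> \<mu> n Z))) \<longlonglongrightarrow> 0"
proof -
  interpret complete_orthogonal_system lebesgue "herm \<sigma>" "hnorm \<sigma>"
    by (rule complete_orthogonal_herm[OF \<sigma>])
  have parts: "plus_part \<phi> \<in> L2_complex lebesgue" "minus_part \<phi> \<in> L2_complex lebesgue"
    using \<phi> by (simp_all add: L2_bc_iff)
  \<comment> \<open>An equivalence for arbitrary \<open>c\<close>, so that existence and uniqueness
    both reduce to solving for the two idempotent coordinates of \<open>c n\<close>.\<close>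
  have conv: "(\<lambda>N. norm_bc lebesgue_bc (\<lambda>Z. S0_transform \<sigma> \<nu> \<mu> \<phi> Z - (\<Sum>n<N. c n * phi_n \<sigma> \<nu> \<mu> n Z))) \<longlonglongrightarrow> 0 \<longleftrightarrow>
    (\<forall>n. idem_plus (c n) * of_real (herm_scale n) = coef (plus_part \<phi>) n) \<and>
    (\<forall>n. idem_minus (c n) * of_real (herm_scale n) = coef (minus_part \<phi>) n)" (is "?L \<longleftrightarrow> ?R") for c
  proof -
    let ?p = "\<lambda>n. idem_plus (c n) * of_real (herm_scale n)"
    let ?m = "\<lambda>n. idem_minus (c n) * of_real (herm_scale n)"
    have L2: "(\<lambda>x. \<phi> x - (\<Sum>n<N. c n * herm_bc n x)) \<in> L2_bc lebesgue" for N
      by (rule L2_bc_ops(2)[OF \<phi> conjunct2[OF isometry_sum[OF S0_isometry herm_bc_L2]]])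
    have ps: "plus_part (\<lambda>x. \<phi> x - (\<Sum>n<N. c n * herm_bc n x)) = (\<lambda>x. idem_plus (\<phi> x) - psum ?p N x)"
      "minus_part (\<lambda>x. \<phi> x - (\<Sum>n<N. c n * herm_bc n x)) = (\<lambda>x. idem_minus (\<phi> x) - psum ?m N x)" for N
      unfolding psum_def idem_linear idem_sum idem_plus_times idem_minus_times
      by (simp_all only: idem_herm_bc[THEN fun_cong] mult.assoc)
    have "?L \<longleftrightarrow> (\<lambda>N. norm_bc lebesgue (\<lambda>x. \<phi> x - (\<Sum>n<N. c n * herm_bc n x))) \<longlonglongrightarrow> 0"
      unfolding S0_herm_bc[symmetric] isometry_norm_expansion[OF S0_isometry herm_bc_L2 \<phi>] ..
    also have "\<dots> \<longleftrightarrow> (\<lambda>N. l2_sq lebesgue (\<lambda>x. idem_plus (\<phi> x) - psum ?p N x)) \<longlonglongrightarrow> 0 \<and>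
        (\<lambda>N. l2_sq lebesgue (\<lambda>x. idem_minus (\<phi> x) - psum ?m N x)) \<longlonglongrightarrow> 0"
      unfolding norm_bc_tendsto_0_iff[OF L2] ps ..
    also have "\<dots> \<longleftrightarrow> ?p = coef (plus_part \<phi>) \<and> ?m = coef (minus_part \<phi>)"
      unfolding expansion_iff[OF parts(1)] expansion_iff[OF parts(2)] ..
    finally show ?thesis
      by (simp only: fun_eq_iff)
  qed
  define c0 where "c0 n = of_cx (coef (plus_part \<phi>) n / of_real (herm_scale n)) * e_plus +
    of_cx (coef (minus_part \<phi>) n / of_real (herm_scale n)) * e_minus" for n
  have nz: "complex_of_real (herm_scale n) \<noteq> 0" for n
    using herm_scale_pos[of n] by simp
  have c0: "idem_plus (c0 n) = coef (plus_part \<phi>) n / of_real (herm_scale n)"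
    "idem_minus (c0 n) = coef (minus_part \<phi>) n / of_real (herm_scale n)" for n
    by (simp_all only: c0_def idem_combine)
  show ?thesis
    unfolding conv
  proof (intro ex1I[of _ c0] conjI allI)
    show "idem_plus (c0 n) * of_real (herm_scale n) = coef (plus_part \<phi>) n"
      "idem_minus (c0 n) * of_real (herm_scale n) = coef (minus_part \<phi>) n" for n
      using nz[of n] by (simp_all add: c0)
    fix c
    assume c: "(\<forall>n. idem_plus (c n) * of_real (herm_scale n) = coef (plus_part \<phi>) n) \<and>
      (\<forall>n. idem_minus (c n) * of_real (herm_scale n) = coef (minus_part \<phi>) n)"
    show "c = c0"
    proof
      fix n
      have "idem_plus (c n) = idem_plus (c0 n)" "idem_minus (c n) = idem_minus (c0 n)"
        using c nz[of n] by (simp_all add: c0 eq_divide_eq)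
      then show "c n = c0 n"
        by (simp add: bicomplex_eq_idem)
    qed
  qed
qed

lemma phi_n_basis: "bc_orthogonal_basis lebesgue_bc (M_space \<sigma> \<nu> \<mu>) (phi_n \<sigma> \<nu> \<mu>)"
  unfolding bc_orthogonal_basis_def
proof (intro conjI allI impI ballI)
  show "phi_n \<sigma> \<nu> \<mu> n \<in> M_space \<sigma> \<nu> \<mu>" for n
    unfolding M_space_eq S0_herm_bc[symmetric] by (intro imageI herm_bc_L2)
  show "inner_bc lebesgue_bc (phi_n \<sigma> \<nu> \<mu> m) (phi_n \<sigma> \<nu> \<mu> n) = 0" if "m \<noteq> n" for m n
    by (rule orthogonal_phi_n[OF that])
  fix f assume "f \<in> M_space \<sigma> \<nu> \<mu>"
  then obtain \<phi> where "\<phi> \<in> L2_bc lebesgue" "f = S0_transform \<sigma> \<nu> \<mu> \<phi>"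
    unfolding M_space_eq by blast
  then show "\<exists>!c. (\<lambda>N. norm_bc lebesgue_bc (\<lambda>x. f x - (\<Sum>n<N. c n * phi_n \<sigma> \<nu> \<mu> n x))) \<longlonglongrightarrow> 0"
    using phi_n_expansion by simp
qed

text \<open>The norm is computed on the line. Both components of \<open>herm_bc n\<close> are the
  same function, so the quadratic mean of their squared norms is that common value.\<close>

lemma norm_phi_n:
  "(norm_bc lebesgue_bc (phi_n \<sigma> \<nu> \<mu> n))\<^sup>2 = (pi / \<sigma>) powr (1/2) * 2 ^ n * \<sigma> ^ n * fact n"
proof -
  have "l2_sq lebesgue (\<lambda>t. complex_of_real (herm \<sigma> n t)) = hnorm \<sigma> n"
    using herm_orthogonal[OF \<sigma>, of n n] by (simp add: l2_sq_def power2_eq_square)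
  then have l2: "l2_sq lebesgue (\<lambda>t. complex_of_real (herm_scale n) * of_real (herm \<sigma> n t)) = (herm_scale n)\<^sup>2 * hnorm \<sigma> n"
    by (simp add: l2_sq_cmult)
  have "(norm_bc lebesgue_bc (phi_n \<sigma> \<nu> \<mu> n))\<^sup>2 = (norm_bc lebesgue (herm_bc n))\<^sup>2"
    unfolding S0_herm_bc[symmetric] isometry_norm[OF S0_isometry herm_bc_L2] ..
  also have "\<dots> = (herm_scale n)\<^sup>2 * hnorm \<sigma> n"
    unfolding norm_bc_sq[OF herm_bc_L2] idem_herm_bc l2 using hnorm_pos[OF \<sigma>, of n] by simp
  also have "\<dots> = (pi / \<sigma>) powr (1/2) * 2 ^ n * \<sigma> ^ n * fact n"
  proof -
    define r where "r = sqrt (\<sigma> / pi)"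
    have r: "r > 0" "\<sigma> / pi = r\<^sup>2" using \<sigma> by (simp_all add: r_def)
    have "(\<sigma> / pi) powr (5/4) = (\<sigma> / pi) powr (3/4) * (\<sigma> / pi) powr (1/2)"
      by (simp flip: powr_add)
    then have "(\<sigma> / pi) powr (5/4) = (\<sigma> / pi) powr (3/4) * r"
      using \<sigma> by (simp add: powr_half_sqrt r_def)
    \<comment> \<open>The powers 3/4 and 5/4 of \<sigma>/\<pi> leave 1/r, so the squared norm
      becomes \<sigma>^(2n) / (r^2 \<open>hnorm\<close>).\<close>
    then have sc: "herm_scale n = \<sigma> ^ n / (r * hnorm \<sigma> n)"
      using \<sigma> by (simp add: herm_scale_def)
    have q: "sqrt (pi / \<sigma>) = 1 / r"
      by (simp add: r_def real_sqrt_divide)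
    then have h: "hnorm \<sigma> n = 1 / r * (\<sigma> ^ n / 2 ^ n) / fact n"
      by (simp add: hnorm_def power_divide)
    have "(pi / \<sigma>) powr (1/2) = 1 / r"
      using \<sigma> q by (simp add: powr_half_sqrt)
    then show ?thesis
      unfolding sc h using r(1) \<sigma> by (simp add: field_simps power2_eq_square)
  qed
  finally show ?thesis .
qed

end

theorem theorem3p7:
  fixes \<sigma> :: real and \<nu> \<mu> :: bicomplex
  assumes "\<sigma> > 0" and "\<nu>\<^sup>2 = -1" and "\<mu>\<^sup>2 = -1"
  shows "(\<forall>\<phi> \<in> L2_bc lebesgue. \<forall>Z. integrable lebesgue (V_integrand \<sigma> \<nu> \<mu> \<phi> (psi0 \<sigma>) Z)) \<and>
    bc_hilbert lebesgue_bc (M_space \<sigma> \<nu> \<mu>) \<and>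
    bc_isometry_onto lebesgue lebesgue_bc (M_space \<sigma> \<nu> \<mu>) (S0_transform \<sigma> \<nu> \<mu>) \<and>
    bc_orthogonal_basis lebesgue_bc (M_space \<sigma> \<nu> \<mu>) (phi_n \<sigma> \<nu> \<mu>) \<and>
    (\<forall>n. (norm_bc lebesgue_bc (phi_n \<sigma> \<nu> \<mu> n))\<^sup>2 = (pi / \<sigma>) powr (1/2) * 2 ^ n * \<sigma> ^ n * fact n)"
proof -
  interpret bicomplex_bargmann \<sigma> \<nu> \<mu>
    using assms by unfold_locales
  show ?thesis
    using V_integrand_integrable M_space_hilbert S0_isometry phi_n_basis norm_phi_n by blast
qed

end
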